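(* Let $K$ be a compact space. Then the following conditions are equivalent: (1) $K$ is Eberlein. (2) There exist a bounded set $\mathcal{A}\subset \mathcal{C}(K)$ separating the points of $K$ and a retractional skeleton $\mathfrak{s}=(r_s)_{s\in\Gamma}$ on $K$ such that $\mathfrak{s}$ is $\mathcal{A}$-shrinking. (3) There exist a countable family $\mathcal{A}$ of subsets of $B_{\mathcal{C}(K)}$ and a full retractional skeleton $\mathfrak{s}=(r_s)_{s\in\Gamma}$ on $K$ such that (a) for every $A\in\mathcal{A}$ there exists $\varepsilon_A>0$ such that $\mathfrak{s}$ is $(A,\varepsilon_A)$-shrinking, and (b) for every $\varepsilon>0$ we have $B_{\mathcal{C}(K)}=\bigcup\{A\in\mathcal{A}: \varepsilon_A<\varepsilon\}$.
   Context: All topological spaces are Tychonoff (in particular Hausdorff). $\mathcal{C}(K)$ is the Banach space of real-valued continuous functions on $K$ with the supremum norm, and $B_{\mathcal{C}(K)}$ is its closed unit ball. For a set $I$, $c_0(I)=\{x\in\mathbb{R}^I : \forall \varepsilon>0,\ \{i\in I: |x(i)|>\varepsilon\}\text{ is finite}\}\subset\mathbb{R}^I$ with the topology inherited from the product topology. A compact space is Eberlein if it embeds homeomorphically into $c_0(I)$ for some set $I$. Up-directed means nonempty and any two elements have an upper bound. An up-directed partially ordered set $\Gamma$ is $\sigma$-complete if every increasing sequence $(s_n)_{n\in\omega}$ ($s_n\le s_{n+1}$) has a supremum in $\Gamma$. A retractional skeleton on $K$ is a family $\mathfrak{s}=(r_s)_{s\in\Gamma}$ of continuous retractions on $K$ indexed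 by an up-directed $\sigma$-complete partially ordered set $\Gamma$ such that: (i) $r_s[K]$ is a metrizable compact space for each $s\in\Gamma$; (ii) if $s\le t$ then $r_s=r_t\circ r_s=r_s\circ r_t$; (iii) if $(s_n)_{n\in\omega}$ is increasing in $\Gamma$ and $s=\sup_n s_n$, then $r_s(x)=\lim_n r_{s_n}(x)$ for every $x\in K$; (iv) $x=\lim_{s\in\Gamma}r_s(x)$ for every $x\in K$. The set induced by $\mathfrak{s}$ is $D(\mathfrak{s})=\bigcup_{s\in\Gamma}r_s[K]$; $\mathfrak{s}$ is full if $D(\mathfrak{s})=K$. For a nonempty bounded $\mathcal{A}\subset\mathcal{C}(K)$ put $\rho_{\mathcal{A}}(k,l)=\sup_{f\in\mathcal{A}}|f(k)-f(l)|$ for $k,l\in K$. The skeleton $\mathfrak{s}$ is $\mathcal{A}$-shrinking if for every $x\in K$ and every increasing sequence $(s_n)_{n\in\omega}$ in $\Gamma$ with $s=\sup_n s_n$ we have $\lim_n\rho_{\mathcal{A}}(r_{s_n}(x),r_s(x))=0$. For $\varepsilon>0$, $\mathfrak{s}$ is $(\mathcal{A},\varepsilon)$-shrinking if for all such $x$, $(s_n)$, $s$ we have $\limsup_n\rho_{\mathcal{A}}(r_{s_n}(x),r_s(x))\le\varepsilon$. *)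

theory Defs
  imports "HOL-Analysis.Analysis"
begin

section \<open>Eberlein compacta\<close>

text \<open>
  Points of \<^term>\<open>powertop_real I\<close> are functions that are \<^term>\<open>undefined\<close> off \<open>I\<close>.
\<close>

definition c0_space :: "'i set \<Rightarrow> ('i \<Rightarrow> real) topology" where
  "c0_space I = subtopology (powertop_real I)
     {x. \<forall>\<epsilon>>0. finite {i \<in> I. \<bar>x i\<bar> > \<epsilon>}}"

text \<open>
  HOL cannot quantify over the type of the index set, so it is fixed to sets of real-valued
  functions on the points of the space. The lemma \<open>eberlein_compactI\<close> below shows that an
  embedding into \<open>c\<^sub>0(I)\<close> for a set \<open>I\<close> of any other type gives the same notion.
\<close>

definition eberlein_compact :: "'a topology \<Rightarrow> bool" where
  "eberlein_compact X \<longleftrightarrow> compact_space X \<and>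
     (\<exists>(I :: ('a \<Rightarrow> real) set) f. embedding_map X (c0_space I) f)"

lemma Hausdorff_c0_space: "Hausdorff_space (c0_space I)"
  unfolding c0_space_def
  by (intro Hausdorff_space_subtopology) (simp add: Hausdorff_space_product_topology)

lemma eberlein_compactI:
  fixes X :: "'a topology" and I :: "'i set"
  assumes X: "compact_space X" and f: "embedding_map X (c0_space I) f"
  shows "eberlein_compact X"
proof -
  have cf: "continuous_map X (c0_space I) f"
    using f unfolding embedding_map_def
    by (meson continuous_map_in_subtopology homeomorphic_imp_continuous_map)
  have inj: "inj_on f (topspace X)"
    using f by (simp add: embedding_map_def homeomorphic_eq_everything_map)
  define \<phi> where "\<phi> i = (\<lambda>x. f x i)" for i
  define J where "J = \<phi> ` I"
  define g where "g x = (\<lambda>j\<in>J. j x)" for x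
  have fc0: "f x \<in> topspace (c0_space I)" if "x \<in> topspace X" for x
    using cf that by (auto simp: continuous_map_def)
  have c\<phi>: "continuous_map X euclideanreal (\<phi> i)" if "i \<in> I" for i
    using cf that unfolding c0_space_def \<phi>_def
    by (simp add: continuous_map_in_subtopology continuous_map_componentwise)
  have fin: "finite {j \<in> J. \<bar>g x j\<bar> > \<epsilon>}" if "x \<in> topspace X" "\<epsilon> > 0" for x \<epsilon>
  proof (rule finite_surj)
    show "finite {i \<in> I. \<bar>f x i\<bar> > \<epsilon>}"
      using fc0[OF that(1)] that(2) by (simp add: c0_space_def)
    show "{j \<in> J. \<bar>g x j\<bar> > \<epsilon>} \<subseteq> \<phi> ` {i \<in> I. \<bar>f x i\<bar> > \<epsilon>}"
      by (auto simp: J_def g_def \<phi>_def)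
  qed
  have "continuous_map X (powertop_real J) g"
    unfolding continuous_map_componentwise
    by (auto simp: g_def J_def extensional_def) (use c\<phi> in \<open>simp add: eta_contract_eq\<close>)
  then have cg: "continuous_map X (c0_space J) g"
    using fin by (auto simp: c0_space_def continuous_map_in_subtopology)
  have "inj_on g (topspace X)"
  proof (rule inj_onI)
    fix x y assume xy: "x \<in> topspace X" "y \<in> topspace X" "g x = g y"
    have "f x i = f y i" if "i \<in> I" for i
      using fun_cong[OF xy(3), of "\<phi> i"] that by (simp add: g_def J_def \<phi>_def)
    moreover have "f x \<in> extensional I" "f y \<in> extensional I"
      using fc0[OF xy(1)] fc0[OF xy(2)] by (auto simp: c0_space_def PiE_def)
    ultimately have "f x = f y"
      by (meson extensionalityI)
    with inj xy show "x = y"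
      by (auto dest: inj_onD)
  qed
  then have "embedding_map X (c0_space J) g"
    by (intro continuous_imp_embedding_map X Hausdorff_c0_space cg)
  then show ?thesis
    using X unfolding eberlein_compact_def by blast
qed


section \<open>Retractional skeletons\<close>

definition up_directed :: "'i set \<Rightarrow> 'i rel \<Rightarrow> bool" where
  "up_directed \<Gamma> R \<longleftrightarrow> \<Gamma> \<noteq> {} \<and> (\<forall>s\<in>\<Gamma>. \<forall>t\<in>\<Gamma>. \<exists>u\<in>\<Gamma>. (s, u) \<in> R \<and> (t, u) \<in> R)"

definition increasing_seq :: "'i set \<Rightarrow> 'i rel \<Rightarrow> (nat \<Rightarrow> 'i) \<Rightarrow> bool" where
  "increasing_seq \<Gamma> R \<sigma> \<longleftrightarrow> (\<forall>n. \<sigma> n \<in> \<Gamma> \<and> (\<sigma> n, \<sigma> (Suc n)) \<in> R)"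

definition is_sup_seq :: "'i set \<Rightarrow> 'i rel \<Rightarrow> (nat \<Rightarrow> 'i) \<Rightarrow> 'i \<Rightarrow> bool" where
  "is_sup_seq \<Gamma> R \<sigma> s \<longleftrightarrow> s \<in> \<Gamma> \<and> (\<forall>n. (\<sigma> n, s) \<in> R) \<and>
     (\<forall>t\<in>\<Gamma>. (\<forall>n. (\<sigma> n, t) \<in> R) \<longrightarrow> (s, t) \<in> R)"

definition sigma_complete :: "'i set \<Rightarrow> 'i rel \<Rightarrow> bool" where
  "sigma_complete \<Gamma> R \<longleftrightarrow> (\<forall>\<sigma>. increasing_seq \<Gamma> R \<sigma> \<longrightarrow> (\<exists>s. is_sup_seq \<Gamma> R \<sigma> s))"

text \<open>Limits along this filter are limits of nets indexed by \<open>\<Gamma>\<close>.\<close>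

definition tails :: "'i set \<Rightarrow> 'i rel \<Rightarrow> 'i filter" where
  "tails \<Gamma> R = (INF s\<in>\<Gamma>. principal {t \<in> \<Gamma>. (s, t) \<in> R})"

lemma eventually_tails:
  assumes "partial_order_on \<Gamma> R" "up_directed \<Gamma> R"
  shows "eventually P (tails \<Gamma> R) \<longleftrightarrow> (\<exists>s\<in>\<Gamma>. \<forall>t\<in>\<Gamma>. (s, t) \<in> R \<longrightarrow> P t)"
proof -
  have "trans R"
    using assms(1) by (simp add: partial_order_on_def preorder_on_def)
  have "\<exists>x\<in>\<Gamma>. principal {t \<in> \<Gamma>. (x, t) \<in> R}
          \<le> inf (principal {t \<in> \<Gamma>. (a, t) \<in> R}) (principal {t \<in> \<Gamma>. (b, t) \<in> R})"
    if ab: "a \<in> \<Gamma>" "b \<in> \<Gamma>" for a b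
  proof -
    obtain u where "u \<in> \<Gamma>" "(a, u) \<in> R" "(b, u) \<in> R"
      using assms(2) ab unfolding up_directed_def by blast
    with \<open>trans R\<close> show ?thesis
      by (intro bexI[of _ u]) (auto dest: transD)
  qed
  then have "eventually P (tails \<Gamma> R) \<longleftrightarrow>
      (\<exists>s\<in>\<Gamma>. eventually P (principal {t \<in> \<Gamma>. (s, t) \<in> R}))"
    unfolding tails_def using assms(2)
    by (intro eventually_INF_base) (auto simp: up_directed_def)
  then show ?thesis
    by (auto simp: eventually_principal)
qed

definition retractional_skeleton ::
  "'a topology \<Rightarrow> 'i set \<Rightarrow> 'i rel \<Rightarrow> ('i \<Rightarrow> 'a \<Rightarrow> 'a) \<Rightarrow> bool" where
  "retractional_skeleton K \<Gamma> R r \<longleftrightarrow>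
     partial_order_on \<Gamma> R \<and> up_directed \<Gamma> R \<and> sigma_complete \<Gamma> R \<and>
     (\<forall>s\<in>\<Gamma>. continuous_map K K (r s) \<and> (\<forall>x\<in>topspace K. r s (r s x) = r s x)) \<and>
     (\<forall>s\<in>\<Gamma>. compact_space (subtopology K (r s ` topspace K)) \<and>
             metrizable_space (subtopology K (r s ` topspace K))) \<and>
     (\<forall>s\<in>\<Gamma>. \<forall>t\<in>\<Gamma>. (s, t) \<in> R \<longrightarrow>
        (\<forall>x\<in>topspace K. r s x = r t (r s x) \<and> r s x = r s (r t x))) \<and>
     (\<forall>\<sigma> s. increasing_seq \<Gamma> R \<sigma> \<and> is_sup_seq \<Gamma> R \<sigma> s \<longrightarrow>
        (\<forall>x\<in>topspace K. limitin K (\<lambda>n. r (\<sigma> n) x) (r s x) sequentially)) \<and>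
     (\<forall>x\<in>topspace K. limitin K (\<lambda>s. r s x) x (tails \<Gamma> R))"

definition induced_set :: "'a topology \<Rightarrow> 'i set \<Rightarrow> ('i \<Rightarrow> 'a \<Rightarrow> 'a) \<Rightarrow> 'a set" where
  "induced_set K \<Gamma> r = (\<Union>s\<in>\<Gamma>. r s ` topspace K)"

definition full_skeleton :: "'a topology \<Rightarrow> 'i set \<Rightarrow> ('i \<Rightarrow> 'a \<Rightarrow> 'a) \<Rightarrow> bool" where
  "full_skeleton K \<Gamma> r \<longleftrightarrow> induced_set K \<Gamma> r = topspace K"


section \<open>Shrinking\<close>

text \<open>
  The metric space \<open>C(K)\<close>: its points are \<^term>\<open>undefined\<close> off \<^term>\<open>topspace K\<close>, so that
  distinct points are distinct functions on \<open>K\<close>.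
\<close>

abbreviation cfun :: "'a topology \<Rightarrow> ('a \<Rightarrow> real) metric" where
  "cfun K \<equiv> cfunspace K euclidean_metric"

definition cfun_ball :: "'a topology \<Rightarrow> ('a \<Rightarrow> real) set" where
  "cfun_ball K = mcball_of (cfun K) (\<lambda>x\<in>topspace K. 0) 1"

definition bounded_cfun :: "'a topology \<Rightarrow> ('a \<Rightarrow> real) set \<Rightarrow> bool" where
  "bounded_cfun K A \<longleftrightarrow> Metric_space.mbounded (mspace (cfun K)) (mdist (cfun K)) A"

lemma mspace_cfun:
  assumes "compact_space K"
  shows "mspace (cfun K) = {f \<in> extensional (topspace K). continuous_map K euclideanreal f}"
proof -
  have "bounded (f ` topspace K)" if "continuous_map K euclideanreal f" for f
    using image_compactin[OF _ that] assms
    by (simp add: compact_space_def compact_imp_bounded)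
  then show ?thesis
    by auto
qed

definition separates_points :: "'a topology \<Rightarrow> ('a \<Rightarrow> real) set \<Rightarrow> bool" where
  "separates_points K A \<longleftrightarrow>
     (\<forall>x\<in>topspace K. \<forall>y\<in>topspace K. x \<noteq> y \<longrightarrow> (\<exists>f\<in>A. f x \<noteq> f y))"

text \<open>Only meaningful for nonempty bounded \<open>A\<close>; this is ensured wherever it is used.\<close>

definition rho :: "('a \<Rightarrow> real) set \<Rightarrow> 'a \<Rightarrow> 'a \<Rightarrow> real" where
  "rho A k l = (SUP f\<in>A. \<bar>f k - f l\<bar>)"

definition shrinking ::
  "'a topology \<Rightarrow> ('a \<Rightarrow> real) set \<Rightarrow> 'i set \<Rightarrow> 'i rel \<Rightarrow> ('i \<Rightarrow> 'a \<Rightarrow> 'a) \<Rightarrow> bool" where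
  "shrinking K A \<Gamma> R r \<longleftrightarrow>
     (\<forall>x\<in>topspace K. \<forall>\<sigma> s. increasing_seq \<Gamma> R \<sigma> \<and> is_sup_seq \<Gamma> R \<sigma> s \<longrightarrow>
        (\<lambda>n. rho A (r (\<sigma> n) x) (r s x)) \<longlonglongrightarrow> 0)"

definition eps_shrinking ::
  "'a topology \<Rightarrow> ('a \<Rightarrow> real) set \<Rightarrow> real \<Rightarrow> 'i set \<Rightarrow> 'i rel \<Rightarrow> ('i \<Rightarrow> 'a \<Rightarrow> 'a) \<Rightarrow> bool" where
  "eps_shrinking K A \<epsilon> \<Gamma> R r \<longleftrightarrow>
     (\<forall>x\<in>topspace K. \<forall>\<sigma> s. increasing_seq \<Gamma> R \<sigma> \<and> is_sup_seq \<Gamma> R \<sigma> s \<longrightarrow>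
        limsup (\<lambda>n. ereal (rho A (r (\<sigma> n) x) (r s x))) \<le> ereal \<epsilon>)"

text \<open>
  The type argument is the type of the elements of the index set \<open>\<Gamma>\<close> of the skeleton.
\<close>

definition has_shrinking_skeleton :: "'i itself \<Rightarrow> 'a topology \<Rightarrow> bool" where
  "has_shrinking_skeleton _ K \<longleftrightarrow>
     (\<exists>A (\<Gamma> :: 'i set) R r.
        A \<noteq> {} \<and> A \<subseteq> mspace (cfun K) \<and> bounded_cfun K A \<and> separates_points K A \<and>
        retractional_skeleton K \<Gamma> R r \<and> shrinking K A \<Gamma> R r)"

definition has_countably_shrinking_full_skeleton :: "'i itself \<Rightarrow> 'a topology \<Rightarrow> bool" where
  "has_countably_shrinking_full_skeleton _ K \<longleftrightarrow>
     (\<exists>\<A> (\<Gamma> :: 'i set) R r.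
        countable \<A> \<and> (\<forall>A\<in>\<A>. A \<noteq> {} \<and> A \<subseteq> cfun_ball K) \<and>
        retractional_skeleton K \<Gamma> R r \<and> full_skeleton K \<Gamma> r \<and>
        (\<exists>eps. (\<forall>A\<in>\<A>. eps A > 0 \<and> eps_shrinking K A (eps A) \<Gamma> R r) \<and>
               (\<forall>\<epsilon>>0. cfun_ball K = \<Union>{A \<in> \<A>. eps A < \<epsilon>})))"

end

(*
  (2) implies (3). If no s fixed x, repeated jumps of r_s(x) would violate shrinking, so the
  skeleton is full. By compactness each f in the unit ball has a modulus of continuity with respect
  to rho_A, and the functions with a common modulus form the sets required in (3).

  (3) implies (1). By induction on the cardinality of a directed set M of indices one finds
  functions that determine r_s(x) for all s in M and that split, for each epsilon, into countably
  many subfamilies of which only finitely many members exceed epsilon at a given point. If M is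
  uncountable, write it as an increasing chain of smaller directed sets M_m; every directed set
  has its own continuous retraction r_{M_m}, and the differences g - g o r_{M_m}, with g belonging
  to the next member of the chain, do the job: since jumps along increasing sequences are
  eventually small, only finitely many m matter at each point. Soft thresholding then yields an
  embedding into c_0.

  (1) implies (2). For K in c_0(I), restriction to J (extended by 0) is a retraction of K for
  cofinally many countable J, and the coordinate functions witness shrinking.
*)
theory Submission
  imports Defs
begin

section \<open>Topological preliminaries\<close>

text \<open>Suprema exist in the index set only along increasing sequences, so an uncountable
  directed \<open>M\<close> may have none and its retraction cannot be taken from the skeleton. It
  is built from cluster points of the nets \<open>r s x\<close> with \<open>s \<in> M\<close>.
  Uniqueness and continuity rest on one fact: the maps \<open>r s\<close> with
  \<open>s \<in> M\<close> separate the points of \<open>directed_range M\<close>. This is where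
  fullness enters: every point is fixed by some index, and interleaving such indices with those of
  \<open>M\<close> shows that a point of \<open>directed_range M\<close> is fixed by the supremum of
  a sequence from \<open>M\<close>.

  The functions of the induction are manufactured on the way and do not come from a family fixed
  beforehand. Jumps must therefore be controlled for the whole unit ball, up to a countable
  splitting; this is what the covering in (3) provides, and the differences are halved in order to
  stay in the ball. The number of the covering set containing \<open>g\<close> becomes part of the
  colour of the difference formed from \<open>g\<close>.\<close>

lemma finite_subset_incseq_UN:
  fixes S :: "nat \<Rightarrow> 'b set"
  assumes "finite F" "F \<subseteq> (\<Union>n. S n)" "\<And>m n. m \<le> n \<Longrightarrow> S m \<subseteq> S n"
  shows "\<exists>n. F \<subseteq> S n"
  using assms(1,2)
proof (induction rule: finite_induct)
  case (insert a F)
  then obtain m n where "F \<subseteq> S m" "a \<in> S n" by auto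
  then have "insert a F \<subseteq> S (max m n)"
    using assms(3)[of m "max m n"] assms(3)[of n "max m n"] by auto
  then show ?case by blast
qed simp

lemma closure_of_meets:
  "x \<in> X closure_of S \<Longrightarrow> openin X T \<Longrightarrow> x \<in> T \<Longrightarrow> \<exists>y\<in>S. y \<in> T"
  by (auto simp: in_closure_of)

lemma closedin_Collect_ball:
  assumes "\<And>i. i \<in> I \<Longrightarrow> closedin X {z \<in> topspace X. Q i z}"
  shows "closedin X {z \<in> topspace X. \<forall>i\<in>I. Q i z}"
proof -
  have eq: "{z \<in> topspace X. \<forall>i\<in>I. Q i z} = \<Inter>(insert (topspace X) ((\<lambda>i. {z \<in> topspace X. Q i z}) ` I))"
    by auto
  show ?thesis unfolding eq by (rule closedin_Inter) (use assms in auto)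
qed

text \<open>Later proofs index \<open>C\<close> by approximation requirements, any two of which
  follow from a third; a common point meets all of them at once.\<close>

lemma compact_space_directed_Inter:
  assumes X: "compact_space X" and "A \<noteq> {}"
    and cl: "\<And>a. a \<in> A \<Longrightarrow> closedin X (C a)"
    and ne: "\<And>a. a \<in> A \<Longrightarrow> C a \<noteq> {}"
    and dir: "\<And>a b. a \<in> A \<Longrightarrow> b \<in> A \<Longrightarrow> \<exists>c\<in>A. C c \<subseteq> C a \<inter> C b"
  shows "(\<Inter>a\<in>A. C a) \<noteq> {}"
proof -
  have low: "\<exists>c\<in>A. C c \<subseteq> \<Inter>\<F>" if "finite \<F>" "\<F> \<subseteq> C ` A" for \<F>
    using that
  proof (induction rule: finite_induct)
    case empty
    then show ?case using \<open>A \<noteq> {}\<close> by auto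
  next
    case (insert F \<F>)
    then obtain c a where "c \<in> A" "C c \<subseteq> \<Inter>\<F>" "a \<in> A" "F = C a"
      by auto
    moreover from dir[OF \<open>c \<in> A\<close> \<open>a \<in> A\<close>] obtain d where "d \<in> A" "C d \<subseteq> C c \<inter> C a"
      by blast
    ultimately show ?case
      by (intro bexI[of _ d]) auto
  qed
  have "\<Inter>\<F> \<noteq> {}" if "finite \<F>" "\<F> \<subseteq> C ` A" for \<F>
    using low[OF that] ne by fastforce
  then show ?thesis
    using X cl unfolding compact_space_fip by (metis (no_types, lifting) imageE)
qed

text \<open>The preimage of \<open>C\<close> is the first projection of the part of the graph over
  \<open>C\<close>, and projecting along a compact factor is a closed map. This suits retractions
  obtained by choice, of which only defining equations are known.\<close>

lemma continuous_map_from_closed_graph: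
  assumes "compact_space Y" and h: "h \<in> topspace X \<rightarrow> topspace Y"
    and cl: "closedin (prod_topology X Y) {z \<in> topspace X \<times> topspace Y. snd z = h (fst z)}"
  shows "continuous_map X Y h"
  unfolding continuous_map_closedin
proof (intro conjI ballI allI impI)
  show "h \<in> topspace X \<rightarrow> topspace Y"
    by (rule h)
  fix C assume C: "closedin Y C"
  have "closedin (prod_topology X Y)
     ({z \<in> topspace X \<times> topspace Y. snd z = h (fst z)} \<inter> topspace X \<times> C)"
    by (intro closedin_Int cl) (simp add: closedin_prod_Times_iff C)
  then have "closedin X
     (fst ` ({z \<in> topspace X \<times> topspace Y. snd z = h (fst z)} \<inter> topspace X \<times> C))"
    using closed_map_fst[OF assms(1), of X] unfolding closed_map_def by blast
  moreover have "fst ` ({z \<in> topspace X \<times> topspace Y. snd z = h (fst z)} \<inter> topspace X \<times> C)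
      = {x \<in> topspace X. h x \<in> C}"
    using h closedin_subset[OF C] by (force simp: image_iff)
  ultimately show "closedin X {x \<in> topspace X. h x \<in> C}"
    by simp
qed

text \<open>The compact complement of \<open>U\<close> is covered by the open sets on which some
  \<open>p i\<close> is bounded away from \<open>p i z\<close>; finitely many of them suffice, and
  \<open>y n\<close> eventually leaves each.\<close>

lemma limitin_compact_separated:
  assumes K: "compact_space K" and z: "z \<in> topspace K"
    and y: "eventually (\<lambda>n. y n \<in> topspace K) F"
    and p: "\<And>i. i \<in> I \<Longrightarrow> continuous_map K euclideanreal (p i)"
    and lim: "\<And>i. i \<in> I \<Longrightarrow> ((\<lambda>n. p i (y n)) \<longlongrightarrow> p i z) F"
    and sep: "\<And>w. w \<in> topspace K \<Longrightarrow> w \<noteq> z \<Longrightarrow> \<exists>i\<in>I. p i w \<noteq> p i z"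
  shows "limitin K y z F"
  unfolding limitin_def
proof (intro conjI allI impI z)
  fix U assume "openin K U \<and> z \<in> U"
  then have U: "openin K U" "z \<in> U" by auto
  define V where "V = (\<lambda>(i, n). {w \<in> topspace K. \<bar>p i w - p i z\<bar> > 1 / real (Suc n)})"
  have opV: "openin K (V a)" if aI: "a \<in> I \<times> UNIV" for a
  proof -
    obtain i n where a: "a = (i, n)" "i \<in> I" using aI by auto
    have "continuous_map K euclideanreal (\<lambda>w. \<bar>p i w - p i z\<bar>)"
      by (intro continuous_map_real_abs continuous_map_diff p a) auto
    from openin_continuous_map_preimage[OF this, of "{1 / real (Suc n)<..}"]
    show ?thesis by (simp add: a V_def)
  qed
  have "compactin K (topspace K - U)"
    using K U(1) closedin_compact_space by blast
  moreover have "topspace K - U \<subseteq> \<Union>(V ` (I \<times> UNIV))"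
  proof
    fix w assume w: "w \<in> topspace K - U"
    then obtain i where i: "i \<in> I" "p i w \<noteq> p i z"
      using sep U by (metis DiffE)
    then obtain n where "1 / real (Suc n) < \<bar>p i w - p i z\<bar>"
      using nat_approx_posE[of "\<bar>p i w - p i z\<bar>"] by auto
    then show "w \<in> \<Union>(V ` (I \<times> UNIV))"
      using i w by (auto simp: V_def)
  qed
  ultimately obtain \<F> where \<F>: "finite \<F>" "\<F> \<subseteq> V ` (I \<times> UNIV)" "topspace K - U \<subseteq> \<Union>\<F>"
    using opV unfolding compactin_def by (metis (no_types, lifting) imageE)
  then obtain B where B: "finite B" "B \<subseteq> I \<times> UNIV" "\<F> = V ` B"
    by (meson finite_subset_image)
  have "eventually (\<lambda>n. \<forall>b\<in>B. y n \<notin> V b) F"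
    unfolding eventually_ball_finite_distrib[OF B(1)]
  proof
    fix b assume "b \<in> B"
    then obtain i m where b: "b = (i, m)" "i \<in> I" using B by auto
    have "eventually (\<lambda>n. dist (p i (y n)) (p i z) < 1 / real (Suc m)) F"
      using lim[OF b(2)] by (rule tendstoD) simp
    then show "eventually (\<lambda>n. y n \<notin> V b) F"
      by eventually_elim (simp add: V_def b dist_real_def)
  qed
  with y show "eventually (\<lambda>n. y n \<in> U) F"
    by eventually_elim (use \<F> B in auto)
qed

text \<open>A countable subset of \<open>M\<close> need have no upper bound in \<open>M\<close>. The
  sequence replaces one: its supremum in the ambient sigma-complete index set lies above all of
  \<open>C\<close>.\<close>

lemma countable_dominating_seq:
  assumes M: "up_directed M R" and "trans R" and C: "countable C" "C \<subseteq> M"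
  obtains \<sigma> where "increasing_seq M R \<sigma>" "\<And>c. c \<in> C \<Longrightarrow> \<exists>n. (c, \<sigma> n) \<in> R"
proof -
  obtain m where m: "m \<in> M" using M by (auto simp: up_directed_def)
  \<comment> \<open>Inserting \<open>m\<close> keeps the enumerated set nonempty when
    \<open>C\<close> is empty.\<close>
  define e where "e = from_nat_into (insert m C)"
  have e: "e n \<in> M" for n
    using from_nat_into[of "insert m C" n] C m by (auto simp: e_def)
  have "\<exists>\<sigma>. \<forall>n. (\<sigma> n \<in> M \<and> (e n, \<sigma> n) \<in> R) \<and> (\<sigma> n, \<sigma> (Suc n)) \<in> R"
  proof (rule dependent_nat_choice)
    show "\<exists>x. x \<in> M \<and> (e 0, x) \<in> R"
      using M e unfolding up_directed_def by meson
    show "\<exists>y. (y \<in> M \<and> (e (Suc n), y) \<in> R) \<and> (x, y) \<in> R" if "x \<in> M \<and> (e n, x) \<in> R" for x n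
      using M e that unfolding up_directed_def by meson
  qed
  then obtain \<sigma> where \<sigma>: "\<And>n. \<sigma> n \<in> M \<and> (e n, \<sigma> n) \<in> R \<and> (\<sigma> n, \<sigma> (Suc n)) \<in> R"
    by blast
  show thesis
  proof
    show "increasing_seq M R \<sigma>" using \<sigma> by (simp add: increasing_seq_def)
    fix c assume "c \<in> C"
    then obtain n where "c = e n"
      unfolding e_def using from_nat_into_surj[of "insert m C" c] C by auto
    then show "\<exists>n. (c, \<sigma> n) \<in> R" using \<sigma> by blast
  qed
qed

section \<open>Function spaces and shrinking\<close>

lemma cfun_ball_iff:
  assumes "compact_space K"
  shows "f \<in> cfun_ball K \<longleftrightarrow> f \<in> extensional (topspace K) \<and> continuous_map K euclideanreal f \<and>
     (\<forall>x\<in>topspace K. \<bar>f x\<bar> \<le> 1)"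
proof -
  have z: "(\<lambda>x\<in>topspace K. 0) \<in> mspace (cfun K)"
    unfolding mspace_cfun[OF assms] by (auto intro: continuous_map_eq[of _ _ "\<lambda>x. 0"])
  show ?thesis
  proof
    assume f: "f \<in> cfun_ball K"
    then have fm: "f \<in> mspace (cfun K)" by (simp add: cfun_ball_def del: mspace_cfunspace)
    have "dist ((\<lambda>x\<in>topspace K. 0) x) (f x) \<le> 1" if "x \<in> topspace K" for x
      using mdist_cfunspace_imp_mdist_le[OF z fm _ that, of 1] f
      by (simp add: cfun_ball_def del: mspace_cfunspace)
    with fm show "f \<in> extensional (topspace K) \<and> continuous_map K euclideanreal f \<and>
     (\<forall>x\<in>topspace K. \<bar>f x\<bar> \<le> 1)"
      unfolding mspace_cfun[OF assms] by (auto simp: dist_real_def)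
  next
    assume f: "f \<in> extensional (topspace K) \<and> continuous_map K euclideanreal f \<and>
     (\<forall>x\<in>topspace K. \<bar>f x\<bar> \<le> 1)"
    then have "f \<in> mspace (cfun K)" by (simp add: mspace_cfun[OF assms] del: mspace_cfunspace)
    moreover have "mdist (cfun K) (\<lambda>x\<in>topspace K. 0) f \<le> 1"
      by (rule mdist_cfunspace_le) (use f in \<open>auto simp: dist_real_def\<close>)
    ultimately show "f \<in> cfun_ball K"
      using z by (simp add: cfun_ball_def del: mspace_cfunspace)
  qed
qed

lemma bounded_cfunD:
  assumes K: "compact_space K" and A: "bounded_cfun K A" "A \<subseteq> mspace (cfun K)"
  shows "\<exists>C. \<forall>f\<in>A. \<forall>x\<in>topspace K. \<bar>f x\<bar> \<le> C"
proof -
  obtain c B where cB: "A \<subseteq> Metric_space.mcball (mspace (cfun K)) (mdist (cfun K)) c B"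
    using A(1) by (auto simp: bounded_cfun_def Metric_space.mbounded_def simp del: mspace_cfunspace)
  show ?thesis
  proof (cases "A = {}")
    case False
    with cB have c: "c \<in> mspace (cfun K)"
      by (auto simp: Metric_space.in_mcball simp del: mspace_cfunspace)
    have "compactin euclideanreal (c ` topspace K)"
      using c K unfolding mspace_cfun[OF K] compact_space_def
      by (intro image_compactin[of K]) auto
    then obtain D where D: "\<And>x. x \<in> topspace K \<Longrightarrow> \<bar>c x\<bar> \<le> D"
      using compact_imp_bounded[of "c ` topspace K"] by (auto simp: bounded_real)
    have "\<bar>f x\<bar> \<le> B + D" if "f \<in> A" "x \<in> topspace K" for f x
    proof -
      have "f \<in> mspace (cfun K)" "mdist (cfun K) c f \<le> B"
        using cB that by (auto simp: Metric_space.in_mcball simp del: mspace_cfunspace)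
      then have "dist (c x) (f x) \<le> B"
        using mdist_cfunspace_imp_mdist_le[OF c _ _ that(2)] by auto
      with D[OF that(2)] show ?thesis by (auto simp: dist_real_def)
    qed
    then show ?thesis by blast
  qed auto
qed

lemma bounded_cfunI:
  assumes K: "compact_space K" and A: "A \<subseteq> mspace (cfun K)"
    and C: "\<And>f x. f \<in> A \<Longrightarrow> x \<in> topspace K \<Longrightarrow> \<bar>f x\<bar> \<le> C" "0 \<le> C"
  shows "bounded_cfun K A"
proof -
  have z: "(\<lambda>x\<in>topspace K. 0) \<in> mspace (cfun K)"
    unfolding mspace_cfun[OF K] by (auto intro: continuous_map_eq[of _ _ "\<lambda>x. 0"])
  have "mdist (cfun K) (\<lambda>x\<in>topspace K. 0) f \<le> C" if "f \<in> A" for f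
    by (rule mdist_cfunspace_le) (use that C in \<open>auto simp: dist_real_def\<close>)
  then show ?thesis
    unfolding bounded_cfun_def Metric_space.mbounded_def[OF Metric_space_mspace_mdist]
    using z A
    by (intro exI[of _ "\<lambda>x\<in>topspace K. 0"] exI[of _ C])
      (auto simp: Metric_space.in_mcball simp del: mspace_cfunspace)
qed

text \<open>The common bound \<open>C\<close> makes the set of values bounded above, so that the
  supremum in \<open>rho\<close> is a genuine one.\<close>

lemma rho_upper:
  assumes "\<And>f x. f \<in> A \<Longrightarrow> x \<in> S \<Longrightarrow> \<bar>f x\<bar> \<le> C" "f \<in> A" "k \<in> S" "l \<in> S"
  shows "\<bar>f k - f l\<bar> \<le> rho A k l"
  unfolding rho_def
proof (rule cSUP_upper[OF assms(2)])
  have "\<bar>g k - g l\<bar> \<le> C + C" if "g \<in> A" for g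
    using assms(1)[OF that assms(3)] assms(1)[OF that assms(4)] by linarith
  then show "bdd_above ((\<lambda>f. \<bar>f k - f l\<bar>) ` A)"
    by (intro bdd_aboveI[of _ "C + C"]) auto
qed

lemma rho_le:
  assumes "A \<noteq> {}" "\<And>f. f \<in> A \<Longrightarrow> \<bar>f k - f l\<bar> \<le> e"
  shows "rho A k l \<le> e"
  unfolding rho_def using assms by (intro cSUP_least) auto

lemma shrinkingD:
  assumes "shrinking K A \<Gamma> R r" and C: "\<forall>f\<in>A. \<forall>x\<in>topspace K. \<bar>f x\<bar> \<le> C"
    and r: "\<And>s. s \<in> \<Gamma> \<Longrightarrow> r s x \<in> topspace K"
    and x: "x \<in> topspace K" and \<sigma>: "increasing_seq \<Gamma> R \<sigma>" "is_sup_seq \<Gamma> R \<sigma> s" and "\<epsilon> > 0"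
  shows "\<exists>N. \<forall>n\<ge>N. \<forall>f\<in>A. \<bar>f (r (\<sigma> n) x) - f (r s x)\<bar> \<le> \<epsilon>"
proof -
  have "(\<lambda>n. rho A (r (\<sigma> n) x) (r s x)) \<longlonglongrightarrow> 0"
    using assms(1) x \<sigma> unfolding shrinking_def by blast
  then have "\<forall>\<^sub>F n in sequentially. rho A (r (\<sigma> n) x) (r s x) < \<epsilon>"
    using \<open>\<epsilon> > 0\<close> by (rule order_tendstoD)
  then obtain N where N: "\<And>n. n \<ge> N \<Longrightarrow> rho A (r (\<sigma> n) x) (r s x) < \<epsilon>"
    unfolding eventually_sequentially by blast
  have "\<bar>f (r (\<sigma> n) x) - f (r s x)\<bar> \<le> \<epsilon>" if "n \<ge> N" "f \<in> A" for n f
  proof -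
    have "\<bar>f (r (\<sigma> n) x) - f (r s x)\<bar> \<le> rho A (r (\<sigma> n) x) (r s x)"
      by (rule rho_upper[of A "topspace K" C, OF _ that(2)])
         (use r \<sigma> C in \<open>auto simp: increasing_seq_def is_sup_seq_def\<close>)
    with N[OF that(1)] show ?thesis by linarith
  qed
  then show ?thesis by blast
qed

lemma shrinkingI:
  assumes "A \<noteq> {}" and C: "\<And>f x. f \<in> A \<Longrightarrow> x \<in> topspace K \<Longrightarrow> \<bar>f x\<bar> \<le> C"
    and r: "\<And>s x. s \<in> \<Gamma> \<Longrightarrow> x \<in> topspace K \<Longrightarrow> r s x \<in> topspace K"
    and *: "\<And>x \<sigma> s \<epsilon>. x \<in> topspace K \<Longrightarrow> increasing_seq \<Gamma> R \<sigma> \<Longrightarrow> is_sup_seq \<Gamma> R \<sigma> s \<Longrightarrow> \<epsilon> > 0 \<Longrightarrow>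
       \<exists>N. \<forall>n\<ge>N. \<forall>f\<in>A. \<bar>f (r (\<sigma> n) x) - f (r s x)\<bar> \<le> \<epsilon>"
  shows "shrinking K A \<Gamma> R r"
  unfolding shrinking_def
proof (intro ballI allI impI)
  fix x \<sigma> s assume x: "x \<in> topspace K" and \<sigma>: "increasing_seq \<Gamma> R \<sigma> \<and> is_sup_seq \<Gamma> R \<sigma> s"
  obtain f where f: "f \<in> A" using assms(1) by blast
  show "(\<lambda>n. rho A (r (\<sigma> n) x) (r s x)) \<longlonglongrightarrow> 0"
  proof (rule LIMSEQ_I)
    fix e :: real assume "e > 0"
    then obtain N where N: "\<And>n f. n \<ge> N \<Longrightarrow> f \<in> A \<Longrightarrow> \<bar>f (r (\<sigma> n) x) - f (r s x)\<bar> \<le> e / 2"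
      using *[of x \<sigma> s "e / 2"] x \<sigma> by auto
    have "norm (rho A (r (\<sigma> n) x) (r s x) - 0) < e" if "n \<ge> N" for n
    proof -
      have "\<bar>f (r (\<sigma> n) x) - f (r s x)\<bar> \<le> rho A (r (\<sigma> n) x) (r s x)"
        by (rule rho_upper[of A "topspace K" C, OF _ f])
           (use r x \<sigma> C in \<open>auto simp: increasing_seq_def is_sup_seq_def\<close>)
      moreover have "rho A (r (\<sigma> n) x) (r s x) \<le> e / 2"
        by (rule rho_le) (use assms(1) N that in auto)
      ultimately show ?thesis using \<open>e > 0\<close> by auto
    qed
    then show "\<exists>N. \<forall>n\<ge>N. norm (rho A (r (\<sigma> n) x) (r s x) - 0) < e" by blast
  qed
qed

text \<open>A bound on the limsup gives eventual bounds only by larger constants, hence the strict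
  inequality between \<open>\<epsilon>\<close> and \<open>\<delta>\<close>.\<close>

lemma eps_shrinkingD:
  assumes "eps_shrinking K A \<epsilon> \<Gamma> R r" and C: "\<forall>f\<in>A. \<forall>x\<in>topspace K. \<bar>f x\<bar> \<le> C"
    and r: "\<And>s. s \<in> \<Gamma> \<Longrightarrow> r s x \<in> topspace K"
    and x: "x \<in> topspace K" and \<sigma>: "increasing_seq \<Gamma> R \<sigma>" "is_sup_seq \<Gamma> R \<sigma> s" and "\<epsilon> < \<delta>"
  shows "\<exists>N. \<forall>n\<ge>N. \<forall>f\<in>A. \<bar>f (r (\<sigma> n) x) - f (r s x)\<bar> \<le> \<delta>"
proof -
  have "limsup (\<lambda>n. ereal (rho A (r (\<sigma> n) x) (r s x))) \<le> ereal \<epsilon>"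
    using assms(1) x \<sigma> unfolding eps_shrinking_def by blast
  also have "\<dots> < ereal \<delta>" using \<open>\<epsilon> < \<delta>\<close> by simp
  finally have "\<forall>\<^sub>F n in sequentially. ereal (rho A (r (\<sigma> n) x) (r s x)) < ereal \<delta>"
    by (rule Limsup_lessD)
  then obtain N where N: "\<And>n. n \<ge> N \<Longrightarrow> rho A (r (\<sigma> n) x) (r s x) < \<delta>"
    unfolding eventually_sequentially by auto
  have "\<bar>f (r (\<sigma> n) x) - f (r s x)\<bar> \<le> \<delta>" if "n \<ge> N" "f \<in> A" for n f
  proof -
    have "\<bar>f (r (\<sigma> n) x) - f (r s x)\<bar> \<le> rho A (r (\<sigma> n) x) (r s x)"
      by (rule rho_upper[of A "topspace K" C, OF _ that(2)])
         (use r \<sigma> C in \<open>auto simp: increasing_seq_def is_sup_seq_def\<close>)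
    with N[OF that(1)] show ?thesis by linarith
  qed
  then show ?thesis by blast
qed

lemma eps_shrinkingI:
  assumes "A \<noteq> {}"
    and *: "\<And>x \<sigma> s. x \<in> topspace K \<Longrightarrow> increasing_seq \<Gamma> R \<sigma> \<Longrightarrow> is_sup_seq \<Gamma> R \<sigma> s \<Longrightarrow>
       \<exists>N. \<forall>n\<ge>N. \<forall>f\<in>A. \<bar>f (r (\<sigma> n) x) - f (r s x)\<bar> \<le> \<epsilon>"
  shows "eps_shrinking K A \<epsilon> \<Gamma> R r"
  unfolding eps_shrinking_def
proof (intro ballI allI impI)
  fix x \<sigma> s assume "x \<in> topspace K" and "increasing_seq \<Gamma> R \<sigma> \<and> is_sup_seq \<Gamma> R \<sigma> s"
  then obtain N where "\<And>n f. n \<ge> N \<Longrightarrow> f \<in> A \<Longrightarrow> \<bar>f (r (\<sigma> n) x) - f (r s x)\<bar> \<le> \<epsilon>"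
    using * by blast
  then have "\<And>n. n \<ge> N \<Longrightarrow> rho A (r (\<sigma> n) x) (r s x) \<le> \<epsilon>"
    using assms(1) by (auto intro: rho_le)
  then show "limsup (\<lambda>n. ereal (rho A (r (\<sigma> n) x) (r s x))) \<le> ereal \<epsilon>"
    by (intro Limsup_bounded) (auto simp: eventually_sequentially)
qed

section \<open>Shrinking skeletons are full\<close>

locale skeleton =
  fixes K :: "'a topology" and \<Gamma> :: "'i set" and R :: "'i rel" and r :: "'i \<Rightarrow> 'a \<Rightarrow> 'a"
  assumes compact: "compact_space K" and Hausdorff: "Hausdorff_space K"
    and skel: "retractional_skeleton K \<Gamma> R r"
begin

lemma po: "refl_on \<Gamma> R" "trans R" "antisym R"
  using skel by (auto simp: retractional_skeleton_def partial_order_on_def preorder_on_def)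

lemma up: "up_directed \<Gamma> R"
  using skel by (simp add: retractional_skeleton_def)

lemma ub: "s \<in> \<Gamma> \<Longrightarrow> t \<in> \<Gamma> \<Longrightarrow> \<exists>u\<in>\<Gamma>. (s, u) \<in> R \<and> (t, u) \<in> R"
  using up by (auto simp: up_directed_def)

lemma R_trans: "(s, t) \<in> R \<Longrightarrow> (t, u) \<in> R \<Longrightarrow> (s, u) \<in> R"
  using po by (auto dest: transD)

lemma R_refl: "s \<in> \<Gamma> \<Longrightarrow> (s, s) \<in> R"
  using po by (auto simp: refl_on_def)

lemma ex_sup: "increasing_seq \<Gamma> R \<sigma> \<Longrightarrow> \<exists>s. is_sup_seq \<Gamma> R \<sigma> s"
  using skel by (simp add: retractional_skeleton_def sigma_complete_def)

lemma r_in: "s \<in> \<Gamma> \<Longrightarrow> x \<in> topspace K \<Longrightarrow> r s x \<in> topspace K"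
  using skel by (auto simp: retractional_skeleton_def continuous_map_def)

lemma r_cont: "s \<in> \<Gamma> \<Longrightarrow> continuous_map K K (r s)"
  using skel by (simp add: retractional_skeleton_def)

lemma r_metrizable: "s \<in> \<Gamma> \<Longrightarrow> metrizable_space (subtopology K (r s ` topspace K))"
  using skel by (simp add: retractional_skeleton_def)

lemma r_idem: "s \<in> \<Gamma> \<Longrightarrow> x \<in> topspace K \<Longrightarrow> r s (r s x) = r s x"
  using skel by (simp add: retractional_skeleton_def)

lemma r_le:
  assumes "s \<in> \<Gamma>" "t \<in> \<Gamma>" "(s, t) \<in> R" "x \<in> topspace K"
  shows "r t (r s x) = r s x" "r s (r t x) = r s x"
  using skel assms unfolding retractional_skeleton_def by metis+

lemma r_lim:
  "increasing_seq \<Gamma> R \<sigma> \<Longrightarrow> is_sup_seq \<Gamma> R \<sigma> s \<Longrightarrow> x \<in> topspace K \<Longrightarrow>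
    limitin K (\<lambda>n. r (\<sigma> n) x) (r s x) sequentially"
  using skel by (simp add: retractional_skeleton_def)

lemma r_sup_eq:
  assumes \<sigma>: "increasing_seq \<Gamma> R \<sigma>" "is_sup_seq \<Gamma> R \<sigma> s"
    and xy: "x \<in> topspace K" "y \<in> topspace K" and eq: "\<And>n. r (\<sigma> n) x = r (\<sigma> n) y"
  shows "r s x = r s y"
proof -
  have "limitin K (\<lambda>n. r (\<sigma> n) x) (r s y) sequentially"
    using r_lim[OF \<sigma> xy(2)] by (simp add: eq)
  then show ?thesis
    using limitin_Hausdorff_unique[OF r_lim[OF \<sigma> xy(1)]] Hausdorff by auto
qed

text \<open>The net of all \<open>r s x\<close> converges to \<open>x\<close>, and a net that is
  constant from some index on converges to that constant.\<close>

lemma r_all_eq: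
  assumes xy: "x \<in> topspace K" "y \<in> topspace K"
    and s: "s \<in> \<Gamma>" "\<And>t. t \<in> \<Gamma> \<Longrightarrow> (s, t) \<in> R \<Longrightarrow> r t x = y"
  shows "x = y"
proof -
  have po': "partial_order_on \<Gamma> R"
    using skel by (simp add: retractional_skeleton_def)
  have nontriv: "tails \<Gamma> R \<noteq> bot"
    unfolding trivial_limit_def eventually_tails[OF po' up] using R_refl by blast
  have "limitin K (\<lambda>s. r s x) x (tails \<Gamma> R)"
    using skel xy by (simp add: retractional_skeleton_def)
  moreover have "limitin K (\<lambda>s. r s x) y (tails \<Gamma> R)"
    by (rule limitin_eventually) (use xy s in \<open>auto simp: eventually_tails[OF po' up]\<close>)
  ultimately show ?thesis
    using limitin_Hausdorff_unique Hausdorff nontriv by metis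
qed

text \<open>For each tolerance there is an index beyond which \<open>r t x\<close> moves by no more
  than it, uniformly over \<open>A\<close>. An increasing sequence of such indices for the
  tolerances 1 / (n + 1) has a supremum \<open>s\<close> beyond which nothing moves, because
  \<open>A\<close> separates points; the limit \<open>x\<close> of the net is then
  \<open>r s x\<close>.\<close>

lemma shrinking_imp_full:
  assumes sh: "shrinking K A \<Gamma> R r" and sep: "separates_points K A"
    and C: "\<forall>f\<in>A. \<forall>x\<in>topspace K. \<bar>f x\<bar> \<le> C"
  shows "full_skeleton K \<Gamma> r"
proof -
  have "\<exists>s\<in>\<Gamma>. r s x = x" if x: "x \<in> topspace K" for x
  proof -
    note D = shrinkingD[OF sh C r_in[OF _ x] x]
    define near where "near \<epsilon> s t \<longleftrightarrow> (\<forall>f\<in>A. \<bar>f (r t x) - f (r s x)\<bar> \<le> \<epsilon>)" for \<epsilon> s t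
    have stable: "\<exists>s\<in>\<Gamma>. (u, s) \<in> R \<and> (\<forall>t\<in>\<Gamma>. (s, t) \<in> R \<longrightarrow> near \<epsilon> s t)"
      if u: "u \<in> \<Gamma>" and "\<epsilon> > 0" for u \<epsilon>
    proof (rule ccontr)
      assume "\<not> ?thesis"
      then have far: "\<exists>t. t \<in> \<Gamma> \<and> (s, t) \<in> R \<and> \<not> near \<epsilon> s t" if "s \<in> \<Gamma>" "(u, s) \<in> R" for s
        using that by blast
      have "\<exists>\<sigma>. \<forall>n. (\<sigma> n \<in> \<Gamma> \<and> (u, \<sigma> n) \<in> R) \<and> (\<sigma> n, \<sigma> (Suc n)) \<in> R \<and> \<not> near \<epsilon> (\<sigma> n) (\<sigma> (Suc n))"
      proof (rule dependent_nat_choice)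
        show "\<exists>s. s \<in> \<Gamma> \<and> (u, s) \<in> R" using u R_refl by blast
        show "\<exists>t. (t \<in> \<Gamma> \<and> (u, t) \<in> R) \<and> (s, t) \<in> R \<and> \<not> near \<epsilon> s t"
          if "s \<in> \<Gamma> \<and> (u, s) \<in> R" for s n
          using far that R_trans by meson
      qed
      then obtain \<sigma> where \<sigma>: "\<And>n. \<sigma> n \<in> \<Gamma>" "\<And>n. (\<sigma> n, \<sigma> (Suc n)) \<in> R"
        "\<And>n. \<not> near \<epsilon> (\<sigma> n) (\<sigma> (Suc n))" by blast
      then have inc: "increasing_seq \<Gamma> R \<sigma>" by (simp add: increasing_seq_def)
      then obtain s where s: "is_sup_seq \<Gamma> R \<sigma> s" using ex_sup by blast
      \<comment> \<open>Half of \<open>\<epsilon>\<close>, because two consecutive terms are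
        compared through \<open>r s x\<close>.\<close>
      from D[OF _ inc s, of "\<epsilon> / 2"] obtain N where
        N: "\<And>n f. n \<ge> N \<Longrightarrow> f \<in> A \<Longrightarrow> \<bar>f (r (\<sigma> n) x) - f (r s x)\<bar> \<le> \<epsilon> / 2"
        using \<open>\<epsilon> > 0\<close> by auto
      have "near \<epsilon> (\<sigma> N) (\<sigma> (Suc N))"
        unfolding near_def
      proof
        fix f assume "f \<in> A"
        then show "\<bar>f (r (\<sigma> (Suc N)) x) - f (r (\<sigma> N) x)\<bar> \<le> \<epsilon>"
          using N[OF le_refl, of f] N[OF le_SucI[OF le_refl], of f] by linarith
      qed
      with \<sigma> show False by blast
    qed
    have "\<exists>\<sigma>. \<forall>n. (\<sigma> n \<in> \<Gamma> \<and> (\<forall>t\<in>\<Gamma>. (\<sigma> n, t) \<in> R \<longrightarrow> near (1 / real (Suc n)) (\<sigma> n) t)) \<and>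
        (\<sigma> n, \<sigma> (Suc n)) \<in> R"
    proof (rule dependent_nat_choice)
      show "\<exists>s. s \<in> \<Gamma> \<and> (\<forall>t\<in>\<Gamma>. (s, t) \<in> R \<longrightarrow> near (1 / real (Suc 0)) s t)"
        using stable[of _ "1 / real (Suc 0)"] up unfolding up_directed_def by fastforce
      show "\<exists>s'. (s' \<in> \<Gamma> \<and> (\<forall>t\<in>\<Gamma>. (s', t) \<in> R \<longrightarrow> near (1 / real (Suc (Suc n))) s' t)) \<and> (s, s') \<in> R"
        if "s \<in> \<Gamma> \<and> (\<forall>t\<in>\<Gamma>. (s, t) \<in> R \<longrightarrow> near (1 / real (Suc n)) s t)" for s n
        using stable[of s "1 / real (Suc (Suc n))"] that by fastforce
    qed
    then obtain \<sigma> where \<sigma>: "\<And>n. \<sigma> n \<in> \<Gamma>" "\<And>n. (\<sigma> n, \<sigma> (Suc n)) \<in> R"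
      "\<And>n t. t \<in> \<Gamma> \<Longrightarrow> (\<sigma> n, t) \<in> R \<Longrightarrow> near (1 / real (Suc n)) (\<sigma> n) t" by blast
    then have inc: "increasing_seq \<Gamma> R \<sigma>" by (simp add: increasing_seq_def)
    then obtain s where s: "is_sup_seq \<Gamma> R \<sigma> s" using ex_sup by blast
    have s\<Gamma>: "s \<in> \<Gamma>" "\<And>n. (\<sigma> n, s) \<in> R" using s by (auto simp: is_sup_seq_def)
    have const: "r t x = r s x" if t: "t \<in> \<Gamma>" "(s, t) \<in> R" for t
    proof (rule ccontr)
      assume "r t x \<noteq> r s x"
      then obtain f where f: "f \<in> A" "f (r t x) \<noteq> f (r s x)"
        using sep r_in x t s\<Gamma> unfolding separates_points_def by metis
      \<comment> \<open>Half of the gap, because both points are compared with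
        \<open>r (\<sigma> n) x\<close>.\<close>
      then obtain n where n: "1 / real (Suc n) < \<bar>f (r t x) - f (r s x)\<bar> / 2"
        using nat_approx_posE[of "\<bar>f (r t x) - f (r s x)\<bar> / 2"] by auto
      have "\<bar>f (r t x) - f (r (\<sigma> n) x)\<bar> \<le> 1 / real (Suc n)"
        using \<sigma>(3)[OF t(1) R_trans[OF s\<Gamma>(2) t(2)], of n] f by (auto simp: near_def)
      moreover have "\<bar>f (r s x) - f (r (\<sigma> n) x)\<bar> \<le> 1 / real (Suc n)"
        using \<sigma>(3)[OF s\<Gamma>, of n] f by (auto simp: near_def)
      ultimately have "\<bar>f (r t x) - f (r s x)\<bar> \<le> 1 / real (Suc n) + 1 / real (Suc n)"
        by (simp only: abs_le_iff) linarith
      then show False using n by simp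
    qed
    have "x = r s x"
      by (rule r_all_eq[OF x r_in[OF s\<Gamma>(1) x] s\<Gamma>(1) const])
    then show ?thesis using s\<Gamma> by metis
  qed
  then show ?thesis
    unfolding full_skeleton_def induced_set_def using r_in by (force simp: image_iff)
qed

end

section \<open>Moduli of continuity and the countable covering of the unit ball\<close>

text \<open>If no \<open>n\<close> worked, the closed sets of pairs that \<open>f\<close> separates
  by at least \<open>\<epsilon>\<close> and \<open>A\<close> by at most 1 / (n + 1) would be
  nonempty and decreasing; a common pair would consist of distinct points that \<open>A\<close>
  fails to separate.\<close>

lemma uniform_modulus:
  assumes K: "compact_space K" and A: "\<And>g. g \<in> A \<Longrightarrow> continuous_map K euclideanreal g"
    and sep: "separates_points K A" and f: "continuous_map K euclideanreal f" and "\<epsilon> > 0"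
  shows "\<exists>n. \<forall>x\<in>topspace K. \<forall>y\<in>topspace K.
     (\<forall>g\<in>A. \<bar>g x - g y\<bar> \<le> 1 / real (Suc n)) \<longrightarrow> \<bar>f x - f y\<bar> \<le> \<epsilon>"
proof (rule ccontr)
  assume "\<not> ?thesis"
  then have bad: "\<exists>x\<in>topspace K. \<exists>y\<in>topspace K.
     (\<forall>g\<in>A. \<bar>g x - g y\<bar> \<le> 1 / real (Suc n)) \<and> \<bar>f x - f y\<bar> > \<epsilon>" for n
    by (auto simp: not_le)
  define P where "P = prod_topology K K"
  define C where "C n = topspace P \<inter> {z. \<epsilon> \<le> \<bar>f (fst z) - f (snd z)\<bar>} \<inter>
      (\<Inter>g\<in>A. {z \<in> topspace P. \<bar>g (fst z) - g (snd z)\<bar> \<le> 1 / real (Suc n)})" for n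
  have cont: "continuous_map P euclideanreal (\<lambda>z. \<bar>g (fst z) - g (snd z)\<bar>)"
    if "continuous_map K euclideanreal g" for g
    unfolding P_def
    by (intro continuous_map_real_abs continuous_map_diff
        continuous_map_compose[OF continuous_map_fst that, unfolded o_def]
        continuous_map_compose[OF continuous_map_snd that, unfolded o_def])
  have closed1: "closedin P (topspace P \<inter> {z. \<epsilon> \<le> \<bar>f (fst z) - f (snd z)\<bar>})"
    using closedin_continuous_map_preimage[OF cont[OF f], of "{\<epsilon>..}"]
    by (simp add: Collect_conj_eq)
  have closed2: "closedin P {z \<in> topspace P. \<bar>g (fst z) - g (snd z)\<bar> \<le> 1 / real (Suc n)}"
    if "g \<in> A" for g n
    using closedin_continuous_map_preimage[OF cont[OF A[OF that]], of "{..1 / real (Suc n)}"] by simp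
  have "(\<Inter>n\<in>UNIV. C n) \<noteq> {}"
  proof (rule compact_space_directed_Inter)
    show "compact_space P" by (simp add: P_def compact_space_prod_topology K)
    show "closedin P (C n)" for n
    proof (cases "A = {}")
      case True
      then show ?thesis using closed1 by (simp add: C_def)
    next
      case False
      then show ?thesis
        unfolding C_def by (intro closedin_Int closed1 closedin_INT closed2)
    qed
    show "C n \<noteq> {}" for n
    proof -
      obtain x y where "x \<in> topspace K" "y \<in> topspace K"
         "\<forall>g\<in>A. \<bar>g x - g y\<bar> \<le> 1 / real (Suc n)" "\<bar>f x - f y\<bar> > \<epsilon>" using bad by blast
      then have "(x, y) \<in> C n" by (auto simp: C_def P_def)
      then show ?thesis by blast
    qed
    show "\<exists>c\<in>UNIV. C c \<subseteq> C a \<inter> C b" for a b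
    proof -
      have "1 / real (Suc (max a b)) \<le> 1 / real (Suc a)" "1 / real (Suc (max a b)) \<le> 1 / real (Suc b)"
        by (auto intro!: divide_left_mono)
      then have "C (max a b) \<subseteq> C a \<inter> C b" unfolding C_def by fastforce
      then show ?thesis by blast
    qed
  qed auto
  then obtain x y where xy: "\<And>n. (x, y) \<in> C n" by auto
  then have xyK: "x \<in> topspace K" "y \<in> topspace K" "\<epsilon> \<le> \<bar>f x - f y\<bar>"
    by (auto simp: C_def P_def)
  with \<open>\<epsilon> > 0\<close> have "x \<noteq> y" by auto
  then obtain g where g: "g \<in> A" "g x \<noteq> g y"
    using sep xyK by (auto simp: separates_points_def)
  then obtain n where "1 / real (Suc n) < \<bar>g x - g y\<bar>"
    using nat_approx_posE[of "\<bar>g x - g y\<bar>"] by auto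
  moreover have "\<bar>g x - g y\<bar> \<le> 1 / real (Suc n)"
    using xy[of n] g by (auto simp: C_def)
  ultimately show False by simp
qed

text \<open>Shrinking passes from \<open>A\<close> to each class \<open>B n m\<close>: once all
  members of \<open>A\<close> change by at most 1 / (n + 1), all members of the class change by at
  most 1 / (m + 1). For fixed \<open>m\<close> the classes cover the ball, since every continuous
  function has some modulus.\<close>

lemma (in skeleton) shrinking_imp_countably_shrinking:
  assumes ne: "topspace K \<noteq> {}" and A: "A \<noteq> {}" "A \<subseteq> mspace (cfun K)" "bounded_cfun K A"
    and sep: "separates_points K A" and sh: "shrinking K A \<Gamma> R r"
  shows "has_countably_shrinking_full_skeleton TYPE('i) K"
proof -
  obtain C where C: "\<forall>f\<in>A. \<forall>x\<in>topspace K. \<bar>f x\<bar> \<le> C"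
    using bounded_cfunD[OF compact A(3,2)] by blast
  have Acont: "continuous_map K euclideanreal g" if "g \<in> A" for g
    using A(2) that unfolding mspace_cfun[OF compact] by blast
  define c where "c m = (\<lambda>x\<in>topspace K. 1 / real (Suc m))" for m
  define B where "B n m = {f \<in> cfun_ball K. \<forall>x\<in>topspace K. \<forall>y\<in>topspace K.
     (\<forall>g\<in>A. \<bar>g x - g y\<bar> \<le> 1 / real (Suc n)) \<longrightarrow> \<bar>f x - f y\<bar> \<le> 1 / real (Suc m)}" for n m
  \<comment> \<open>The shrinking constant must be a function of the set, so \<open>m\<close> has to be recoverable from it.\<close>
  define B' where "B' n m = B n m - {c m}" for n m
  define eps where "eps S = 1 / real (Suc (SOME m. \<exists>n. S = B' n m))" for S
  obtain x0 where x0: "x0 \<in> topspace K" using ne by blast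
  have c_inj: "m = m'" if "c m = c m'" for m m'
    using fun_cong[OF that, of x0] x0 by (simp add: c_def)
  have const_B: "(\<lambda>x\<in>topspace K. a) \<in> B n m" if "\<bar>a\<bar> \<le> 1" for a n m
    using that by (auto simp: B_def cfun_ball_iff[OF compact] intro: continuous_map_eq[of _ _ "\<lambda>x. a"])
  \<comment> \<open>Every \<open>B n m\<close> contains all the constants \<open>c k\<close>, so
    \<open>c m\<close> is the only one of them missing from \<open>B' n m\<close> and reveals
    \<open>m\<close>.\<close>
  have m_inj: "m = m'" if "B' n m = B' n' m'" for n m n' m'
  proof -
    have "c m \<in> B n' m'" unfolding c_def by (rule const_B) simp
    moreover have "c m \<notin> B' n' m'" using that by (auto simp: B'_def)
    ultimately show ?thesis using c_inj by (auto simp: B'_def)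
  qed
  have eps_eq: "eps (B' n m) = 1 / real (Suc m)" for n m
  proof -
    have "(SOME m'. \<exists>n'. B' n m = B' n' m') = m"
      by (rule some_equality) (use m_inj in blast)+
    then show ?thesis by (simp add: eps_def)
  qed
  define \<A> where "\<A> = range (\<lambda>(n, m). B' n m)"
  have "countable \<A>" unfolding \<A>_def by simp
  moreover have "S \<noteq> {} \<and> S \<subseteq> cfun_ball K" if S: "S \<in> \<A>" for S
  proof -
    obtain n m where S: "S = B' n m" using S by (auto simp: \<A>_def)
    have "(\<lambda>x\<in>topspace K. 0) \<noteq> c m"
      unfolding c_def using x0 by (auto dest!: fun_cong[of _ _ x0])
    then have "(\<lambda>x\<in>topspace K. 0) \<in> S" unfolding S B'_def using const_B[of 0] by auto
    then show ?thesis by (auto simp: S B'_def B_def)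
  qed
  moreover have "eps S > 0 \<and> eps_shrinking K S (eps S) \<Gamma> R r" if S: "S \<in> \<A>" for S
  proof -
    obtain n m where nm: "S = B' n m" using S by (auto simp: \<A>_def)
    have "eps_shrinking K S (1 / real (Suc m)) \<Gamma> R r"
    proof (rule eps_shrinkingI)
      show "S \<noteq> {}" using \<open>S \<in> \<A> \<Longrightarrow> S \<noteq> {} \<and> S \<subseteq> cfun_ball K\<close> S by blast
      fix x \<sigma> s assume x: "x \<in> topspace K" and \<sigma>: "increasing_seq \<Gamma> R \<sigma>" "is_sup_seq \<Gamma> R \<sigma> s"
      have "\<exists>N. \<forall>k\<ge>N. \<forall>f\<in>A. \<bar>f (r (\<sigma> k) x) - f (r s x)\<bar> \<le> 1 / real (Suc n)"
        by (rule shrinkingD[OF sh C r_in[OF _ x] x \<sigma>]) auto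
      then obtain N where N: "\<And>k f. k \<ge> N \<Longrightarrow> f \<in> A \<Longrightarrow> \<bar>f (r (\<sigma> k) x) - f (r s x)\<bar> \<le> 1 / real (Suc n)"
        by blast
      have "r (\<sigma> k) x \<in> topspace K" "r s x \<in> topspace K" for k
        using \<sigma> r_in x by (auto simp: increasing_seq_def is_sup_seq_def)
      then have "\<forall>k\<ge>N. \<forall>f\<in>S. \<bar>f (r (\<sigma> k) x) - f (r s x)\<bar> \<le> 1 / real (Suc m)"
        using N unfolding nm B'_def B_def by blast
      then show "\<exists>N. \<forall>k\<ge>N. \<forall>f\<in>S. \<bar>f (r (\<sigma> k) x) - f (r s x)\<bar> \<le> 1 / real (Suc m)" by blast
    qed
    then show ?thesis by (simp add: nm eps_eq)
  qed
  moreover have "cfun_ball K = \<Union>{S \<in> \<A>. eps S < \<epsilon>}" if "\<epsilon> > 0" for \<epsilon>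
  proof
    show "\<Union>{S \<in> \<A>. eps S < \<epsilon>} \<subseteq> cfun_ball K"
      by (auto simp: \<A>_def B'_def B_def)
    show "cfun_ball K \<subseteq> \<Union>{S \<in> \<A>. eps S < \<epsilon>}"
    proof
      fix f assume f: "f \<in> cfun_ball K"
      obtain m0 where m0: "1 / real (Suc m0) < \<epsilon>" using nat_approx_posE[OF \<open>\<epsilon> > 0\<close>] by blast
      have "1 / real (Suc (Suc m0)) \<le> 1 / real (Suc m0)" by (auto intro!: divide_left_mono)
      \<comment> \<open>\<open>f\<close> may be the constant that was removed. The constants removed
        at two consecutive levels differ, so one of the two levels serves.\<close>
      moreover have "f \<noteq> c m0 \<or> f \<noteq> c (Suc m0)" using c_inj[of m0 "Suc m0"] by auto
      ultimately obtain m where m: "1 / real (Suc m) < \<epsilon>" "f \<noteq> c m"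
        using m0 by (metis order_le_less_trans)
      have fc: "continuous_map K euclideanreal f" using f by (simp add: cfun_ball_iff[OF compact])
      obtain n where "f \<in> B n m"
        using uniform_modulus[OF compact Acont sep fc, of "1 / real (Suc m)"] f
        by (auto simp: B_def)
      then have "f \<in> B' n m" using m by (simp add: B'_def)
      moreover have "B' n m \<in> \<A>" by (auto simp: \<A>_def)
      ultimately show "f \<in> \<Union>{S \<in> \<A>. eps S < \<epsilon>}" using m eps_eq by auto
    qed
  qed
  ultimately show ?thesis
    unfolding has_countably_shrinking_full_skeleton_def
    using skel shrinking_imp_full[OF sh sep C]
    by (intro exI[of _ \<A>] exI[of _ \<Gamma>] exI[of _ R] exI[of _ r] conjI exI[of _ eps]) auto
qed

section \<open>Retractions associated with directed sets of indices\<close>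

locale full_skeleton_space = skeleton K \<Gamma> R r
  for K :: "'a topology" and \<Gamma> :: "'i set" and R :: "'i rel" and r :: "'i \<Rightarrow> 'a \<Rightarrow> 'a" +
  assumes nonempty: "topspace K \<noteq> {}" and full: "full_skeleton K \<Gamma> r"
begin

lemma fixed:
  assumes "x \<in> topspace K" shows "\<exists>s\<in>\<Gamma>. r s x = x"
proof -
  obtain s y where "s \<in> \<Gamma>" "y \<in> topspace K" "x = r s y"
    using full assms unfolding full_skeleton_def induced_set_def by blast
  then show ?thesis using r_idem by metis
qed

lemma ex_metric:
  assumes s: "s \<in> \<Gamma>"
  obtains S d where "Metric_space S d" "subtopology K (r s ` topspace K) = Metric_space.mtopology S d"
    "\<And>x. x \<in> topspace K \<Longrightarrow> r s x \<in> S" "S = r s ` topspace K"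
    "\<And>q. q \<in> S \<Longrightarrow> continuous_map K euclideanreal (\<lambda>z. d q (r s z))"
proof -
  obtain S d where Sd: "Metric_space S d" "subtopology K (r s ` topspace K) = Metric_space.mtopology S d"
    using r_metrizable[OF s] unfolding metrizable_space_def by metis
  interpret Metric_space S d by fact
  have S: "S = r s ` topspace K"
    using arg_cong[OF Sd(2), of topspace] r_in[OF s] by auto
  have "continuous_map K mtopology (r s)"
    unfolding Sd(2)[symmetric] using r_cont[OF s] by (auto simp: continuous_map_in_subtopology)
  then have "continuous_map K euclideanreal (\<lambda>z. d q (r s z))" if "q \<in> S" for q
    using that continuous_map_mdist[of K "metric (S, d)" "\<lambda>_. q" "r s"] by simp
  with Sd S show thesis using that by blast
qed

text \<open>A metric on the range of \<open>r s\<close> gives the distance between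
  \<open>r s x\<close> and \<open>r s z\<close>. As a real function of \<open>z\<close> it can be
  added to those of other indices, which the next construction exploits.\<close>

lemma ex_coincidence_function:
  assumes "s \<in> \<Gamma>" "x \<in> topspace K"
  shows "\<exists>\<phi>. continuous_map K euclideanreal \<phi> \<and>
    (\<forall>z\<in>topspace K. 0 \<le> \<phi> z \<and> (\<phi> z = 0 \<longleftrightarrow> r s z = r s x))"
proof -
  obtain S d where Sd: "Metric_space S d" "\<And>x. x \<in> topspace K \<Longrightarrow> r s x \<in> S"
    "\<And>q. q \<in> S \<Longrightarrow> continuous_map K euclideanreal (\<lambda>z. d q (r s z))"
    using ex_metric[OF assms(1)] by metis
  interpret Metric_space S d by fact
  show ?thesis
    using Sd assms by (intro exI[of _ "\<lambda>z. d (r s x) (r s z)"]) auto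
qed

text \<open>The intended range of the retraction belonging to \<open>M\<close>. The union of the
  ranges alone need not be closed.\<close>

definition directed_range :: "'i set \<Rightarrow> 'a set" where
  "directed_range M = K closure_of (\<Union>s\<in>M. r s ` topspace K)"

text \<open>
  A point \<open>x\<close> of \<open>directed_range M\<close> is reached by countably many indices of \<open>M\<close>: alternate between points
  \<open>e n\<close> fixed by \<open>s n \<in> M\<close>, which approximate \<open>x\<close> as seen by \<open>t 0, \<dots>, t n\<close>, and indices
  \<open>t (n + 1)\<close> above \<open>s n\<close>. A cluster point of the \<open>e n\<close> agrees with \<open>x\<close> under all \<open>t n\<close>, so it is \<open>x\<close>.
\<close>

lemma directed_range_fixed:
  assumes M: "up_directed M R" "M \<subseteq> \<Gamma>" and x: "x \<in> directed_range M"
  obtains C where "countable C" "C \<subseteq> M"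
    "\<And>t. t \<in> \<Gamma> \<Longrightarrow> (\<And>c. c \<in> C \<Longrightarrow> (c, t) \<in> R) \<Longrightarrow> r t x = x"
proof -
  have xK: "x \<in> topspace K"
    using x by (simp add: directed_range_def in_closure_of)
  have pick: "\<exists>e s'. e \<in> topspace K \<and> s' \<in> M \<and> (s, s') \<in> R \<and> r s' e = e \<and> \<psi> e < \<epsilon>"
    if \<psi>: "continuous_map K euclideanreal \<psi>" "\<psi> x = 0" and "\<epsilon> > 0" and s: "s \<in> M" for \<psi> \<epsilon> s
  proof -
    have "openin K {z \<in> topspace K. \<psi> z < \<epsilon>}"
      using openin_continuous_map_preimage[OF \<psi>(1), of "{..<\<epsilon>}"] by simp
    moreover have "x \<in> {z \<in> topspace K. \<psi> z < \<epsilon>}" using xK \<psi> \<open>\<epsilon> > 0\<close> by simp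
    ultimately have "\<exists>e\<in>(\<Union>s\<in>M. r s ` topspace K). e \<in> {z \<in> topspace K. \<psi> z < \<epsilon>}"
      by (rule closure_of_meets[OF x[unfolded directed_range_def]])
    then obtain e where e: "e \<in> (\<Union>s\<in>M. r s ` topspace K)" "e \<in> topspace K" "\<psi> e < \<epsilon>"
      by (elim bexE CollectE conjE)
    then obtain s1 y where s1: "s1 \<in> M" "e = r s1 y" "y \<in> topspace K" by blast
    obtain s' where s': "s' \<in> M" "(s, s') \<in> R" "(s1, s') \<in> R"
      using M(1) s s1(1) unfolding up_directed_def by meson
    have "r s' e = e"
      unfolding s1(2) by (rule r_le) (use M s' s1 in auto)
    with e s' show ?thesis by blast
  qed
  define Inv where "Inv n = (\<lambda>(e, s, t, \<psi>). e \<in> topspace K \<and> s \<in> M \<and> r s e = e \<and>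
      t \<in> \<Gamma> \<and> r t x = x \<and> continuous_map K euclideanreal \<psi> \<and> \<psi> x = 0 \<and>
      (\<forall>z\<in>topspace K. 0 \<le> \<psi> z \<and> (\<psi> z = 0 \<longrightarrow> r t z = r t x)) \<and> \<psi> e < 1 / real (Suc n))" for n
  \<comment> \<open>The link \<open>(s, t') \<in> R\<close> later puts the supremum of the
    \<open>t n\<close> above that of the \<open>s n\<close>. The growth of \<open>\<psi>\<close>
    lets one inequality at \<open>e n\<close> speak for all earlier indices too.\<close>
  define Rel where "Rel = (\<lambda>(e :: 'a, s, t, \<psi>) (e' :: 'a, s', t', \<psi>'). (s, s') \<in> R \<and> (t, t') \<in> R \<and> (s, t') \<in> R \<and>
      (\<forall>z\<in>topspace K. \<psi> z \<le> (\<psi>' z :: real)))"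
  have "\<exists>p. \<forall>n. Inv n (p n) \<and> Rel (p n) (p (Suc n))"
  proof (rule dependent_nat_choice)
    obtain t where t: "t \<in> \<Gamma>" "r t x = x" using fixed[OF xK] by blast
    obtain \<phi> where \<phi>: "continuous_map K euclideanreal \<phi>"
      "\<forall>z\<in>topspace K. 0 \<le> \<phi> z \<and> (\<phi> z = 0 \<longleftrightarrow> r t z = r t x)"
      using ex_coincidence_function[OF t(1) xK] by blast
    obtain s where "s \<in> M" using M by (auto simp: up_directed_def)
    moreover have "\<phi> x = 0" using \<phi>(2) xK by blast
    ultimately obtain e s' where "e \<in> topspace K" "s' \<in> M" "r s' e = e" "\<phi> e < 1"
      using pick[OF \<phi>(1), of 1 s] by auto
    with \<open>\<phi> x = 0\<close> have "Inv 0 (e, s', t, \<phi>)"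
      unfolding Inv_def prod.case using t \<phi> by (intro conjI ballI impI) auto
    then show "\<exists>p. Inv 0 p" by blast
  next
    fix p n assume "Inv n p"
    obtain e s t \<psi> where p: "p = (e, s, t, \<psi>)" by (cases p)
    have inv: "e \<in> topspace K" "s \<in> M" "r s e = e"
      "t \<in> \<Gamma>" "r t x = x" "continuous_map K euclideanreal \<psi>" "\<psi> x = 0"
      "\<forall>z\<in>topspace K. 0 \<le> \<psi> z \<and> (\<psi> z = 0 \<longrightarrow> r t z = r t x)"
      using \<open>Inv n p\<close> unfolding p Inv_def prod.case by blast+
    obtain t' where t': "t' \<in> \<Gamma>" "(t, t') \<in> R" "(s, t') \<in> R"
      using ub[OF inv(4), of s] inv(2) M by blast
    obtain \<phi> where \<phi>: "continuous_map K euclideanreal \<phi>"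
      "\<forall>z\<in>topspace K. 0 \<le> \<phi> z \<and> (\<phi> z = 0 \<longleftrightarrow> r t' z = r t' x)"
      using ex_coincidence_function[OF t'(1) xK] by blast
    \<comment> \<open>A sum of nonnegative functions vanishes only where each summand does, so a
      zero of \<open>\<psi>'\<close> still coincides with \<open>x\<close> under
      \<open>t'\<close>.\<close>
    define \<psi>' where "\<psi>' z = \<psi> z + \<phi> z" for z
    have \<psi>': "continuous_map K euclideanreal \<psi>'"
      using continuous_map_add[OF inv(6) \<phi>(1)] unfolding \<psi>'_def .
    have "\<psi>' x = 0" using inv(7) \<phi>(2) xK unfolding \<psi>'_def by fastforce
    from pick[OF \<psi>' this _ inv(2), of "1 / real (Suc (Suc n))"]
    obtain e' s' where e': "e' \<in> topspace K" "s' \<in> M" "(s, s') \<in> R" "r s' e' = e'"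
      "\<psi>' e' < 1 / real (Suc (Suc n))" by auto
    have "r t' x = x" using r_le(1)[OF inv(4) t'(1,2) xK] inv(5) by simp
    moreover have "\<forall>z\<in>topspace K. 0 \<le> \<psi>' z \<and> (\<psi>' z = 0 \<longrightarrow> r t' z = r t' x)"
    proof
      fix z assume z: "z \<in> topspace K"
      have "0 \<le> \<psi> z" "0 \<le> \<phi> z" using inv(8) \<phi>(2) z by blast+
      moreover from this have "\<phi> z = 0" if "\<psi>' z = 0" using that unfolding \<psi>'_def by linarith
      ultimately show "0 \<le> \<psi>' z \<and> (\<psi>' z = 0 \<longrightarrow> r t' z = r t' x)"
        using \<phi>(2) z unfolding \<psi>'_def by fastforce
    qed
    ultimately have "Inv (Suc n) (e', s', t', \<psi>')"
      unfolding Inv_def prod.case using e' t'(1) \<psi>' \<open>\<psi>' x = 0\<close> by blast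
    moreover have "Rel p (e', s', t', \<psi>')"
      using e' t' \<phi> by (simp add: Rel_def p \<psi>'_def)
    ultimately show "\<exists>q. Inv (Suc n) q \<and> Rel p q" by blast
  qed
  then obtain p where p: "\<And>n. Inv n (p n)" "\<And>n. Rel (p n) (p (Suc n))" by blast
  define e where "e n = fst (p n)" for n
  define s where "s n = fst (snd (p n))" for n
  define t where "t n = fst (snd (snd (p n)))" for n
  define \<psi> where "\<psi> n = snd (snd (snd (p n)))" for n
  have pn: "p n = (e n, s n, t n, \<psi> n)" for n
    by (simp add: e_def s_def t_def \<psi>_def)
  have inv: "e n \<in> topspace K" "s n \<in> M" "r (s n) (e n) = e n" "t n \<in> \<Gamma>" "r (t n) x = x"
    "continuous_map K euclideanreal (\<psi> n)" "\<psi> n x = 0" "\<psi> n (e n) < 1 / real (Suc n)"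
    "\<And>z. z \<in> topspace K \<Longrightarrow> 0 \<le> \<psi> n z" "\<And>z. z \<in> topspace K \<Longrightarrow> \<psi> n z = 0 \<Longrightarrow> r (t n) z = r (t n) x"
    for n using p(1)[of n] unfolding pn Inv_def prod.case by blast+
  have rel: "(s n, s (Suc n)) \<in> R" "(t n, t (Suc n)) \<in> R" "(s n, t (Suc n)) \<in> R"
    "\<And>z. z \<in> topspace K \<Longrightarrow> \<psi> n z \<le> \<psi> (Suc n) z" for n
    using p(2)[of n] by (auto simp: pn Rel_def)
  have inc: "increasing_seq \<Gamma> R s" "increasing_seq \<Gamma> R t"
    using inv rel M by (auto simp: increasing_seq_def)
  obtain sS tS where sup: "is_sup_seq \<Gamma> R s sS" "is_sup_seq \<Gamma> R t tS"
    using ex_sup inc by metis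
  have supD: "sS \<in> \<Gamma>" "tS \<in> \<Gamma>" "\<And>n. (s n, sS) \<in> R" "\<And>n. (t n, tS) \<in> R"
    "\<And>u. u \<in> \<Gamma> \<Longrightarrow> (\<And>n. (s n, u) \<in> R) \<Longrightarrow> (sS, u) \<in> R"
    using sup by (auto simp: is_sup_seq_def)
  have st: "(sS, tS) \<in> R"
    using supD rel R_trans by meson
  have s\<Gamma>: "s n \<in> \<Gamma>" for n using inv(2) M by blast
  have sS_e: "r sS (e n) = e n" for n
    using r_le(1)[OF s\<Gamma> supD(1) supD(3), of "e n" n] inv by simp
  have \<psi>_mono: "\<psi> j z \<le> \<psi> k z" if "j \<le> k" "z \<in> topspace K" for j k z
    using that(1) by (induction rule: dec_induct) (use rel(4)[OF that(2)] order_trans in blast)+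
  \<comment> \<open>\<open>D k\<close> contains \<open>e k\<close>. A common point is fixed by
    \<open>sS\<close>, and every \<open>\<psi> j\<close> vanishes at it.\<close>
  define D where "D k = {z \<in> topspace K. r sS z = z} \<inter>
     (\<Inter>j\<in>{..k}. {z \<in> topspace K. \<psi> j z \<le> 1 / real (Suc k)})" for k
  have "(\<Inter>k\<in>UNIV. D k) \<noteq> {}"
  proof (rule compact_space_directed_Inter[OF compact])
    show "closedin K (D k)" for k
    proof -
      have "closedin K {z \<in> topspace K. \<psi> j z \<le> 1 / real (Suc k)}" for j
        using closedin_continuous_map_preimage[OF inv(6), of "{..1 / real (Suc k)}" j] by simp
      moreover have "closedin K {z \<in> topspace K. r sS z = z}"
        by (rule closedin_continuous_maps_eq[OF Hausdorff r_cont[OF supD(1)]]) simp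
      ultimately show ?thesis unfolding D_def by (intro closedin_Int closedin_INT) auto
    qed
    show "D k \<noteq> {}" for k
    proof -
      have "\<psi> j (e k) \<le> 1 / real (Suc k)" if "j \<le> k" for j
        using \<psi>_mono[OF that inv(1)] inv(8)[of k] by (meson less_imp_le order_trans)
      then have "e k \<in> D k" using inv(1) sS_e by (simp add: D_def)
      then show ?thesis by blast
    qed
    show "\<exists>c\<in>UNIV. D c \<subseteq> D a \<inter> D b" for a b
    proof -
      have "D c \<subseteq> D a" if "a \<le> c" for a c
      proof -
        have "1 / real (Suc c) \<le> 1 / real (Suc a)" using that by (auto intro!: divide_left_mono)
        moreover have "{..a} \<subseteq> {..c}" using that by simp
        ultimately show ?thesis unfolding D_def by (auto intro: order_trans)
      qed
      then have "D (max a b) \<subseteq> D a \<inter> D b" by simp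
      then show ?thesis by blast
    qed
  qed auto
  then obtain z where z: "\<And>k. z \<in> D k" by blast
  have zK: "z \<in> topspace K" "r sS z = z" using z[of 0] by (auto simp: D_def)
  have "\<psi> j z = 0" for j
  proof (rule ccontr)
    assume "\<psi> j z \<noteq> 0"
    then have "\<psi> j z > 0" using inv(9)[OF zK(1), of j] by simp
    then obtain n where n: "1 / real (Suc n) < \<psi> j z" using nat_approx_posE by blast
    have "\<psi> j z \<le> 1 / real (Suc (max j n))" using z[of "max j n"] by (auto simp: D_def)
    also have "\<dots> \<le> 1 / real (Suc n)" by (auto intro!: divide_left_mono)
    finally show False using n by simp
  qed
  then have "r (t j) z = r (t j) x" for j using inv(10)[OF zK(1)] by blast
  \<comment> \<open>Both points are fixed by \<open>tS\<close>: \<open>x\<close> because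
    \<open>t 0\<close> fixes it, \<open>z\<close> because \<open>sS\<close> fixes it and lies below
    \<open>tS\<close>. Hence \<open>x = z\<close>.\<close>
  then have "r tS z = r tS x" by (rule r_sup_eq[OF inc(2) sup(2) zK(1) xK])
  moreover have "r tS x = x" using r_le(1)[OF inv(4) supD(2) supD(4) xK, of 0] inv(5)[of 0] by simp
  moreover have "r tS z = z" using r_le(1)[OF supD(1,2) st zK(1)] zK by simp
  ultimately have xs: "r sS x = x" using zK by simp
  show thesis
  proof
    show "countable (range s)" "range s \<subseteq> M" using inv(2) by auto
    fix u assume u: "u \<in> \<Gamma>" "\<And>c. c \<in> range s \<Longrightarrow> (c, u) \<in> R"
    then have "(sS, u) \<in> R" using supD(5) by blast
    from r_le(1)[OF supD(1) u(1) this xK] xs show "r u x = x" by simp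
  qed
qed

lemma directed_range_subset: "directed_range M \<subseteq> topspace K"
  unfolding directed_range_def by (rule closure_of_subset_topspace)

text \<open>The countable subsets of \<open>M\<close> that reach \<open>x\<close> and
  \<open>y\<close> are dominated by one increasing sequence in \<open>M\<close>. Its supremum,
  possibly outside \<open>M\<close>, fixes both points, and its values at them are limits of equal
  sequences.\<close>

lemma directed_range_separated:
  assumes M: "up_directed M R" "M \<subseteq> \<Gamma>" and xy: "x \<in> directed_range M" "y \<in> directed_range M"
    and eq: "\<And>s. s \<in> M \<Longrightarrow> r s x = r s y"
  shows "x = y"
proof -
  obtain C where C: "countable C" "C \<subseteq> M"
    "\<And>t. t \<in> \<Gamma> \<Longrightarrow> (\<And>c. c \<in> C \<Longrightarrow> (c, t) \<in> R) \<Longrightarrow> r t x = x"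
    using directed_range_fixed[OF M xy(1)] by metis
  obtain D where D: "countable D" "D \<subseteq> M"
    "\<And>t. t \<in> \<Gamma> \<Longrightarrow> (\<And>c. c \<in> D \<Longrightarrow> (c, t) \<in> R) \<Longrightarrow> r t y = y"
    using directed_range_fixed[OF M xy(2)] by metis
  obtain \<sigma> where \<sigma>: "increasing_seq M R \<sigma>" "\<And>c. c \<in> C \<union> D \<Longrightarrow> \<exists>n. (c, \<sigma> n) \<in> R"
    using countable_dominating_seq[OF M(1) po(2), of "C \<union> D"] C D by auto
  have inc: "increasing_seq \<Gamma> R \<sigma>" using \<sigma>(1) M(2) by (auto simp: increasing_seq_def)
  obtain s where s: "is_sup_seq \<Gamma> R \<sigma> s" using ex_sup[OF inc] by blast
  have sD: "s \<in> \<Gamma>" "\<And>n. (\<sigma> n, s) \<in> R" using s by (auto simp: is_sup_seq_def)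
  have dom: "(c, s) \<in> R" if "c \<in> C \<union> D" for c
    using \<sigma>(2)[OF that] sD R_trans by blast
  have xyK: "x \<in> topspace K" "y \<in> topspace K" using xy directed_range_subset by auto
  have "r s x = r s y"
    by (rule r_sup_eq[OF inc s xyK eq]) (use \<sigma>(1) in \<open>auto simp: increasing_seq_def\<close>)
  then show ?thesis using C(3)[OF sD(1)] D(3)[OF sD(1)] dom by auto
qed

text \<open>\<open>y\<close> is a cluster point of the net of all \<open>r s x\<close> with
  \<open>s \<in> M\<close>. The equation \<open>r s (r t x) = r s x\<close> for \<open>t\<close>
  above \<open>s\<close> passes to \<open>y\<close> because it defines a closed set. The last clause
  expresses clustering in terms of real functions, as the estimate of jumps will need it.\<close>

lemma ex_limit_retract:
  assumes M: "up_directed M R" "M \<subseteq> \<Gamma>" and x: "x \<in> topspace K"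
  shows "\<exists>y. y \<in> directed_range M \<and> (\<forall>s\<in>M. r s y = r s x) \<and>
    (\<forall>u\<in>M. \<forall>f \<delta>. continuous_map K euclideanreal f \<and> \<delta> > 0 \<longrightarrow>
       (\<exists>s\<in>M. (u, s) \<in> R \<and> \<bar>f (r s x) - f y\<bar> < \<delta>))"
proof -
  define C where "C u = K closure_of ((\<lambda>s. r s x) ` {s \<in> M. (u, s) \<in> R})" for u
  have inK: "r s x \<in> topspace K" if "s \<in> M" for s using r_in[OF _ x] M that by blast
  have "(\<Inter>u\<in>M. C u) \<noteq> {}"
  proof (rule compact_space_directed_Inter[OF compact])
    show "M \<noteq> {}" using M by (auto simp: up_directed_def)
    show "closedin K (C u)" for u by (simp add: C_def)
    show "C u \<noteq> {}" if "u \<in> M" for u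
    proof -
      have "r u x \<in> C u"
        unfolding C_def using that M R_refl inK
        by (intro subsetD[OF closure_of_subset]) auto
      then show ?thesis by blast
    qed
    show "\<exists>c\<in>M. C c \<subseteq> C a \<inter> C b" if ab: "a \<in> M" "b \<in> M" for a b
    proof -
      obtain c where c: "c \<in> M" "(a, c) \<in> R" "(b, c) \<in> R"
        using M(1) ab unfolding up_directed_def by meson
      then have "C c \<subseteq> C a" "C c \<subseteq> C b"
        unfolding C_def by (auto intro!: closure_of_mono dest: R_trans)
      with c show ?thesis by blast
    qed
  qed
  then obtain y where y: "\<And>u. u \<in> M \<Longrightarrow> y \<in> C u" by blast
  obtain m where m: "m \<in> M" using M by (auto simp: up_directed_def)
  have yK: "y \<in> topspace K" using y[OF m] by (simp add: C_def in_closure_of)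
  have "C m \<subseteq> directed_range M"
    unfolding C_def directed_range_def using x by (intro closure_of_mono) auto
  then have "y \<in> directed_range M" using y[OF m] by blast
  moreover have "r s y = r s x" if s: "s \<in> M" for s
  proof -
    have s\<Gamma>: "s \<in> \<Gamma>" using s M by blast
    have "closedin K {z \<in> topspace K. r s z = r s x}"
      by (rule closedin_continuous_maps_eq[OF Hausdorff r_cont[OF s\<Gamma>]]) (simp add: inK s)
    moreover have "(\<lambda>s. r s x) ` {t \<in> M. (s, t) \<in> R} \<subseteq> {z \<in> topspace K. r s z = r s x}"
      using r_le(2)[OF s\<Gamma> _ _ x] M inK by auto
    ultimately have "C s \<subseteq> {z \<in> topspace K. r s z = r s x}"
      unfolding C_def by (rule closure_of_minimal[rotated])
    then show ?thesis using y[OF s] by blast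
  qed
  moreover have "\<exists>s\<in>M. (u, s) \<in> R \<and> \<bar>f (r s x) - f y\<bar> < \<delta>"
    if u: "u \<in> M" and f: "continuous_map K euclideanreal f" "\<delta> > 0" for u f \<delta>
  proof -
    have "openin K {z \<in> topspace K. \<bar>f z - f y\<bar> < \<delta>}"
    proof -
      have "continuous_map K euclideanreal (\<lambda>z. \<bar>f z - f y\<bar>)"
        by (intro continuous_map_real_abs continuous_map_diff f) auto
      from openin_continuous_map_preimage[OF this, of "{..<\<delta>}"] show ?thesis by simp
    qed
    moreover have "y \<in> {z \<in> topspace K. \<bar>f z - f y\<bar> < \<delta>}" using yK f by simp
    ultimately have "\<exists>w\<in>(\<lambda>s. r s x) ` {s \<in> M. (u, s) \<in> R}. w \<in> {z \<in> topspace K. \<bar>f z - f y\<bar> < \<delta>}"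
      by (rule closure_of_meets[OF y[OF u, unfolded C_def]])
    then show ?thesis by auto
  qed
  ultimately show ?thesis by (intro exI[of _ y]) simp
qed

text \<open>
  The retraction associated with a directed set \<open>M\<close> of indices; for empty \<open>M\<close> a constant map, so
  that the differences in the induction below need no special treatment at the bottom.
\<close>

definition directed_retraction :: "'i set \<Rightarrow> 'a \<Rightarrow> 'a" where
  "directed_retraction M x = (if M = {} then (SOME z. z \<in> topspace K) else
     (SOME y. y \<in> directed_range M \<and> (\<forall>s\<in>M. r s y = r s x) \<and>
      (\<forall>u\<in>M. \<forall>f \<delta>. continuous_map K euclideanreal f \<and> \<delta> > 0 \<longrightarrow>
       (\<exists>s\<in>M. (u, s) \<in> R \<and> \<bar>f (r s x) - f y\<bar> < \<delta>))))"

lemma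
  assumes M: "up_directed M R" "M \<subseteq> \<Gamma>" and x: "x \<in> topspace K"
  shows directed_retraction_directed_range: "directed_retraction M x \<in> directed_range M"
    and r_directed_retraction: "\<And>s. s \<in> M \<Longrightarrow> r s (directed_retraction M x) = r s x"
    and directed_retraction_cluster: "\<And>u f \<delta>. u \<in> M \<Longrightarrow> continuous_map K euclideanreal f \<Longrightarrow> \<delta> > 0 \<Longrightarrow>
       \<exists>s\<in>M. (u, s) \<in> R \<and> \<bar>f (r s x) - f (directed_retraction M x)\<bar> < \<delta>"
proof -
  have "M \<noteq> {}" using M by (auto simp: up_directed_def)
  then have "directed_retraction M x \<in> directed_range M \<and> (\<forall>s\<in>M. r s (directed_retraction M x) = r s x) \<and>
      (\<forall>u\<in>M. \<forall>f \<delta>. continuous_map K euclideanreal f \<and> \<delta> > 0 \<longrightarrow>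
       (\<exists>s\<in>M. (u, s) \<in> R \<and> \<bar>f (r s x) - f (directed_retraction M x)\<bar> < \<delta>))"
    unfolding directed_retraction_def using someI_ex[OF ex_limit_retract[OF M x]] by simp
  then show "directed_retraction M x \<in> directed_range M" "\<And>s. s \<in> M \<Longrightarrow> r s (directed_retraction M x) = r s x"
    "\<And>u f \<delta>. u \<in> M \<Longrightarrow> continuous_map K euclideanreal f \<Longrightarrow> \<delta> > 0 \<Longrightarrow>
       \<exists>s\<in>M. (u, s) \<in> R \<and> \<bar>f (r s x) - f (directed_retraction M x)\<bar> < \<delta>"
    by blast+
qed

lemma directed_retraction_in:
  assumes M: "M = {} \<or> up_directed M R" "M \<subseteq> \<Gamma>" and x: "x \<in> topspace K"
  shows "directed_retraction M x \<in> topspace K"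
proof (cases "M = {}")
  case True
  then show ?thesis using nonempty by (auto simp: directed_retraction_def some_in_eq)
next
  case False
  then show ?thesis using directed_retraction_directed_range[of M x] M x directed_range_subset by blast
qed

text \<open>For nonempty \<open>M\<close> both images lie in \<open>directed_range M\<close>, where
  the maps \<open>r s\<close> with \<open>s \<in> M\<close> separate points.\<close>

lemma directed_retraction_eq:
  assumes M: "M = {} \<or> up_directed M R" "M \<subseteq> \<Gamma>" and xy: "x \<in> topspace K" "y \<in> topspace K"
    and eq: "\<And>s. s \<in> M \<Longrightarrow> r s x = r s y"
  shows "directed_retraction M x = directed_retraction M y"
proof (cases "M = {}")
  case False
  with M have M: "up_directed M R" "M \<subseteq> \<Gamma>" by auto
  show ?thesis
    by (rule directed_range_separated[OF M directed_retraction_directed_range[OF M xy(1)] directed_retraction_directed_range[OF M xy(2)]])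
      (simp add: r_directed_retraction[OF M] xy eq)
qed (simp add: directed_retraction_def)

text \<open>By separation, a pair with second component in \<open>directed_range M\<close> belongs
  to the graph as soon as all \<open>r s\<close> with \<open>s \<in> M\<close> agree on its
  components. These conditions are closed.\<close>

lemma directed_retraction_cont:
  assumes M: "M = {} \<or> up_directed M R" "M \<subseteq> \<Gamma>"
  shows "continuous_map K K (directed_retraction M)"
proof (cases "M = {}")
  case True
  then have "directed_retraction M = (\<lambda>x. SOME z. z \<in> topspace K)" by (auto simp: directed_retraction_def)
  then show ?thesis using nonempty by (simp add: some_in_eq)
next
  case False
  with M have M': "up_directed M R" by auto
  define P where "P = prod_topology K K"
  have "{z \<in> topspace K \<times> topspace K. snd z = directed_retraction M (fst z)} =
      (topspace K \<times> directed_range M) \<inter> (\<Inter>s\<in>M. {z \<in> topspace P. r s (snd z) = r s (fst z)})"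
    (is "?G = ?H")
  proof (intro set_eqI iffI)
    fix z assume z: "z \<in> ?G"
    then have zK: "fst z \<in> topspace K" "snd z \<in> topspace K" "snd z = directed_retraction M (fst z)" by auto
    then have "snd z \<in> directed_range M" using directed_retraction_directed_range[OF M' M(2)] by metis
    moreover have "r s (snd z) = r s (fst z)" if "s \<in> M" for s
      unfolding zK(3) by (rule r_directed_retraction[OF M' M(2) zK(1) that])
    moreover have "z \<in> topspace P" unfolding P_def using zK by (simp add: mem_Times_iff)
    ultimately show "z \<in> ?H"
      using zK(1) by (intro IntI INT_I CollectI conjI) (auto simp: mem_Times_iff simp del: topspace_prod_topology)
  next
    fix z assume z: "z \<in> ?H"
    from IntD1[OF z] have "fst z \<in> topspace K" "snd z \<in> directed_range M"
      by (simp_all only: mem_Times_iff)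
    have "snd z = directed_retraction M (fst z)"
    proof (rule directed_range_separated[OF M' M(2) _ directed_retraction_directed_range[OF M' M(2) \<open>fst z \<in> topspace K\<close>]])
      show "snd z \<in> directed_range M" by fact
      fix s assume s: "s \<in> M"
      have "r s (snd z) = r s (fst z)" using INT_D[OF IntD2[OF z] s] by (simp only: mem_Collect_eq)
      also have "\<dots> = r s (directed_retraction M (fst z))"
        using r_directed_retraction[OF M' M(2) \<open>fst z \<in> topspace K\<close> s] by simp
      finally show "r s (snd z) = r s (directed_retraction M (fst z))" .
    qed
    moreover have "snd z \<in> topspace K" using \<open>snd z \<in> directed_range M\<close> directed_range_subset by blast
    ultimately show "z \<in> ?G" using \<open>fst z \<in> topspace K\<close> by (simp add: mem_Times_iff)
  qed
  moreover have "closedin P {z \<in> topspace P. r s (snd z) = r s (fst z)}" if "s \<in> M" for s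
  proof (rule closedin_continuous_maps_eq[OF Hausdorff])
    have "continuous_map K K (r s)" using r_cont M that by blast
    then show "continuous_map P K (\<lambda>z. r s (snd z))" "continuous_map P K (\<lambda>z. r s (fst z))"
      unfolding P_def by (auto intro: continuous_map_compose[unfolded o_def, OF continuous_map_snd]
         continuous_map_compose[unfolded o_def, OF continuous_map_fst])
  qed
  moreover have "closedin P (topspace K \<times> directed_range M)"
    by (simp add: P_def directed_range_def closedin_prod_Times_iff)
  ultimately have "closedin (prod_topology K K) ?G"
    using False by (auto simp: P_def[symmetric] intro!: closedin_Int closedin_INT)
  then show ?thesis
    using directed_retraction_in[OF M] by (intro continuous_map_from_closed_graph compact) auto
qed

end

section \<open>Induction on the cardinality of directed sets of indices\<close>

unbundle cardinal_syntax

definition step_closure :: "('i \<Rightarrow> 'i \<Rightarrow> 'i) \<Rightarrow> 'i set \<Rightarrow> 'i set" where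
  "step_closure u X = X \<union> (\<lambda>(a, b). u a b) ` (X \<times> X)"

text \<open>Later \<open>u\<close> chooses upper bounds, so that closed sets are directed.
  Generating the closure in countably many steps keeps its cardinality under control.\<close>

definition closure_under :: "('i \<Rightarrow> 'i \<Rightarrow> 'i) \<Rightarrow> 'i set \<Rightarrow> 'i set" where
  "closure_under u X = (\<Union>n. (step_closure u ^^ n) X)"

lemma step_closure_power_mono: "m \<le> n \<Longrightarrow> (step_closure u ^^ m) X \<subseteq> (step_closure u ^^ n) X"
  by (induction rule: dec_induct) (auto simp: step_closure_def)

lemma subset_closure_under: "X \<subseteq> closure_under u X"
proof
  fix x assume "x \<in> X"
  then have "x \<in> (step_closure u ^^ 0) X" by simp
  then show "x \<in> closure_under u X" unfolding closure_under_def by blast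
qed

lemma closure_under_closed:
  assumes "a \<in> closure_under u X" "b \<in> closure_under u X"
  shows "u a b \<in> closure_under u X"
proof -
  obtain m n where "a \<in> (step_closure u ^^ m) X" "b \<in> (step_closure u ^^ n) X"
    using assms by (auto simp: closure_under_def)
  then have "a \<in> (step_closure u ^^ max m n) X" "b \<in> (step_closure u ^^ max m n) X"
    using step_closure_power_mono[of m "max m n" u X] step_closure_power_mono[of n "max m n" u X]
    by auto
  then have "u a b \<in> (step_closure u ^^ Suc (max m n)) X"
    by (auto simp: step_closure_def)
  then show ?thesis unfolding closure_under_def by blast
qed

lemma closure_under_induct [consumes 1, case_names base step]:
  assumes "x \<in> closure_under u X" "\<And>a. a \<in> X \<Longrightarrow> P a" "\<And>a b. P a \<Longrightarrow> P b \<Longrightarrow> P (u a b)"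
  shows "P x"
proof -
  have "\<forall>x \<in> (step_closure u ^^ n) X. P x" for n
  proof (induction n)
    case (Suc n)
    show ?case
    proof
      fix x assume "x \<in> (step_closure u ^^ Suc n) X"
      then consider "x \<in> (step_closure u ^^ n) X"
        | a b where "a \<in> (step_closure u ^^ n) X" "b \<in> (step_closure u ^^ n) X" "x = u a b"
        by (auto simp: step_closure_def)
      then show "P x"
      proof cases
        case 1
        with Suc show ?thesis by (rule bspec)
      next
        case (2 a b)
        show ?thesis unfolding 2(3) by (rule assms(3)) (rule bspec[OF Suc 2(1)], rule bspec[OF Suc 2(2)])
      qed
    qed
  qed (simp add: assms(2))
  moreover obtain n where "x \<in> (step_closure u ^^ n) X"
    using assms(1) unfolding closure_under_def by blast
  ultimately show ?thesis by (rule bspec)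
qed

lemma closure_under_mono:
  assumes "X \<subseteq> Y" shows "closure_under u X \<subseteq> closure_under u Y"
proof
  fix x assume "x \<in> closure_under u X"
  then show "x \<in> closure_under u Y"
  proof (induction rule: closure_under_induct)
    case (base a)
    then show ?case using assms subset_closure_under[of Y u] by blast
  next
    case (step a b)
    then show ?case by (rule closure_under_closed)
  qed
qed

lemma closure_under_subset:
  assumes "X \<subseteq> M" "\<And>a b. a \<in> M \<Longrightarrow> b \<in> M \<Longrightarrow> u a b \<in> M"
  shows "closure_under u X \<subseteq> M"
proof
  fix x assume "x \<in> closure_under u X"
  then show "x \<in> M"
  proof (induction rule: closure_under_induct)
    case (base a)
    then show ?case using assms(1) by blast
  next
    case (step a b)
    then show ?case by (rule assms(2))
  qed
qed

text \<open>One step stays within the cardinality of \<open>Y \<times> Y\<close>, which is that of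
  \<open>Y\<close>, and there are countably many steps. Comparing with a separate infinite
  \<open>Y\<close> also covers finite \<open>X\<close>, with the naturals as
  \<open>Y\<close>.\<close>

lemma card_of_closure_under:
  assumes Y: "infinite Y" and X: "|X| \<le>o |Y|"
  shows "|closure_under u X| \<le>o |Y|"
proof -
  have "|(step_closure u ^^ n) X| \<le>o |Y|" for n
  proof (induction n)
    case 0
    then show ?case using X by simp
  next
    case (Suc n)
    let ?Z = "(step_closure u ^^ n) X"
    have "|?Z \<times> ?Z| \<le>o |?Z \<times> Y|" by (rule card_of_Times_mono2[OF Suc])
    also have "|?Z \<times> Y| \<le>o |Y \<times> Y|" by (rule card_of_Times_mono1[OF Suc])
    also have "|Y \<times> Y| =o |Y|" by (rule card_of_Times_same_infinite[OF Y])
    finally have "|(\<lambda>(a, b). u a b) ` (?Z \<times> ?Z)| \<le>o |Y|"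
      using card_of_image ordLeq_transitive by blast
    then show ?case
      using Suc Y unfolding step_closure_def funpow.simps o_apply
      by (intro card_of_Un_ordLeq_infinite_Field) (simp_all add: Field_card_of card_of_card_order_on)
  qed
  moreover have "|UNIV :: nat set| \<le>o |Y|" using Y infinite_iff_card_of_nat by blast
  ultimately show ?thesis
    unfolding closure_under_def by (intro card_of_UNION_ordLeq_infinite[OF Y]) auto
qed

text \<open>Pass to the least element of what remains, keeping the invariant that infinitely many
  members of \<open>Z\<close> lie strictly above the current one.\<close>

lemma infinite_increasing_seq:
  assumes W: "Well_order W" and Z: "Z \<subseteq> Field W" "infinite Z"
  obtains m where "\<And>k::nat. m k \<in> Z" "\<And>k. m k \<in> underS W (m (Suc k))"
proof -
  have lin: "(a, b) \<in> W \<or> (b, a) \<in> W" if "a \<in> Field W" "b \<in> Field W" for a b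
    using W that unfolding well_order_on_def linear_order_on_def total_on_def
      partial_order_on_def preorder_on_def refl_on_def by metis
  have least: "\<exists>a\<in>T. \<forall>b\<in>T. (a, b) \<in> W" if T: "T \<subseteq> Field W" "T \<noteq> {}" for T
  proof -
    have "wf (W - Id)" using W by (simp add: well_order_on_def)
    then obtain a where a: "a \<in> T" "\<And>b. (b, a) \<in> W - Id \<Longrightarrow> b \<notin> T"
      using T(2) by (metis wfE_min all_not_in_conv)
    then have "(a, b) \<in> W" if "b \<in> T" for b
      using lin[of a b] T(1) that by auto
    then show ?thesis using a by blast
  qed
  define above where "above a = {z \<in> Z. a \<in> underS W z}" for a
  have step: "\<exists>b\<in>T. infinite (T \<inter> above b)" if T: "T \<subseteq> Z" "infinite T" for T
  proof -
    have "T \<noteq> {}" using T(2) by auto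
    then obtain b where b: "b \<in> T" "\<And>c. c \<in> T \<Longrightarrow> (b, c) \<in> W" using least[OF subset_trans[OF T(1) Z(1)]] by blast
    then have "T - {b} \<subseteq> T \<inter> above b"
      using T(1) by (auto simp: above_def underS_def)
    then have "infinite (T \<inter> above b)" using T(2) by (meson finite_Diff2 finite.intros finite_subset)
    then show ?thesis using b by blast
  qed
  have "\<exists>m. \<forall>k::nat. (m k \<in> Z \<and> infinite (above (m k))) \<and> m k \<in> underS W (m (Suc k))"
  proof (rule dependent_nat_choice)
    show "\<exists>b. b \<in> Z \<and> infinite (above b)"
      using step[of Z] Z by (meson finite_subset inf_le2 order_refl infinite_super)
    show "\<exists>b. (b \<in> Z \<and> infinite (above b)) \<and> a \<in> underS W b" if a: "a \<in> Z \<and> infinite (above a)" for a and n :: nat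
    proof -
      obtain b where "b \<in> above a" "infinite (above a \<inter> above b)"
        using step[of "above a"] a by (auto simp: above_def)
      moreover from this have "infinite (above b)" by (meson finite_Int)
      ultimately show ?thesis by (auto simp: above_def)
    qed
  qed
  then show thesis using that by blast
qed

section \<open>Function families determined by a directed set of indices\<close>

context full_skeleton_space
begin

text \<open>The splitting into countably many subfamilies is a colouring by naturals, and it may
  depend on \<open>\<epsilon>\<close>, as the covering in (3) does. Both directions of the
  equivalence matter: one makes the functions separate enough points, the other makes them invariant
  under the retraction belonging to \<open>M\<close>.\<close>

definition determined_c0 :: "'i set \<Rightarrow> ('a \<Rightarrow> real) set \<Rightarrow> bool" where
  "determined_c0 M G \<longleftrightarrow>
     (\<forall>g\<in>G. continuous_map K euclideanreal g \<and> (\<forall>x\<in>topspace K. \<bar>g x\<bar> \<le> 1)) \<and>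
     (\<forall>x\<in>topspace K. \<forall>y\<in>topspace K. (\<forall>g\<in>G. g x = g y) \<longleftrightarrow> (\<forall>s\<in>M. r s x = r s y)) \<and>
     (\<forall>\<epsilon>>0. \<exists>c :: ('a \<Rightarrow> real) \<Rightarrow> nat. \<forall>n. \<forall>x\<in>topspace K. finite {g \<in> G. c g = n \<and> \<bar>g x\<bar> > \<epsilon>})"

text \<open>The range of \<open>r s\<close> is a compact metric space; the functions are the
  distances to the points of its finite 1 / (n + 1)-nets, truncated at 1.\<close>

lemma ex_countable_determining:
  assumes s: "s \<in> \<Gamma>"
  obtains G where "countable G" "\<And>g. g \<in> G \<Longrightarrow> continuous_map K euclideanreal g"
    "\<And>g x. g \<in> G \<Longrightarrow> x \<in> topspace K \<Longrightarrow> \<bar>g x\<bar> \<le> 1"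
    "\<And>x y. x \<in> topspace K \<Longrightarrow> y \<in> topspace K \<Longrightarrow> (\<forall>g\<in>G. g x = g y) \<longleftrightarrow> r s x = r s y"
proof -
  obtain S d where Sd: "Metric_space S d" "subtopology K (r s ` topspace K) = Metric_space.mtopology S d"
    "\<And>x. x \<in> topspace K \<Longrightarrow> r s x \<in> S" "S = r s ` topspace K"
    "\<And>q. q \<in> S \<Longrightarrow> continuous_map K euclideanreal (\<lambda>z. d q (r s z))"
    by (rule ex_metric[OF s]) (rule that; assumption)
  interpret Metric_space S d by fact
  have "compactin K (r s ` topspace K)"
    using image_compactin r_cont[OF s] compact unfolding compact_space_def by blast
  then have "compact_space mtopology"
    unfolding Sd(2)[symmetric] compactin_subspace by blast
  then have "compactin mtopology S" by (simp add: compact_space_def)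
  then have "mtotally_bounded S" by (rule compactin_imp_mtotally_bounded)
  then have "\<exists>Q. finite Q \<and> Q \<subseteq> S \<and> S \<subseteq> (\<Union>q\<in>Q. mball q (1 / real (Suc n)))" for n
    unfolding mtotally_bounded_def by (simp del: of_nat_Suc)
  then obtain Q where Q: "\<And>n. finite (Q n)" "\<And>n. Q n \<subseteq> S"
    "\<And>n. S \<subseteq> (\<Union>q\<in>Q n. mball q (1 / real (Suc n)))" by metis
  define g where "g q z = min 1 (d q (r s z))" for q z
  define G where "G = g ` (\<Union>n. Q n)"
  show thesis
  proof
    show "countable G" unfolding G_def using Q(1) by (intro countable_image countable_UN) (auto intro: countable_finite)
    fix h assume "h \<in> G"
    then obtain q where h: "h = g q" "q \<in> S" using Q by (auto simp: G_def)
    show "continuous_map K euclideanreal h"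
      unfolding h g_def by (intro continuous_map_real_min Sd(5) h) auto
    show "\<bar>h x\<bar> \<le> 1" if "x \<in> topspace K" for x
      unfolding h g_def by auto
  next
    fix x y assume xy: "x \<in> topspace K" "y \<in> topspace K"
    show "(\<forall>g\<in>G. g x = g y) \<longleftrightarrow> r s x = r s y"
    proof
      assume eq: "\<forall>g\<in>G. g x = g y"
      show "r s x = r s y"
      proof (rule ccontr)
        assume "r s x \<noteq> r s y"
        then have "d (r s x) (r s y) > 0" using Sd(3) xy by simp
        \<comment> \<open>Below 1, so that the truncation is inactive at a net point near
          \<open>r s x\<close>; below half the distance, so that the triangle inequality gives a
          contradiction.\<close>
        then obtain n where n: "1 / real (Suc n) < min 1 (d (r s x) (r s y) / 2)"
          using nat_approx_posE[of "min 1 (d (r s x) (r s y) / 2)"] by auto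
        obtain q where q: "q \<in> Q n" "d q (r s x) < 1 / real (Suc n)"
          using Q(3)[of n] Sd(3)[OF xy(1)] by (auto simp del: of_nat_Suc)
        then have "g q x = g q y" using eq by (auto simp: G_def)
        then have "d q (r s y) = d q (r s x)" using q n by (simp add: g_def min_def split: if_splits)
        moreover have "d (r s x) (r s y) \<le> d q (r s x) + d q (r s y)"
          using triangle[of "r s x" q "r s y"] Sd(3) xy q Q(2) commute by (metis subsetD)
        ultimately show False using q n by simp
      qed
    next
      assume "r s x = r s y"
      then show "\<forall>g\<in>G. g x = g y" by (auto simp: G_def g_def)
    qed
  qed
qed

text \<open>An increasing sequence dominating \<open>M\<close> has a supremum \<open>s\<close>, and
  \<open>r s\<close> carries the same information as all \<open>r t\<close> with
  \<open>t \<in> M\<close>. Countably many functions determine \<open>r s\<close>, and each can have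
  a colour of its own.\<close>

lemma determined_c0_countable:
  assumes M: "up_directed M R" "M \<subseteq> \<Gamma>" and "countable M"
  shows "\<exists>G. determined_c0 M G"
proof -
  obtain \<sigma> where \<sigma>: "increasing_seq M R \<sigma>" "\<And>c. c \<in> M \<Longrightarrow> \<exists>n. (c, \<sigma> n) \<in> R"
    using countable_dominating_seq[OF M(1) po(2) \<open>countable M\<close>] by auto
  have inc: "increasing_seq \<Gamma> R \<sigma>" using \<sigma>(1) M(2) by (auto simp: increasing_seq_def)
  have \<sigma>M: "\<sigma> n \<in> M" for n using \<sigma>(1) by (simp add: increasing_seq_def)
  obtain s where s: "is_sup_seq \<Gamma> R \<sigma> s" using ex_sup[OF inc] by blast
  have sD: "s \<in> \<Gamma>" "\<And>n. (\<sigma> n, s) \<in> R" using s by (auto simp: is_sup_seq_def)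
  have sM: "r s x = r s y \<longleftrightarrow> (\<forall>t\<in>M. r t x = r t y)"
    if xy: "x \<in> topspace K" "y \<in> topspace K" for x y
  proof
    assume eq: "r s x = r s y"
    show "\<forall>t\<in>M. r t x = r t y"
    proof
      fix t assume t: "t \<in> M"
      then have "(t, s) \<in> R" using \<sigma>(2) sD R_trans by blast
      then show "r t x = r t y"
        using r_le(2)[of t s x] r_le(2)[of t s y] t M sD xy eq by (metis subsetD)
    qed
  next
    assume "\<forall>t\<in>M. r t x = r t y"
    then show "r s x = r s y" using r_sup_eq[OF inc s xy] \<sigma>M by blast
  qed
  obtain G where G: "countable G" "\<And>g. g \<in> G \<Longrightarrow> continuous_map K euclideanreal g"
    "\<And>g x. g \<in> G \<Longrightarrow> x \<in> topspace K \<Longrightarrow> \<bar>g x\<bar> \<le> 1"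
    "\<And>x y. x \<in> topspace K \<Longrightarrow> y \<in> topspace K \<Longrightarrow> (\<forall>g\<in>G. g x = g y) \<longleftrightarrow> r s x = r s y"
    by (rule ex_countable_determining[OF sD(1)]) (rule that; assumption)
  have "finite {g \<in> G. to_nat_on G g = n \<and> \<bar>g x\<bar> > \<epsilon>}" for n x \<epsilon>
  proof (rule finite_subset)
    show "{g \<in> G. to_nat_on G g = n \<and> \<bar>g x\<bar> > \<epsilon>} \<subseteq> {from_nat_into G n}"
      using from_nat_into_to_nat_on[OF G(1)] by fastforce
  qed simp
  then have "determined_c0 M G"
    unfolding determined_c0_def
    by (intro conjI ballI allI impI exI[of _ "to_nat_on G"]) (simp_all add: G(2,3,4) sM)
  then show ?thesis by blast
qed

end

text \<open>The form in which (3) enters the induction: \<open>a f\<close> will be the number of a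
  covering set containing \<open>f\<close>, and one \<open>N\<close> serves all functions with the
  same number.\<close>

definition (in skeleton) small_jumps :: "real \<Rightarrow> (('a \<Rightarrow> real) \<Rightarrow> nat) \<Rightarrow> bool" where
  "small_jumps \<epsilon> a \<longleftrightarrow> (\<forall>n. \<forall>x\<in>topspace K. \<forall>\<sigma>. increasing_seq \<Gamma> R \<sigma> \<longrightarrow>
     (\<exists>N. \<forall>k\<ge>N. \<forall>f. continuous_map K euclideanreal f \<and> (\<forall>z\<in>topspace K. \<bar>f z\<bar> \<le> 1) \<and> a f = n \<longrightarrow>
        \<bar>f (r (\<sigma> k) x) - f (r (\<sigma> (Suc k)) x)\<bar> \<le> \<epsilon>))"

context full_skeleton_space
begin

text \<open>The retracts at \<open>L k\<close> and \<open>U k\<close> are approximated by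
  \<open>r s x\<close> and \<open>r t x\<close> with \<open>s\<close> below \<open>t\<close>. The
  inclusions between the sets let these pairs be chained into a single increasing sequence, which
  then has infinitely many jumps above \<open>\<epsilon>\<close>.\<close>

lemma no_large_jumps:
  assumes a: "small_jumps \<epsilon> a" and x: "x \<in> topspace K"
    and L: "\<And>k. up_directed (L k) R" "\<And>k. L k \<subseteq> \<Gamma>"
    and U: "\<And>k. up_directed (U k) R" "\<And>k. U k \<subseteq> \<Gamma>"
    and LU: "\<And>k. L k \<subseteq> U k" and UL: "\<And>k. U k \<subseteq> L (Suc k)"
    and f: "\<And>k. continuous_map K euclideanreal (f k)" "\<And>k z. z \<in> topspace K \<Longrightarrow> \<bar>f k z\<bar> \<le> 1"
      "\<And>k. a (f k) = q"
    and jump: "\<And>k::nat. \<bar>f k (directed_retraction (U k) x) - f k (directed_retraction (L k) x)\<bar> > 2 * \<epsilon>" and "\<epsilon> > 0"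
  shows False
proof -
  have next_pair: "\<exists>p. fst p \<in> L k \<and> snd p \<in> U k \<and> (u, fst p) \<in> R \<and> (fst p, snd p) \<in> R \<and>
      \<bar>f k (r (snd p) x) - f k (r (fst p) x)\<bar> > \<epsilon>" if u: "u \<in> L k" for u k
  proof -
    \<comment> \<open>Two errors below \<open>\<epsilon> / 2\<close> leave more than
      \<open>\<epsilon>\<close> of a difference exceeding \<open>2 * \<epsilon>\<close>.\<close>
    obtain s where s: "s \<in> L k" "(u, s) \<in> R" "\<bar>f k (r s x) - f k (directed_retraction (L k) x)\<bar> < \<epsilon> / 2"
      using directed_retraction_cluster[OF L x u f(1), of "\<epsilon> / 2"] \<open>\<epsilon> > 0\<close> by auto
    then have "s \<in> U k" using LU by blast
    then obtain t where t: "t \<in> U k" "(s, t) \<in> R" "\<bar>f k (r t x) - f k (directed_retraction (U k) x)\<bar> < \<epsilon> / 2"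
      using directed_retraction_cluster[OF U x _ f(1), of s k "\<epsilon> / 2"] \<open>\<epsilon> > 0\<close> by auto
    have "\<bar>f k (r t x) - f k (r s x)\<bar> > \<epsilon>" using s(3) t(3) jump[of k] by linarith
    with s t show ?thesis by (intro exI[of _ "(s, t)"]) simp
  qed
  have "\<exists>p. \<forall>k. (fst (p k) \<in> L k \<and> snd (p k) \<in> U k \<and> (fst (p k), snd (p k)) \<in> R \<and>
      \<bar>f k (r (snd (p k)) x) - f k (r (fst (p k)) x)\<bar> > \<epsilon>) \<and> (snd (p k), fst (p (Suc k))) \<in> R"
  proof (rule dependent_nat_choice)
    obtain u where "u \<in> L 0" using L(1)[of 0] by (auto simp: up_directed_def)
    from next_pair[OF this] show "\<exists>p. fst p \<in> L 0 \<and> snd p \<in> U 0 \<and> (fst p, snd p) \<in> R \<and>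
      \<bar>f 0 (r (snd p) x) - f 0 (r (fst p) x)\<bar> > \<epsilon>" by blast
  next
    fix p k assume "fst p \<in> L k \<and> snd p \<in> U k \<and> (fst p, snd p) \<in> R \<and>
      \<bar>f k (r (snd p) x) - f k (r (fst p) x)\<bar> > \<epsilon>"
    then have "snd p \<in> L (Suc k)" using UL by blast
    from next_pair[OF this] show "\<exists>p'. (fst p' \<in> L (Suc k) \<and> snd p' \<in> U (Suc k) \<and> (fst p', snd p') \<in> R \<and>
      \<bar>f (Suc k) (r (snd p') x) - f (Suc k) (r (fst p') x)\<bar> > \<epsilon>) \<and> (snd p, fst p') \<in> R" by blast
  qed
  then obtain p where p: "\<And>k. fst (p k) \<in> L k" "\<And>k. snd (p k) \<in> U k" "\<And>k. (fst (p k), snd (p k)) \<in> R"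
    "\<And>k. \<bar>f k (r (snd (p k)) x) - f k (r (fst (p k)) x)\<bar> > \<epsilon>" "\<And>k. (snd (p k), fst (p (Suc k))) \<in> R"
    by blast
  \<comment> \<open>Each pair occupies an even position and its successor. The jump of pair
    \<open>N\<close> thus occurs at position \<open>2 * N\<close>, which is at least
    \<open>N\<close>.\<close>
  define \<sigma> where "\<sigma> n = (if even n then fst (p (n div 2)) else snd (p (n div 2)))" for n
  have \<sigma>\<Gamma>: "\<sigma> n \<in> \<Gamma>" for n
    using subsetD[OF L(2) p(1)] subsetD[OF U(2) p(2)] by (simp add: \<sigma>_def)
  have \<sigma>R: "(\<sigma> n, \<sigma> (Suc n)) \<in> R" for n
  proof (cases "even n")
    case True
    then show ?thesis using p(3) by (simp add: \<sigma>_def)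
  next
    case False
    then obtain k where "n = Suc (2 * k)" by (metis oddE Suc_eq_plus1)
    then show ?thesis using p(5)[of k] by (simp add: \<sigma>_def)
  qed
  have "increasing_seq \<Gamma> R \<sigma>" using \<sigma>\<Gamma> \<sigma>R by (simp add: increasing_seq_def)
  then obtain N where N: "\<And>k g. k \<ge> N \<Longrightarrow> continuous_map K euclideanreal g \<Longrightarrow>
      (\<forall>z\<in>topspace K. \<bar>g z\<bar> \<le> 1) \<Longrightarrow> a g = q \<Longrightarrow> \<bar>g (r (\<sigma> k) x) - g (r (\<sigma> (Suc k)) x)\<bar> \<le> \<epsilon>"
    using a x unfolding small_jumps_def by metis
  have "\<bar>f N (r (\<sigma> (2 * N)) x) - f N (r (\<sigma> (Suc (2 * N))) x)\<bar> \<le> \<epsilon>"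
    by (rule N) (use f in auto)
  moreover have "\<sigma> (2 * N) = fst (p N)" "\<sigma> (Suc (2 * N)) = snd (p N)" by (simp_all add: \<sigma>_def)
  ultimately show False using p(4)[of N] by (simp add: abs_minus_commute)
qed

text \<open>
  Finiteness: let \<open>h m g = (g - g \<circ> directed_retraction (L m)) / 2\<close> exceed \<open>\<epsilon>\<close> at \<open>x\<close> for infinitely many
  pairs \<open>(m, g)\<close> of one colour. Infinitely many \<open>g\<close> for a single \<open>m\<close> contradict the \<open>c\<^sub>0\<close> property of
  \<open>G m\<close>, at \<open>x\<close> or at the retract of \<open>x\<close>; infinitely many \<open>m\<close> contain an increasing sequence, along
  which the points \<open>r s x\<close> jump by more than \<open>\<epsilon>\<close>.
\<close>

lemma determined_c0_glue:
  fixes L U :: "'i \<Rightarrow> 'i set" and G :: "'i \<Rightarrow> ('a \<Rightarrow> real) set"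
  assumes jumps: "\<And>\<epsilon>. \<epsilon> > 0 \<Longrightarrow> \<exists>a. small_jumps \<epsilon> a"
    and W: "Well_order W" "Field W = M" and M: "M \<subseteq> \<Gamma>"
    and L: "\<And>m. m \<in> M \<Longrightarrow> L m = {} \<or> up_directed (L m) R"
    and U: "\<And>m. m \<in> M \<Longrightarrow> up_directed (U m) R"
    and LU: "\<And>m. m \<in> M \<Longrightarrow> L m \<subseteq> U m" and UM: "\<And>m. m \<in> M \<Longrightarrow> U m \<subseteq> M"
    and UL: "\<And>m n. m \<in> M \<Longrightarrow> n \<in> underS W m \<Longrightarrow> U n \<subseteq> L m"
    and cover: "\<And>m s. m \<in> M \<Longrightarrow> s \<in> L m \<Longrightarrow> \<exists>n\<in>underS W m. s \<in> U n"
    and mem: "\<And>m. m \<in> M \<Longrightarrow> m \<in> U m"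
    and G: "\<And>m. m \<in> M \<Longrightarrow> determined_c0 (U m) (G m)"
  shows "determined_c0 M (\<Union>m\<in>M. (\<lambda>g x. (g x - g (directed_retraction (L m) x)) / 2) ` G m)"
proof -
  define h where "h m g = (\<lambda>x. (g x - g (directed_retraction (L m) x)) / 2)" for m and g :: "'a \<Rightarrow> real"
  define H where "H = (\<Union>m\<in>M. h m ` G m)"
  have U\<Gamma>: "U m \<subseteq> \<Gamma>" and L\<Gamma>: "L m \<subseteq> \<Gamma>" if "m \<in> M" for m
    using UM[OF that] LU[OF that] M by auto
  have inL: "directed_retraction (L m) x \<in> topspace K" if "m \<in> M" "x \<in> topspace K" for m x
    by (rule directed_retraction_in) (use L L\<Gamma> that in auto)
  have G_cont: "continuous_map K euclideanreal g" if "m \<in> M" "g \<in> G m" for m g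
    using G[OF that(1)] that(2) unfolding determined_c0_def by blast
  have G_bd: "\<bar>g x\<bar> \<le> 1" if "m \<in> M" "g \<in> G m" "x \<in> topspace K" for m g x
    using G[OF that(1)] that(2,3) unfolding determined_c0_def by blast
  have G_det: "(\<forall>g\<in>G m. g x = g y) \<longleftrightarrow> (\<forall>s\<in>U m. r s x = r s y)"
    if "m \<in> M" "x \<in> topspace K" "y \<in> topspace K" for m x y
    using G[OF that(1)] that(2,3) unfolding determined_c0_def by blast
  have G_c0: "\<exists>c :: ('a \<Rightarrow> real) \<Rightarrow> nat. \<forall>n. \<forall>x\<in>topspace K. finite {g \<in> G m. c g = n \<and> \<bar>g x\<bar> > \<epsilon>}"
    if "m \<in> M" "\<epsilon> > 0" for m \<epsilon>
    using G[OF that(1)] that(2) unfolding determined_c0_def by blast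
  \<comment> \<open>This turns the difference defining \<open>h m g\<close> into one between the
    retracts at \<open>U m\<close> and \<open>L m\<close>, as \<open>no_large_jumps\<close>
    requires.\<close>
  have g_directed_retraction: "g (directed_retraction (U m) x) = g x" if m: "m \<in> M" "g \<in> G m" and x: "x \<in> topspace K" for m g x
  proof -
    have "directed_retraction (U m) x \<in> topspace K" by (rule directed_retraction_in) (use U U\<Gamma> m x in auto)
    then have "\<forall>g\<in>G m. g (directed_retraction (U m) x) = g x"
      using G_det[OF m(1) _ x] r_directed_retraction[OF U U\<Gamma> x] m(1) by simp
    with m show ?thesis by blast
  qed
  have "determined_c0 M H"
    unfolding determined_c0_def
  proof (intro conjI ballI allI impI)
    fix f assume "f \<in> H"
    then obtain m g where f: "m \<in> M" "g \<in> G m" "f = h m g" by (auto simp: H_def)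
    have "continuous_map K K (directed_retraction (L m))" by (rule directed_retraction_cont) (use L L\<Gamma> f in auto)
    then have "continuous_map K euclideanreal (\<lambda>x. g (directed_retraction (L m) x))"
      using continuous_map_compose[OF _ G_cont[OF f(1,2)]] by (auto simp: o_def)
    then show "continuous_map K euclideanreal f"
      unfolding f(3) h_def divide_inverse
      by (intro continuous_map_real_mult_right continuous_map_diff G_cont[OF f(1,2)])
    show "\<bar>f x\<bar> \<le> 1" if "x \<in> topspace K" for x
    proof -
      have "\<bar>g x - g (directed_retraction (L m) x)\<bar> \<le> \<bar>g x\<bar> + \<bar>g (directed_retraction (L m) x)\<bar>" by (rule abs_triangle_ineq4)
      also have "\<dots> \<le> 1 + 1"
        by (intro add_mono G_bd[OF f(1,2)] inL[OF f(1)] that)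
      finally show ?thesis by (simp add: f(3) h_def)
    qed
  next
    fix x y assume xy: "x \<in> topspace K" "y \<in> topspace K"
    show "(\<forall>f\<in>H. f x = f y) \<longleftrightarrow> (\<forall>s\<in>M. r s x = r s y)"
    proof
      assume eq: "\<forall>s\<in>M. r s x = r s y"
      show "\<forall>f\<in>H. f x = f y"
      proof
        fix f assume "f \<in> H"
        then obtain m g where f: "m \<in> M" "g \<in> G m" "f = h m g" by (auto simp: H_def)
        have "g x = g y" using G_det[OF f(1) xy] eq UM[OF f(1)] f(2) by blast
        moreover have "directed_retraction (L m) x = directed_retraction (L m) y"
          by (rule directed_retraction_eq) (use L[OF f(1)] L\<Gamma>[OF f(1)] xy eq LU[OF f(1)] UM[OF f(1)] in blast)+
        ultimately show "f x = f y" by (simp add: f(3) h_def)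
      qed
    next
      assume eq: "\<forall>f\<in>H. f x = f y"
      have wfW: "wf (W - Id)" using W by (simp add: well_order_on_def)
      \<comment> \<open>Induction along \<open>W\<close>: agreement on the earlier sets gives
        agreement on \<open>L m\<close>, so the subtracted terms coincide and
        \<open>g x = g y\<close> remains. At the bottom \<open>L m\<close> is empty and its
        retraction constant.\<close>
      have "m \<in> M \<longrightarrow> (\<forall>s\<in>U m. r s x = r s y)" for m
      proof (rule wf_induct_rule[OF wfW, of "\<lambda>m. m \<in> M \<longrightarrow> (\<forall>s\<in>U m. r s x = r s y)"])
        fix m assume IH: "\<And>n. (n, m) \<in> W - Id \<Longrightarrow> n \<in> M \<longrightarrow> (\<forall>s\<in>U n. r s x = r s y)"
        show "m \<in> M \<longrightarrow> (\<forall>s\<in>U m. r s x = r s y)"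
        proof
          assume m: "m \<in> M"
          have "r s x = r s y" if s: "s \<in> L m" for s
          proof -
            obtain n where n: "n \<in> underS W m" "s \<in> U n" using cover[OF m s] by blast
            then have "(n, m) \<in> W - Id" "n \<in> M" using W(2) by (auto simp: underS_def Field_def)
            then show ?thesis using IH n(2) by blast
          qed
          then have rL: "directed_retraction (L m) x = directed_retraction (L m) y"
            by (intro directed_retraction_eq L[OF m] L\<Gamma>[OF m] xy)
          have "g x = g y" if "g \<in> G m" for g
          proof -
            have "h m g \<in> H" using m that by (auto simp: H_def)
            then have "h m g x = h m g y" using eq by blast
            then show ?thesis by (simp add: h_def rL)
          qed
          then show "\<forall>s\<in>U m. r s x = r s y" using G_det[OF m xy] by blast
        qed
      qed
      then show "\<forall>s\<in>M. r s x = r s y" using mem by blast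
    qed
  next
    fix \<epsilon> :: real assume "\<epsilon> > 0"
    obtain a where a: "small_jumps \<epsilon> a" using jumps[OF \<open>\<epsilon> > 0\<close>] by blast
    have "\<exists>c :: 'i \<Rightarrow> ('a \<Rightarrow> real) \<Rightarrow> nat. \<forall>m\<in>M. \<forall>n. \<forall>x\<in>topspace K. finite {g \<in> G m. c m g = n \<and> \<bar>g x\<bar> > \<epsilon>}"
      by (intro bchoice ballI G_c0 \<open>\<epsilon> > 0\<close>)
    then obtain c :: "'i \<Rightarrow> ('a \<Rightarrow> real) \<Rightarrow> nat" where
      "\<forall>m\<in>M. \<forall>n. \<forall>x\<in>topspace K. finite {g \<in> G m. c m g = n \<and> \<bar>g x\<bar> > \<epsilon>}" ..
    then have c: "finite {g \<in> G m. c m g = n \<and> \<bar>g x\<bar> > \<epsilon>}" if "m \<in> M" "x \<in> topspace K" for m n x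
      using that by simp
    \<comment> \<open>A function may arise from several pairs \<open>(m, g)\<close>. One is chosen,
      and \<open>f\<close> is recovered from it, so it suffices to count pairs.\<close>
    have "\<exists>\<pi>. \<forall>f\<in>H. fst (\<pi> f) \<in> M \<and> snd (\<pi> f) \<in> G (fst (\<pi> f)) \<and> f = h (fst (\<pi> f)) (snd (\<pi> f))"
      by (intro bchoice) (auto simp: H_def)
    then obtain \<pi> where \<pi>: "\<And>f. f \<in> H \<Longrightarrow> fst (\<pi> f) \<in> M" "\<And>f. f \<in> H \<Longrightarrow> snd (\<pi> f) \<in> G (fst (\<pi> f))"
      "\<And>f. f \<in> H \<Longrightarrow> f = h (fst (\<pi> f)) (snd (\<pi> f))" by blast
    \<comment> \<open>The colour records how \<open>g\<close> is coloured in its own family and its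
      number under \<open>a\<close>. The index \<open>m\<close>, with possibly uncountably many
      values, is not recorded; the bound on jumps takes care of it.\<close>
    define col where "col f = prod_encode (c (fst (\<pi> f)) (snd (\<pi> f)), a (snd (\<pi> f)))" for f
    have "finite {f \<in> H. col f = n \<and> \<bar>f x\<bar> > \<epsilon>}" if x: "x \<in> topspace K" for n x
    proof -
      obtain p q where pq: "n = prod_encode (p, q)" by (metis prod_decode_inverse surj_pair)
      define T where "T = (SIGMA m:M. {g \<in> G m. c m g = p \<and> a g = q \<and> \<bar>g x - g (directed_retraction (L m) x)\<bar> > 2 * \<epsilon>})"
      have "finite T"
      proof (rule finite_subset)
        show "T \<subseteq> (SIGMA m:fst ` T. {g. (m, g) \<in> T})" by force
        have fin_fibre: "finite {g. (m, g) \<in> T}" for m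
        proof (cases "m \<in> M")
          case m: True
          show ?thesis
          proof (rule finite_subset)
            \<comment> \<open>If two numbers differ by more than \<open>2 * \<epsilon>\<close>, the
              absolute value of one of them exceeds \<open>\<epsilon>\<close>.\<close>
            show "{g. (m, g) \<in> T} \<subseteq> {g \<in> G m. c m g = p \<and> \<bar>g x\<bar> > \<epsilon>} \<union>
                {g \<in> G m. c m g = p \<and> \<bar>g (directed_retraction (L m) x)\<bar> > \<epsilon>}"
              unfolding T_def by auto
            show "finite ({g \<in> G m. c m g = p \<and> \<bar>g x\<bar> > \<epsilon>} \<union>
                {g \<in> G m. c m g = p \<and> \<bar>g (directed_retraction (L m) x)\<bar> > \<epsilon>})"
              using c[OF m x] c[OF m inL[OF m x]] by simp
          qed
        qed (simp add: T_def)
        have "finite (fst ` T)"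
        proof (rule ccontr)
          assume "infinite (fst ` T)"
          moreover have "fst ` T \<subseteq> Field W" using W by (auto simp: T_def)
          ultimately obtain m where m: "\<And>k::nat. m k \<in> fst ` T" "\<And>k. m k \<in> underS W (m (Suc k))"
            using infinite_increasing_seq[OF W(1)] by metis
          \<comment> \<open>The shift by one makes the lower sets nonempty:
            \<open>L (m (Suc k))\<close> contains \<open>U (m k)\<close>.\<close>
          have "\<exists>f. \<forall>k. (m (Suc k), f k) \<in> T" using m(1) by (intro choice) force
          then obtain f where f: "\<And>k. (m (Suc k), f k) \<in> T" by blast
          have mM: "m k \<in> M" for k using m(1)[of k] by (auto simp: T_def)
          have fG: "f k \<in> G (m (Suc k))" "a (f k) = q"
            "\<bar>f k x - f k (directed_retraction (L (m (Suc k))) x)\<bar> > 2 * \<epsilon>" for k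
            using f[of k] by (auto simp: T_def)
          show False
          proof (rule no_large_jumps[OF a x, of "\<lambda>k. L (m (Suc k))" "\<lambda>k. U (m (Suc k))" f q])
            fix k
            show "up_directed (L (m (Suc k))) R"
            proof -
              have "U (m k) \<subseteq> L (m (Suc k))" "U (m k) \<noteq> {}"
                using UL[OF mM m(2)] mem[OF mM] by auto
              then show ?thesis using L[OF mM[of "Suc k"]] by auto
            qed
            show "L (m (Suc k)) \<subseteq> \<Gamma>" "U (m (Suc k)) \<subseteq> \<Gamma>" "L (m (Suc k)) \<subseteq> U (m (Suc k))"
              using L\<Gamma> U\<Gamma> LU mM by auto
            show "up_directed (U (m (Suc k))) R" using U mM by blast
            show "U (m (Suc k)) \<subseteq> L (m (Suc (Suc k)))" using UL[OF mM m(2)] .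
            show "continuous_map K euclideanreal (f k)" using G_cont[OF mM fG(1)] .
            show "\<bar>f k z\<bar> \<le> 1" if "z \<in> topspace K" for z using G_bd[OF mM fG(1) that] .
            show "a (f k) = q" by (rule fG)
            show "\<bar>f k (directed_retraction (U (m (Suc k))) x) - f k (directed_retraction (L (m (Suc k))) x)\<bar> > 2 * \<epsilon>"
              using fG(3)[of k] g_directed_retraction[OF mM fG(1) x] by simp
          qed fact
        qed
        then show "finite (SIGMA m:fst ` T. {g. (m, g) \<in> T})"
          using fin_fibre by (intro finite_SigmaI)
      qed
      moreover have "\<pi> ` {f \<in> H. col f = n \<and> \<bar>f x\<bar> > \<epsilon>} \<subseteq> T"
      proof
        fix z assume "z \<in> \<pi> ` {f \<in> H. col f = n \<and> \<bar>f x\<bar> > \<epsilon>}"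
        then obtain f where f: "f \<in> H" "col f = n" "\<bar>f x\<bar> > \<epsilon>" "z = \<pi> f" by blast
        obtain m g where mg: "\<pi> f = (m, g)" by (cases "\<pi> f")
        have 1: "m \<in> M" "g \<in> G m" "f = h m g" using \<pi>[OF f(1)] mg by auto
        have 2: "c m g = p" "a g = q" using f(2) mg pq by (simp_all add: col_def prod_encode_eq)
        have "\<bar>g x - g (directed_retraction (L m) x)\<bar> > 2 * \<epsilon>" using f(3) unfolding 1(3) h_def by simp
        then show "z \<in> T" using 1(1,2) 2 f(4) mg by (simp add: T_def)
      qed
      ultimately have "finite (\<pi> ` {f \<in> H. col f = n \<and> \<bar>f x\<bar> > \<epsilon>})" by (rule finite_subset[rotated])
      moreover have "inj_on \<pi> {f \<in> H. col f = n \<and> \<bar>f x\<bar> > \<epsilon>}"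
        using \<pi>(3) by (intro inj_onI) (metis (no_types, lifting) mem_Collect_eq)
      ultimately show ?thesis by (rule finite_imageD)
    qed
    then show "\<exists>col :: ('a \<Rightarrow> real) \<Rightarrow> nat. \<forall>n. \<forall>x\<in>topspace K. finite {f \<in> H. col f = n \<and> \<bar>f x\<bar> > \<epsilon>}"
      by blast
  qed
  then show ?thesis by (simp add: H_def h_def)
qed

text \<open>As a cardinal, \<open>|M|\<close> well-orders \<open>M\<close> with all proper initial
  segments smaller than \<open>M\<close>. Closing a segment under a choice \<open>u\<close> of upper
  bounds makes it directed without reaching the cardinality of \<open>M\<close>, so the induction
  hypothesis applies to every \<open>U m\<close>.\<close>

lemma ex_determined_c0:
  assumes jumps: "\<And>\<epsilon>. \<epsilon> > 0 \<Longrightarrow> \<exists>a. small_jumps \<epsilon> a"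
    and "up_directed M R" "M \<subseteq> \<Gamma>"
  shows "\<exists>G. determined_c0 M G"
  using assms(2,3)
proof (induction M rule: wf_induct_rule[OF wf_inv_image[OF wf_ordLess, of card_of]])
  case (1 M)
  have IH: "\<exists>G. determined_c0 N G" if "up_directed N R" "N \<subseteq> \<Gamma>" "|N| <o |M|" for N
    using 1(1)[of N] that by simp
  show ?case
  proof (cases "countable M")
    case True
    then show ?thesis using determined_c0_countable 1(2,3) by blast
  next
    case unc: False
    have "\<exists>u. \<forall>a\<in>M. \<forall>b\<in>M. u a b \<in> M \<and> (a, u a b) \<in> R \<and> (b, u a b) \<in> R"
      using 1(2) unfolding up_directed_def by metis
    then obtain u where u: "\<And>a b. a \<in> M \<Longrightarrow> b \<in> M \<Longrightarrow> u a b \<in> M"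
      "\<And>a b. a \<in> M \<Longrightarrow> b \<in> M \<Longrightarrow> (a, u a b) \<in> R" "\<And>a b. a \<in> M \<Longrightarrow> b \<in> M \<Longrightarrow> (b, u a b) \<in> R"
      by blast
    define W where "W = |M|"
    have W: "Well_order W" "Field W = M" unfolding W_def by (rule card_of_Well_order Field_card_of)+
    define L where "L m = closure_under u (underS W m)" for m
    define U where "U m = closure_under u (insert m (underS W m))" for m
    have S: "underS W m \<subseteq> M" for m using W(2) by (auto simp: underS_def Field_def)
    have sub: "closure_under u X \<subseteq> M" if "X \<subseteq> M" for X
      by (rule closure_under_subset[OF that]) (rule u(1))
    have dir: "up_directed (closure_under u X) R" if X: "X \<subseteq> M" "X \<noteq> {}" for X
      unfolding up_directed_def
    proof (intro conjI ballI)
      show "closure_under u X \<noteq> {}" using X(2) subset_closure_under[of X u] by blast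
      fix a b assume ab: "a \<in> closure_under u X" "b \<in> closure_under u X"
      then have "a \<in> M" "b \<in> M" using sub[OF X(1)] by blast+
      then show "\<exists>c\<in>closure_under u X. (a, c) \<in> R \<and> (b, c) \<in> R"
        using closure_under_closed[OF ab] u(2,3) by blast
    qed
    have empty: "closure_under u {} = {}"
    proof -
      have "(step_closure u ^^ n) {} = {}" for n by (induction n) (simp_all add: step_closure_def)
      then show ?thesis by (simp add: closure_under_def)
    qed
    have tot: "insert a (underS W a) \<subseteq> insert b (underS W b) \<or> insert b (underS W b) \<subseteq> insert a (underS W a)"
      if "a \<in> M" "b \<in> M" for a b
    proof -
      have tr: "trans W" "antisym W" "total_on M W"
        using W unfolding well_order_on_def linear_order_on_def partial_order_on_def preorder_on_def by auto
      have "insert a (underS W a) \<subseteq> insert b (underS W b)" if "(a, b) \<in> W" for a b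
        using that tr unfolding underS_def by (auto dest: transD antisymD)
      then show ?thesis using tr(3) that unfolding total_on_def by (cases "a = b") blast+
    qed
    have small: "|U m| <o |M|" if m: "m \<in> M" for m
    proof -
      have S_small: "|underS W m| <o |M|"
        unfolding W_def by (rule card_of_underS[OF card_of_Card_order]) (simp add: Field_card_of m)
      show ?thesis
      \<comment> \<open>The closure of a finite set may be countably infinite, which is still
        smaller than the uncountable \<open>M\<close>.\<close>
      proof (cases "finite (underS W m)")
        case True
        have "countable (U m)"
        proof -
          have "|insert m (underS W m)| \<le>o |UNIV :: nat set|"
            using True by (meson card_of_ordLeq countable_def countable_finite finite_insert subset_UNIV)
          then have "|U m| \<le>o |UNIV :: nat set|"
            unfolding U_def by (intro card_of_closure_under) auto
          then show ?thesis unfolding card_of_ordLeq[symmetric] countable_def by blast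
        qed
        have "\<not> |M| \<le>o |U m|"
        proof
          assume "|M| \<le>o |U m|"
          then obtain f where "inj_on f M" "f ` M \<subseteq> U m" unfolding card_of_ordLeq[symmetric] by blast
          then have "countable M"
            using \<open>countable (U m)\<close> countable_subset countable_image_inj_on by metis
          with unc show False by blast
        qed
        then show ?thesis using not_ordLeq_iff_ordLess card_of_Well_order by blast
      next
        case False
        have "|insert m (underS W m)| \<le>o |underS W m|"
        proof -
          have "|{m}| \<le>o |underS W m|" using False by (intro card_of_singl_ordLeq) auto
          then have "|{m} \<union> underS W m| \<le>o |underS W m|"
            using False by (intro card_of_Un_ordLeq_infinite_Field)
              (simp_all add: Field_card_of card_of_card_order_on card_of_mono1)
          then show ?thesis by simp
        qed
        then have "|U m| \<le>o |underS W m|"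
          unfolding U_def by (intro card_of_closure_under False)
        then show ?thesis using S_small ordLeq_ordLess_trans by blast
      qed
    qed
    have UM: "U m \<subseteq> M" if "m \<in> M" for m
      unfolding U_def by (rule sub) (use that S in auto)
    have dirU: "up_directed (U m) R" if "m \<in> M" for m
      unfolding U_def by (rule dir) (use that S in auto)
    have "\<exists>G. \<forall>m\<in>M. determined_c0 (U m) (G m)"
      by (intro bchoice ballI IH dirU small) (use UM 1(3) in auto)
    then obtain G where G: "\<And>m. m \<in> M \<Longrightarrow> determined_c0 (U m) (G m)" by blast
    have UL: "U n \<subseteq> L m" if "m \<in> M" "n \<in> underS W m" for m n
      unfolding U_def L_def
    proof (rule closure_under_mono)
      have "trans W" "antisym W"
        using W unfolding well_order_on_def linear_order_on_def partial_order_on_def preorder_on_def by auto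
      then show "insert n (underS W n) \<subseteq> underS W m"
        using that(2) unfolding underS_def by (auto dest: transD antisymD)
    qed
    \<comment> \<open>Together with \<open>UL\<close>, \<open>L m\<close> is the union of the
      earlier \<open>U n\<close>. That union is closed under \<open>u\<close> because the sets form
      a chain: the larger of two contains both arguments.\<close>
    have cover: "\<exists>n\<in>underS W m. s \<in> U n" if "s \<in> L m" for m s
      using that unfolding L_def
    proof (induction rule: closure_under_induct)
      case (base a)
      then show ?case unfolding U_def using subset_closure_under[of "insert a (underS W a)" u] by blast
    next
      case (step a b)
      then obtain n k where nk: "n \<in> underS W m" "a \<in> U n" "k \<in> underS W m" "b \<in> U k" by blast
      then have "U n \<subseteq> U k \<or> U k \<subseteq> U n"
        unfolding U_def using tot[of n k] S closure_under_mono by blast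
      then show ?case
        using nk closure_under_closed[of a u _ b] unfolding U_def by blast
    qed
    have "determined_c0 M (\<Union>m\<in>M. (\<lambda>g x. (g x - g (directed_retraction (L m) x)) / 2) ` G m)"
    proof (rule determined_c0_glue[OF jumps W 1(3), of L U G])
      fix m assume m: "m \<in> M"
      show "L m = {} \<or> up_directed (L m) R"
        unfolding L_def using empty dir[OF S] by (cases "underS W m = {}") auto
      show "up_directed (U m) R" "U m \<subseteq> M" "determined_c0 (U m) (G m)"
        using dirU UM G m by auto
      show "L m \<subseteq> U m" unfolding L_def U_def by (rule closure_under_mono) auto
      show "m \<in> U m"
        unfolding U_def using subset_closure_under[of "insert m (underS W m)" u] by blast
    qed ((rule UL cover)?; assumption)+
    then show ?thesis by blast
  qed
qed

end

section \<open>Embedding into $c_0$\<close>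

definition soft_threshold :: "real \<Rightarrow> real \<Rightarrow> real" where
  "soft_threshold e t = t - max (- e) (min e t)"

lemma soft_threshold:
  assumes "e > 0"
  shows "\<bar>soft_threshold e t\<bar> \<le> \<bar>t\<bar>" "soft_threshold e t \<noteq> 0 \<Longrightarrow> \<bar>t\<bar> > e" "\<bar>soft_threshold e t - t\<bar> \<le> e"
  using assms by (auto simp: soft_threshold_def max_def min_def split: if_splits)

text \<open>Coordinates are indexed by a function and a level \<open>j\<close>. Thresholding at 1 /
  (j + 1) annihilates, within each colour, all but finitely many functions at \<open>x\<close>; the
  denominators leave only finitely many levels and colours above a given \<open>\<delta>\<close>.
  All levels together still separate points, since thresholding moves a value by at most 1 / (j +
  1).\<close>

lemma eberlein_compact_if_countably_c0:
  fixes G :: "'g set" and g :: "'g \<Rightarrow> 'a \<Rightarrow> real"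
  assumes K: "compact_space K"
    and cont: "\<And>i. i \<in> G \<Longrightarrow> continuous_map K euclideanreal (g i)"
    and bd: "\<And>i x. i \<in> G \<Longrightarrow> x \<in> topspace K \<Longrightarrow> \<bar>g i x\<bar> \<le> 1"
    and sep: "\<And>x y. x \<in> topspace K \<Longrightarrow> y \<in> topspace K \<Longrightarrow> (\<And>i. i \<in> G \<Longrightarrow> g i x = g i y) \<Longrightarrow> x = y"
    and c0: "\<And>\<epsilon>. \<epsilon> > 0 \<Longrightarrow> \<exists>c :: 'g \<Rightarrow> nat. \<forall>n. \<forall>x\<in>topspace K. finite {i \<in> G. c i = n \<and> \<bar>g i x\<bar> > \<epsilon>}"
  shows "eberlein_compact K"
proof -
  have "\<forall>j. \<exists>c :: 'g \<Rightarrow> nat. \<forall>n. \<forall>x\<in>topspace K. finite {i \<in> G. c i = n \<and> \<bar>g i x\<bar> > 1 / real (Suc j)}"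
    by (intro allI c0) simp
  then obtain c :: "nat \<Rightarrow> 'g \<Rightarrow> nat" where
    "\<forall>j. \<forall>n. \<forall>x\<in>topspace K. finite {i \<in> G. c j i = n \<and> \<bar>g i x\<bar> > 1 / real (Suc j)}"
    by (rule choice[THEN exE])
  then have c: "finite {i \<in> G. c j i = n \<and> \<bar>g i x\<bar> > 1 / real (Suc j)}" if "x \<in> topspace K" for j n x
    using that by blast
  define I where "I = G \<times> (UNIV :: nat set)"
  define F where "F x = (\<lambda>p\<in>I. soft_threshold (1 / real (Suc (snd p))) (g (fst p) x)
      / (real (Suc (snd p)) * real (Suc (c (snd p) (fst p)))))" for x
  have fin: "finite {p \<in> I. \<bar>F x p\<bar> > \<delta>}" if x: "x \<in> topspace K" and "\<delta> > 0" for x \<delta>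
  proof -
    \<comment> \<open>Thresholded values are at most 1 in absolute value, so a coordinate above
      \<open>\<delta>\<close> has a denominator below 1 / \<open>\<delta>\<close>.\<close>
    obtain N where N: "1 / \<delta> \<le> real N" using real_arch_simple by blast
    have "{p \<in> I. \<bar>F x p\<bar> > \<delta>} \<subseteq>
       (\<Union>j\<in>{..N}. \<Union>n\<in>{..N}. {i \<in> G. c j i = n \<and> \<bar>g i x\<bar> > 1 / real (Suc j)} \<times> {j})"
    proof
      fix p assume p: "p \<in> {p \<in> I. \<bar>F x p\<bar> > \<delta>}"
      obtain i j where ij: "p = (i, j)" "i \<in> G" using p by (auto simp: I_def)
      define A B where "A = real (Suc j)" and "B = real (Suc (c j i))"
      have AB: "A \<ge> 1" "B \<ge> 1" by (auto simp: A_def B_def)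
      define t where "t = soft_threshold (1 / real (Suc j)) (g i x)"
      have gt: "\<delta> < \<bar>t\<bar> / (A * B)"
        using p AB by (simp add: ij F_def I_def t_def A_def B_def abs_mult)
      then have "t \<noteq> 0" using \<open>\<delta> > 0\<close> by auto
      then have big: "\<bar>g i x\<bar> > 1 / real (Suc j)"
        unfolding t_def by (intro soft_threshold(2)) auto
      have "\<bar>t\<bar> \<le> 1"
        using soft_threshold(1)[of "1 / real (Suc j)" "g i x"] bd[OF ij(2) x] by (simp add: t_def)
      then have "\<bar>t\<bar> / (A * B) \<le> 1 / (A * B)" using AB by (intro divide_right_mono) auto
      with gt have "\<delta> < 1 / (A * B)" by linarith
      moreover have "A * B > 0" using AB by simp
      ultimately have "A * B < 1 / \<delta>" using \<open>\<delta> > 0\<close> by (simp add: field_simps)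
      then have AN: "A * B < real N" using N by linarith
      have "A \<le> A * B" "B \<le> A * B" using AB by auto
      then have "A \<le> real N" "B \<le> real N" using AN by linarith+
      then have "j \<le> N" "c j i \<le> N" by (auto simp: A_def B_def)
      then show "p \<in> (\<Union>j\<in>{..N}. \<Union>n\<in>{..N}. {i \<in> G. c j i = n \<and> \<bar>g i x\<bar> > 1 / real (Suc j)} \<times> {j})"
        using big ij by auto
    qed
    moreover have "finite (\<Union>j\<in>{..N}. \<Union>n\<in>{..N}. {i \<in> G. c j i = n \<and> \<bar>g i x\<bar> > 1 / real (Suc j)} \<times> {j})"
      by (intro finite_UN_I finite_cartesian_product c[OF x]) auto
    ultimately show ?thesis by (rule finite_subset)
  qed
  have contF: "continuous_map K euclideanreal (\<lambda>x. F x p)" if p: "p \<in> I" for p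
  proof -
    have "continuous_map K euclideanreal (g (fst p))" using p cont by (auto simp: I_def)
    then show ?thesis
      unfolding F_def soft_threshold_def divide_inverse restrict_apply'[OF p]
      by (intro continuous_map_real_mult_right continuous_map_diff continuous_map_real_max
          continuous_map_real_min) auto
  qed
  have "continuous_map K (powertop_real I) F"
    unfolding continuous_map_componentwise using contF by (auto simp: F_def)
  then have cF: "continuous_map K (c0_space I) F"
    using fin by (auto simp: c0_space_def continuous_map_in_subtopology)
  have "inj_on F (topspace K)"
  proof (rule inj_onI)
    fix x y assume xy: "x \<in> topspace K" "y \<in> topspace K" "F x = F y"
    show "x = y"
    proof (rule sep[OF xy(1,2)], rule ccontr)
      fix i assume i: "i \<in> G" "g i x \<noteq> g i y"
      \<comment> \<open>Half of the gap, because thresholding may move both values.\<close>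
      then obtain j where j: "1 / real (Suc j) < \<bar>g i x - g i y\<bar> / 2"
        using nat_approx_posE[of "\<bar>g i x - g i y\<bar> / 2"] by auto
      define e where "e = 1 / real (Suc j)"
      have "e > 0" by (simp add: e_def)
      have "F x (i, j) = F y (i, j)" using xy by simp
      then have eq: "soft_threshold e (g i x) = soft_threshold e (g i y)"
        using i by (simp add: F_def I_def e_def)
      have "\<bar>g i x - g i y\<bar> \<le> e + e"
        using soft_threshold(3)[OF \<open>e > 0\<close>, of "g i x"] soft_threshold(3)[OF \<open>e > 0\<close>, of "g i y"]
        unfolding eq by linarith
      with j show False by (simp add: e_def)
    qed
  qed
  then have "embedding_map K (c0_space I) F"
    by (intro continuous_imp_embedding_map K Hausdorff_c0_space cF)
  then show ?thesis by (rule eberlein_compactI[OF K])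
qed

text \<open>The induction is applied to the whole index set. By fullness any two points are fixed by
  a common index, so functions that determine all \<open>r s\<close> separate points.\<close>

lemma (in full_skeleton_space) small_jumps_imp_eberlein:
  assumes jumps: "\<And>\<epsilon>. \<epsilon> > 0 \<Longrightarrow> \<exists>a. small_jumps \<epsilon> a"
  shows "eberlein_compact K"
proof -
  obtain G where "determined_c0 \<Gamma> G" using ex_determined_c0[OF jumps up] by blast
  note D = this[unfolded determined_c0_def]
  have G: "\<And>g. g \<in> G \<Longrightarrow> continuous_map K euclideanreal g"
    "\<And>g x. g \<in> G \<Longrightarrow> x \<in> topspace K \<Longrightarrow> \<bar>g x\<bar> \<le> 1"
    "\<And>x y. x \<in> topspace K \<Longrightarrow> y \<in> topspace K \<Longrightarrow> (\<forall>g\<in>G. g x = g y) \<longleftrightarrow> (\<forall>s\<in>\<Gamma>. r s x = r s y)"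
    "\<And>\<epsilon>. \<epsilon> > 0 \<Longrightarrow> \<exists>c :: ('a \<Rightarrow> real) \<Rightarrow> nat. \<forall>n. \<forall>x\<in>topspace K. finite {g \<in> G. c g = n \<and> \<bar>g x\<bar> > \<epsilon>}"
    using D[THEN conjunct1] D[THEN conjunct2, THEN conjunct1] D[THEN conjunct2, THEN conjunct2]
    by (simp_all only: Ball_def)
  show ?thesis
  proof (rule eberlein_compact_if_countably_c0[OF compact G(1,2)])
    fix x y assume xy: "x \<in> topspace K" "y \<in> topspace K" and eq: "\<And>g. g \<in> G \<Longrightarrow> g x = g y"
    obtain s t where st: "s \<in> \<Gamma>" "r s x = x" "t \<in> \<Gamma>" "r t y = y" using fixed xy by meson
    obtain u where u: "u \<in> \<Gamma>" "(s, u) \<in> R" "(t, u) \<in> R" using ub[OF st(1,3)] by blast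
    have fix_u: "r u x = x" "r u y = y"
      using r_le(1)[OF st(1) u(1,2) xy(1)] r_le(1)[OF st(3) u(1,3) xy(2)] unfolding st(2,4) .
    have "\<forall>g\<in>G. g x = g y" by (intro ballI eq)
    then have "\<forall>s\<in>\<Gamma>. r s x = r s y" unfolding G(3)[OF xy] .
    then have "r u x = r u y" using u(1) by (rule bspec)
    then show "x = y" unfolding fix_u .
  next
    show "\<exists>c :: ('a \<Rightarrow> real) \<Rightarrow> nat. \<forall>n. \<forall>x\<in>topspace K. finite {g \<in> G. c g = n \<and> \<bar>g x\<bar> > \<epsilon>}"
      if "\<epsilon> > 0" for \<epsilon> by (rule G(4)[OF that])
  qed
qed

text \<open>Consecutive terms are compared through the value at the supremum, which costs a factor
  of two; hence the covering at level \<open>\<epsilon> / 2\<close>.\<close>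

lemma (in full_skeleton_space) countably_shrinking_imp_small_jumps:
  assumes \<A>: "countable \<A>" "\<And>A. A \<in> \<A> \<Longrightarrow> A \<subseteq> cfun_ball K"
    and sh: "\<And>A. A \<in> \<A> \<Longrightarrow> eps_shrinking K A (eps A) \<Gamma> R r"
    and cov: "cfun_ball K = \<Union>{A \<in> \<A>. eps A < \<epsilon> / 2}"
  shows "\<exists>a. small_jumps \<epsilon> a"
proof -
  \<comment> \<open>Members of \<open>cfun_ball K\<close> are undefined off the space, whereas
    \<open>f\<close> may be any function; hence the restriction.\<close>
  define \<beta> where "\<beta> f = (SOME A. A \<in> \<A> \<and> eps A < \<epsilon> / 2 \<and> restrict f (topspace K) \<in> A)" for f
  define a where "a f = to_nat_on \<A> (\<beta> f)" for f
  have \<beta>: "\<beta> f \<in> \<A> \<and> eps (\<beta> f) < \<epsilon> / 2 \<and> restrict f (topspace K) \<in> \<beta> f"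
    if f: "continuous_map K euclideanreal f" "\<forall>z\<in>topspace K. \<bar>f z\<bar> \<le> 1" for f
  proof -
    have "continuous_map K euclideanreal (restrict f (topspace K))"
      using f(1) by (rule continuous_map_eq) simp
    then have "restrict f (topspace K) \<in> cfun_ball K"
      using f by (simp add: cfun_ball_iff[OF compact])
    then have "\<exists>A. A \<in> \<A> \<and> eps A < \<epsilon> / 2 \<and> restrict f (topspace K) \<in> A" using cov by blast
    then show ?thesis unfolding \<beta>_def by (rule someI_ex)
  qed
  have "small_jumps \<epsilon> a"
    unfolding small_jumps_def
  proof (intro allI ballI impI)
    fix n x \<sigma> assume x: "x \<in> topspace K" and inc: "increasing_seq \<Gamma> R \<sigma>"
    show "\<exists>N. \<forall>k\<ge>N. \<forall>f. continuous_map K euclideanreal f \<and> (\<forall>z\<in>topspace K. \<bar>f z\<bar> \<le> 1) \<and> a f = n \<longrightarrow>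
        \<bar>f (r (\<sigma> k) x) - f (r (\<sigma> (Suc k)) x)\<bar> \<le> \<epsilon>"
    proof (cases "\<exists>A\<in>\<A>. to_nat_on \<A> A = n \<and> eps A < \<epsilon> / 2")
      case True
      then obtain A where A: "A \<in> \<A>" "to_nat_on \<A> A = n" "eps A < \<epsilon> / 2" by blast
      obtain s where s: "is_sup_seq \<Gamma> R \<sigma> s" using ex_sup[OF inc] by blast
      have bd: "\<forall>f\<in>A. \<forall>x\<in>topspace K. \<bar>f x\<bar> \<le> 1"
        using \<A>(2)[OF A(1)] by (auto simp: cfun_ball_iff[OF compact])
      obtain N where N: "\<And>k f. k \<ge> N \<Longrightarrow> f \<in> A \<Longrightarrow> \<bar>f (r (\<sigma> k) x) - f (r s x)\<bar> \<le> \<epsilon> / 2"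
        using eps_shrinkingD[OF sh[OF A(1)] bd r_in[OF _ x] x inc s A(3)] by blast
      have "\<bar>f (r (\<sigma> k) x) - f (r (\<sigma> (Suc k)) x)\<bar> \<le> \<epsilon>"
        if "k \<ge> N" and f: "continuous_map K euclideanreal f" "\<forall>z\<in>topspace K. \<bar>f z\<bar> \<le> 1" "a f = n" for k f
      proof -
        have "\<beta> f = A"
          using f(3) A(1,2) \<beta>[OF f(1,2)] \<A>(1) unfolding a_def by (metis to_nat_on_inj)
        then have "restrict f (topspace K) \<in> A" using \<beta>[OF f(1,2)] by simp
        from N[OF _ this, of k] N[OF _ this, of "Suc k"] \<open>k \<ge> N\<close>
        have "\<bar>f (r (\<sigma> k) x) - f (r s x)\<bar> \<le> \<epsilon> / 2" "\<bar>f (r (\<sigma> (Suc k)) x) - f (r s x)\<bar> \<le> \<epsilon> / 2"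
          using inc s r_in[OF _ x] by (simp_all add: increasing_seq_def is_sup_seq_def)
        then show ?thesis by linarith
      qed
      then show ?thesis by blast
    next
      case False
      have "a f \<noteq> n" if "continuous_map K euclideanreal f" "\<forall>z\<in>topspace K. \<bar>f z\<bar> \<le> 1" for f
        using \<beta>[OF that] False unfolding a_def by metis
      then show ?thesis by (intro exI[of _ 0] allI impI) (elim conjE, metis)
    qed
  qed
  then show ?thesis by blast
qed

section \<open>The implications from (3) to (1) and from (2) to (3)\<close>

lemma countably_shrinking_imp_eberlein:
  assumes K: "compact_space K" "Hausdorff_space K" "topspace K \<noteq> {}"
    and "has_countably_shrinking_full_skeleton TYPE('i) K"
  shows "eberlein_compact K"
proof -
  obtain \<A> and \<Gamma> :: "'i set" and R r eps where *: "countable \<A>" "\<forall>A\<in>\<A>. A \<noteq> {} \<and> A \<subseteq> cfun_ball K"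
    "retractional_skeleton K \<Gamma> R r" "full_skeleton K \<Gamma> r"
    "\<forall>A\<in>\<A>. eps A > 0 \<and> eps_shrinking K A (eps A) \<Gamma> R r"
    "\<forall>\<epsilon>>0. cfun_ball K = \<Union>{A \<in> \<A>. eps A < \<epsilon>}"
    using assms(4) unfolding has_countably_shrinking_full_skeleton_def
    by (elim exE conjE) (rule that, assumption+)
  interpret full_skeleton_space K \<Gamma> R r
    by unfold_locales (rule K *)+
  show ?thesis
  proof (rule small_jumps_imp_eberlein)
    fix \<epsilon> :: real assume "\<epsilon> > 0"
    show "\<exists>a. small_jumps \<epsilon> a"
    proof (rule countably_shrinking_imp_small_jumps[OF *(1)])
      show "cfun_ball K = \<Union>{A \<in> \<A>. eps A < \<epsilon> / 2}" using *(6) \<open>\<epsilon> > 0\<close> half_gt_zero by blast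
    qed (use *(2,5) in auto)
  qed
qed

lemma shrinking_imp_countably_shrinking_skeleton:
  assumes K: "compact_space K" "Hausdorff_space K" "topspace K \<noteq> {}"
    and "has_shrinking_skeleton TYPE('i) K"
  shows "has_countably_shrinking_full_skeleton TYPE('i) K"
proof -
  obtain A and \<Gamma> :: "'i set" and R r where *: "A \<noteq> {}" "A \<subseteq> mspace (cfun K)" "bounded_cfun K A"
    "separates_points K A" "retractional_skeleton K \<Gamma> R r" "shrinking K A \<Gamma> R r"
    using assms(4) unfolding has_shrinking_skeleton_def
    by (elim exE conjE) (rule that, assumption+)
  interpret skeleton K \<Gamma> R r
    by unfold_locales (rule K *)+
  show ?thesis by (rule shrinking_imp_countably_shrinking[OF K(3) *(1-4,6)])
qed

section \<open>The skeleton of restrictions to countable coordinate sets\<close>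

text \<open>\<open>K\<close> as a subset of \<open>c\<^sub>0(I)\<close>, given by its coordinate
  functions alone. This leaves room to replace the coordinates of an embedding by bounded
  ones.\<close>

locale c0_family =
  fixes K :: "'a topology" and I :: "'i set" and p :: "'i \<Rightarrow> 'a \<Rightarrow> real"
  assumes compact: "compact_space K" and Hausdorff: "Hausdorff_space K"
    and p_cont: "\<And>i. i \<in> I \<Longrightarrow> continuous_map K euclideanreal (p i)"
    and p_sep: "\<And>x y. x \<in> topspace K \<Longrightarrow> y \<in> topspace K \<Longrightarrow> (\<And>i. i \<in> I \<Longrightarrow> p i x = p i y) \<Longrightarrow> x = y"
    and p_fin: "\<And>x \<epsilon>. x \<in> topspace K \<Longrightarrow> \<epsilon> > 0 \<Longrightarrow> finite {i \<in> I. \<bar>p i x\<bar> > \<epsilon>}"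
begin

definition \<Gamma> :: "'i set set" where
  "\<Gamma> = {J. J \<subseteq> I \<and> countable J \<and>
     (\<forall>x\<in>topspace K. \<exists>y\<in>topspace K. \<forall>i\<in>I. p i y = (if i \<in> J then p i x else 0))}"

definition R :: "'i set rel" where
  "R = {(J, J'). J \<in> \<Gamma> \<and> J' \<in> \<Gamma> \<and> J \<subseteq> J'}"

definition r :: "'i set \<Rightarrow> 'a \<Rightarrow> 'a" where
  "r J x = (SOME y. y \<in> topspace K \<and> (\<forall>i\<in>I. p i y = (if i \<in> J then p i x else 0)))"

lemma
  assumes "J \<in> \<Gamma>" "x \<in> topspace K"
  shows r_in: "r J x \<in> topspace K"
    and p_r: "\<And>i. i \<in> I \<Longrightarrow> p i (r J x) = (if i \<in> J then p i x else 0)"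
proof -
  have "\<exists>y. y \<in> topspace K \<and> (\<forall>i\<in>I. p i y = (if i \<in> J then p i x else 0))"
    using assms unfolding \<Gamma>_def by blast
  from someI_ex[OF this] show "r J x \<in> topspace K"
    "\<And>i. i \<in> I \<Longrightarrow> p i (r J x) = (if i \<in> J then p i x else 0)"
    unfolding r_def by blast+
qed

lemma r_fix:
  assumes J: "J \<in> \<Gamma>" "x \<in> topspace K" and 0: "\<And>i. i \<in> I \<Longrightarrow> i \<notin> J \<Longrightarrow> p i x = 0"
  shows "r J x = x"
  by (rule p_sep[OF r_in[OF J] J(2)]) (simp add: p_r[OF J] 0)

lemma r_r:
  assumes "J \<in> \<Gamma>" "J' \<in> \<Gamma>" "J \<subseteq> J'" and x: "x \<in> topspace K"
  shows "r J' (r J x) = r J x" "r J (r J' x) = r J x"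
proof -
  show "r J' (r J x) = r J x"
    by (rule r_fix) (use assms in \<open>auto simp: r_in p_r\<close>)
  show "r J (r J' x) = r J x"
    by (rule p_sep) (use assms in \<open>auto simp: r_in p_r\<close>)
qed

lemma closedin_box:
  assumes "i \<in> I" shows "closedin K {y \<in> topspace K. \<bar>p i y - c\<bar> \<le> e}"
proof -
  have "continuous_map K euclideanreal (\<lambda>y. \<bar>p i y - c\<bar>)"
    by (intro continuous_map_real_abs continuous_map_diff p_cont[OF assms]) auto
  from closedin_continuous_map_preimage[OF this, of "{..e}"] show ?thesis by simp
qed

lemma closedin_zero: "closedin K {y \<in> topspace K. \<forall>i\<in>I - J. p i y = 0}"
  by (rule closedin_Collect_ball) (use closedin_box[of _ 0 0] in auto)

lemma r_cont:
  assumes J: "J \<in> \<Gamma>" shows "continuous_map K K (r J)"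
proof (rule continuous_map_from_closed_graph[OF compact])
  show "r J \<in> topspace K \<rightarrow> topspace K" using r_in[OF J] by auto
  define P where "P = prod_topology K K"
  have "{z \<in> topspace K \<times> topspace K. snd z = r J (fst z)} =
     {z \<in> topspace P. \<forall>i\<in>I. p i (snd z) = (if i \<in> J then p i (fst z) else 0)}"
  proof (intro Collect_cong conj_cong)
    fix z assume "z \<in> topspace P"
    then have z: "fst z \<in> topspace K" "snd z \<in> topspace K" by (auto simp: P_def)
    show "(snd z = r J (fst z)) = (\<forall>i\<in>I. p i (snd z) = (if i \<in> J then p i (fst z) else 0))"
    proof
      assume *: "\<forall>i\<in>I. p i (snd z) = (if i \<in> J then p i (fst z) else 0)"
      show "snd z = r J (fst z)"
        by (rule p_sep[OF z(2) r_in[OF J z(1)]]) (use * p_r[OF J z(1)] in simp)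
    qed (use p_r[OF J z(1)] in simp)
  qed (simp add: P_def)
  also have "closedin P \<dots>"
  proof (rule closedin_Collect_ball)
    fix i assume i: "i \<in> I"
    have fs: "continuous_map P euclideanreal (\<lambda>z. p i (fst z))" "continuous_map P euclideanreal (\<lambda>z. p i (snd z))"
      unfolding P_def using continuous_map_compose[OF continuous_map_fst p_cont[OF i]]
         continuous_map_compose[OF continuous_map_snd p_cont[OF i]] by (simp_all add: o_def)
    have "continuous_map P euclideanreal (\<lambda>z. if i \<in> J then p i (fst z) else 0)"
      using fs(1) by (cases "i \<in> J") simp_all
    from closedin_continuous_maps_eq[OF Hausdorff_space_euclidean fs(2) this]
    show "closedin P {z \<in> topspace P. p i (snd z) = (if i \<in> J then p i (fst z) else 0)}" .
  qed
  finally show "closedin (prod_topology K K) {z \<in> topspace K \<times> topspace K. snd z = r J (fst z)}"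
    by (simp add: P_def)
qed

lemma countable_support:
  assumes "x \<in> topspace K" shows "countable {i \<in> I. p i x \<noteq> 0}"
proof (rule countable_subset)
  show "{i \<in> I. p i x \<noteq> 0} \<subseteq> (\<Union>n. {i \<in> I. \<bar>p i x\<bar> > 1 / real (Suc n)})"
  proof
    fix i assume i: "i \<in> {i \<in> I. p i x \<noteq> 0}"
    then obtain n where "1 / real (Suc n) < \<bar>p i x\<bar>" using nat_approx_posE[of "\<bar>p i x\<bar>"] by auto
    with i show "i \<in> (\<Union>n. {i \<in> I. \<bar>p i x\<bar> > 1 / real (Suc n)})" by blast
  qed
  have "countable {i \<in> I. \<bar>p i x\<bar> > 1 / real (Suc n)}" for n
    by (rule countable_finite[OF p_fin[OF assms]]) simp
  then show "countable (\<Union>n. {i \<in> I. \<bar>p i x\<bar> > 1 / real (Suc n)})"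
    by (rule countable_UN[OF countableI_type])
qed

lemma ex_finite_net:
  assumes F: "finite F" "F \<subseteq> I" and "e > 0"
  shows "\<exists>D. finite D \<and> D \<subseteq> topspace K \<and> (\<forall>x\<in>topspace K. \<exists>d\<in>D. \<forall>i\<in>F. \<bar>p i d - p i x\<bar> < e)"
proof -
  define V where "V d = (\<Inter>i\<in>F. {x \<in> topspace K. \<bar>p i d - p i x\<bar> < e}) \<inter> topspace K" for d
  have V: "openin K (V d)" for d
    unfolding V_def
  proof (rule openin_INT[OF F(1)])
    fix i assume "i \<in> F"
    then have "continuous_map K euclideanreal (\<lambda>x. \<bar>p i d - p i x\<bar>)"
      using F(2) by (intro continuous_map_real_abs continuous_map_diff p_cont) auto
    from openin_continuous_map_preimage[OF this, of "{..<e}"]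
    show "openin K {x \<in> topspace K. \<bar>p i d - p i x\<bar> < e}" by simp
  qed
  have "topspace K \<subseteq> \<Union>(V ` topspace K)" using \<open>e > 0\<close> by (auto simp: V_def)
  then obtain \<F> where \<F>: "finite \<F>" "\<F> \<subseteq> V ` topspace K" "topspace K \<subseteq> \<Union>\<F>"
    using V compact unfolding compact_space_def compactin_def by (metis (no_types, lifting) imageE)
  then obtain D where D: "finite D" "D \<subseteq> topspace K" "\<F> = V ` D"
    by (meson finite_subset_image)
  have "\<exists>d\<in>D. \<forall>i\<in>F. \<bar>p i d - p i x\<bar> < e" if x: "x \<in> topspace K" for x
  proof -
    obtain d where "d \<in> D" "x \<in> V d" using x \<F>(3) D(3) by auto
    then show ?thesis by (intro bexI[of _ d]) (auto simp: V_def)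
  qed
  with D show ?thesis by blast
qed

text \<open>The restrictions of \<open>D\<close> to \<open>J\<close> are dense among the
  restrictions of all points. \<open>D\<close> is the union of finite nets over the countably many
  pairs of a finite subset of \<open>J\<close> and a precision.\<close>

lemma ex_countable_net:
  assumes J: "countable J" "J \<subseteq> I"
  shows "\<exists>D. countable D \<and> D \<subseteq> topspace K \<and>
     (\<forall>F n. finite F \<and> F \<subseteq> J \<longrightarrow> (\<forall>x\<in>topspace K. \<exists>d\<in>D. \<forall>i\<in>F. \<bar>p i d - p i x\<bar> < 1 / real (Suc n)))"
proof -
  have "\<forall>z. \<exists>D. finite (fst z) \<and> fst z \<subseteq> J \<longrightarrow> finite D \<and> D \<subseteq> topspace K \<and>
      (\<forall>x\<in>topspace K. \<exists>d\<in>D. \<forall>i\<in>fst z. \<bar>p i d - p i x\<bar> < 1 / real (Suc (snd z)))"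
  proof
    fix z :: "'i set \<times> nat"
    show "\<exists>D. finite (fst z) \<and> fst z \<subseteq> J \<longrightarrow> finite D \<and> D \<subseteq> topspace K \<and>
      (\<forall>x\<in>topspace K. \<exists>d\<in>D. \<forall>i\<in>fst z. \<bar>p i d - p i x\<bar> < 1 / real (Suc (snd z)))"
      using ex_finite_net[of "fst z" "1 / real (Suc (snd z))"] J(2) by (cases "finite (fst z) \<and> fst z \<subseteq> J") auto
  qed
  from choice[OF this] obtain D :: "'i set \<times> nat \<Rightarrow> 'a set" where
    D0: "\<forall>z. finite (fst z) \<and> fst z \<subseteq> J \<longrightarrow> finite (D z) \<and> D z \<subseteq> topspace K \<and>
      (\<forall>x\<in>topspace K. \<exists>d\<in>D z. \<forall>i\<in>fst z. \<bar>p i d - p i x\<bar> < 1 / real (Suc (snd z)))" ..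
  have D: "finite (D (F, n)) \<and> D (F, n) \<subseteq> topspace K \<and>
      (\<forall>x\<in>topspace K. \<exists>d\<in>D (F, n). \<forall>i\<in>F. \<bar>p i d - p i x\<bar> < 1 / real (Suc n))"
    if "finite F" "F \<subseteq> J" for F n
    using D0[THEN spec, of "(F, n)"] that unfolding fst_conv snd_conv by blast
  define E where "E = (\<Union>F\<in>{F. finite F \<and> F \<subseteq> J}. \<Union>n. D (F, n))"
  have "countable E"
    unfolding E_def using D by (intro countable_UN countable_Collect_finite_subset J) (auto intro: countable_finite)
  moreover have "E \<subseteq> topspace K" unfolding E_def using D by blast
  moreover have "\<exists>d\<in>E. \<forall>i\<in>F. \<bar>p i d - p i x\<bar> < 1 / real (Suc n)"
    if F: "finite F" "F \<subseteq> J" and x: "x \<in> topspace K" for F n x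
  proof -
    obtain d where "d \<in> D (F, n)" "\<forall>i\<in>F. \<bar>p i d - p i x\<bar> < 1 / real (Suc n)"
      using D[OF F, of n] x by blast
    then show ?thesis using F unfolding E_def by blast
  qed
  ultimately show ?thesis by (intro exI[of _ E]) simp
qed

text \<open>A closing-off argument: repeatedly add the supports of a countable set that is dense
  over the current coordinates. In the union \<open>J\<close>, each \<open>x\<close> is approximated
  on finite subsets of \<open>J\<close> by points supported in \<open>J\<close>, and compactness
  yields a point of the space that equals \<open>x\<close> on \<open>J\<close> and vanishes off
  it.\<close>

lemma ex_\<Gamma>_superset:
  assumes J0: "countable J0" "J0 \<subseteq> I"
  shows "\<exists>J\<in>\<Gamma>. J0 \<subseteq> J"
proof -
  define D where "D J = (SOME D. countable D \<and> D \<subseteq> topspace K \<and>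
     (\<forall>F n. finite F \<and> F \<subseteq> J \<longrightarrow> (\<forall>x\<in>topspace K. \<exists>d\<in>D. \<forall>i\<in>F. \<bar>p i d - p i x\<bar> < 1 / real (Suc n))))" for J
  have D: "countable (D J) \<and> D J \<subseteq> topspace K \<and>
     (\<forall>F n. finite F \<and> F \<subseteq> J \<longrightarrow> (\<forall>x\<in>topspace K. \<exists>d\<in>D J. \<forall>i\<in>F. \<bar>p i d - p i x\<bar> < 1 / real (Suc n)))"
    if "countable J" "J \<subseteq> I" for J
    unfolding D_def by (rule someI_ex[OF ex_countable_net[OF that]])
  define S where "S n = ((\<lambda>J. J \<union> (\<Union>d\<in>D J. {i \<in> I. p i d \<noteq> 0})) ^^ n) J0" for n
  have S_Suc: "S (Suc n) = S n \<union> (\<Union>d\<in>D (S n). {i \<in> I. p i d \<noteq> 0})" for n by (simp add: S_def)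
  have S: "countable (S n) \<and> S n \<subseteq> I" for n
  proof (induction n)
    case 0
    then show ?case using J0 by (simp add: S_def)
  next
    case (Suc n)
    then have "countable (D (S n))" "D (S n) \<subseteq> topspace K" using D by blast+
    then have "countable (\<Union>d\<in>D (S n). {i \<in> I. p i d \<noteq> 0})"
      by (intro countable_UN countable_support) auto
    then show ?case using Suc unfolding S_Suc by auto
  qed
  have S_mono: "S m \<subseteq> S n" if "m \<le> n" for m n
    using that by (induction rule: dec_induct) (auto simp: S_Suc)
  define J where "J = (\<Union>n. S n)"
  have J: "J \<subseteq> I" "countable J" using S by (auto simp: J_def)
  have "J0 \<subseteq> J"
  proof -
    have "S 0 = J0" by (simp add: S_def)
    then show ?thesis unfolding J_def by blast
  qed
  have "\<exists>y\<in>topspace K. \<forall>i\<in>I. p i y = (if i \<in> J then p i x else 0)" if x: "x \<in> topspace K" for x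
  proof -
    define C where "C z = {y \<in> topspace K. \<forall>i\<in>fst z. \<bar>p i y - p i x\<bar> \<le> 1 / real (Suc (snd z))} \<inter>
       {y \<in> topspace K. \<forall>i\<in>I - J. p i y = 0}" for z :: "'i set \<times> nat"
    have "(\<Inter>z\<in>{F. finite F \<and> F \<subseteq> J} \<times> UNIV. C z) \<noteq> {}"
    proof (rule compact_space_directed_Inter[OF compact])
      fix z w assume z: "z \<in> {F. finite F \<and> F \<subseteq> J} \<times> (UNIV :: nat set)"
      show "closedin K (C z)"
        unfolding C_def using z J(1) by (intro closedin_Int closedin_zero closedin_Collect_ball closedin_box) auto
      obtain F n where Fn: "z = (F, n)" "finite F" "F \<subseteq> J" using z by auto
      obtain k where k: "F \<subseteq> S k"
        using finite_subset_incseq_UN[of F S] Fn S_mono unfolding J_def by blast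
      obtain d where d: "d \<in> D (S k)" "\<forall>i\<in>F. \<bar>p i d - p i x\<bar> < 1 / real (Suc n)"
        using D[of "S k"] S[of k] Fn(2) k x by blast
      have "d \<in> topspace K" using D[of "S k"] S[of k] d(1) by blast
      moreover have "p i d = 0" if "i \<in> I - J" for i
      proof (rule ccontr)
        assume "p i d \<noteq> 0"
        then have "i \<in> S (Suc k)" using that d(1) unfolding S_Suc by blast
        then show False using that unfolding J_def by blast
      qed
      ultimately have "d \<in> C z" using d(2) by (auto simp: C_def Fn)
      then show "C z \<noteq> {}" by blast
      assume w: "w \<in> {F. finite F \<and> F \<subseteq> J} \<times> (UNIV :: nat set)"
      define v where "v = (fst z \<union> fst w, max (snd z) (snd w))"
      have "1 / real (Suc (snd v)) \<le> 1 / real (Suc (snd z))" "1 / real (Suc (snd v)) \<le> 1 / real (Suc (snd w))"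
        unfolding v_def by (auto intro!: divide_left_mono)
      then have "C v \<subseteq> C z \<inter> C w"
        unfolding C_def by (auto simp: v_def simp del: of_nat_Suc intro: order_trans)
      moreover have "v \<in> {F. finite F \<and> F \<subseteq> J} \<times> UNIV" using z w by (auto simp: v_def)
      ultimately show "\<exists>c\<in>{F. finite F \<and> F \<subseteq> J} \<times> UNIV. C c \<subseteq> C z \<inter> C w" by blast
    qed auto
    then obtain y where y: "\<And>F n. finite F \<Longrightarrow> F \<subseteq> J \<Longrightarrow> y \<in> C (F, n)" by auto
    have yK: "y \<in> topspace K" "\<forall>i\<in>I - J. p i y = 0" using y[of "{}" 0] by (auto simp: C_def)
    have "p i y = p i x" if i: "i \<in> J" for i
    proof (rule ccontr)
      assume "p i y \<noteq> p i x"
      then obtain n where "1 / real (Suc n) < \<bar>p i y - p i x\<bar>"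
        using nat_approx_posE[of "\<bar>p i y - p i x\<bar>"] by auto
      moreover have "\<bar>p i y - p i x\<bar> \<le> 1 / real (Suc n)" using y[of "{i}" n] i by (auto simp: C_def)
      ultimately show False by linarith
    qed
    with yK show ?thesis by (intro bexI[of _ y]) auto
  qed
  then have "J \<in> \<Gamma>" using J by (simp add: \<Gamma>_def)
  with \<open>J0 \<subseteq> J\<close> show ?thesis by blast
qed

lemma increasing_seqD:
  assumes "increasing_seq \<Gamma> R \<sigma>"
  shows "\<sigma> n \<in> \<Gamma>" "m \<le> n \<Longrightarrow> \<sigma> m \<subseteq> \<sigma> n"
proof -
  have *: "\<sigma> n \<in> \<Gamma>" "\<sigma> n \<subseteq> \<sigma> (Suc n)" for n
    using assms by (auto simp: increasing_seq_def R_def)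
  show "\<sigma> n \<in> \<Gamma>" by (rule *)
  show "m \<le> n \<Longrightarrow> \<sigma> m \<subseteq> \<sigma> n" by (rule lift_Suc_mono_le[of \<sigma>]) (use * in auto)
qed

text \<open>The points \<open>r (\<sigma> n) x\<close> agree with \<open>x\<close> on growing sets
  and vanish off the union; a common point of the corresponding closed sets is the restriction of
  \<open>x\<close> to the union.\<close>

lemma UN_in_\<Gamma>:
  assumes \<sigma>: "increasing_seq \<Gamma> R \<sigma>" shows "(\<Union>n. \<sigma> n) \<in> \<Gamma>"
proof -
  note \<sigma>D = increasing_seqD[OF \<sigma>]
  have J: "(\<Union>n. \<sigma> n) \<subseteq> I" "countable (\<Union>n. \<sigma> n)"
    using \<sigma>D(1) unfolding \<Gamma>_def by auto
  have "\<exists>y\<in>topspace K. \<forall>i\<in>I. p i y = (if i \<in> (\<Union>n. \<sigma> n) then p i x else 0)"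
    if x: "x \<in> topspace K" for x
  proof -
    \<comment> \<open>Equality is written as a distance at most 0, so that
      \<open>closedin_box\<close> applies.\<close>
    define C where "C n = {y \<in> topspace K. \<forall>i\<in>\<sigma> n. \<bar>p i y - p i x\<bar> \<le> 0} \<inter>
      {y \<in> topspace K. \<forall>i\<in>I - (\<Union>n. \<sigma> n). p i y = 0}" for n
    have "(\<Inter>n\<in>UNIV. C n) \<noteq> {}"
    proof (rule compact_space_directed_Inter[OF compact])
      fix n m
      show "closedin K (C n)"
        unfolding C_def using J(1) by (intro closedin_Int closedin_zero closedin_Collect_ball closedin_box) auto
      have "i \<in> I" if "i \<in> \<sigma> n" for i using J(1) that by blast
      then have "r (\<sigma> n) x \<in> C n"
        unfolding C_def by (auto simp: r_in[OF \<sigma>D(1) x] p_r[OF \<sigma>D(1) x])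
      then show "C n \<noteq> {}" by blast
      have "C (max n m) \<subseteq> C n \<inter> C m"
        using \<sigma>D(2)[of n "max n m"] \<sigma>D(2)[of m "max n m"] unfolding C_def by auto
      then show "\<exists>k\<in>UNIV. C k \<subseteq> C n \<inter> C m" by blast
    qed auto
    then obtain y where y: "\<And>n. y \<in> C n" by auto
    then show ?thesis by (intro bexI[of _ y]) (auto simp: C_def)
  qed
  with J show ?thesis unfolding \<Gamma>_def by blast
qed

lemma is_sup_seq_iff:
  assumes \<sigma>: "increasing_seq \<Gamma> R \<sigma>" shows "is_sup_seq \<Gamma> R \<sigma> s \<longleftrightarrow> s = (\<Union>n. \<sigma> n)"
  using UN_in_\<Gamma>[OF \<sigma>] increasing_seqD(1)[OF \<sigma>] unfolding is_sup_seq_def R_def by blast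

text \<open>Points of the range vanish off the countable \<open>J\<close>, so their coordinates in
  \<open>J\<close> embed the range into a countable power of the reals.\<close>

lemma r_metrizable:
  assumes J: "J \<in> \<Gamma>"
  shows "compact_space (subtopology K (r J ` topspace K)) \<and> metrizable_space (subtopology K (r J ` topspace K))"
proof
  define X where "X = subtopology K (r J ` topspace K)"
  have "compactin K (r J ` topspace K)"
    using image_compactin[OF _ r_cont[OF J]] compact unfolding compact_space_def by blast
  then show cX: "compact_space (subtopology K (r J ` topspace K))"
    by (rule compact_space_subtopology)
  have JI: "J \<subseteq> I" "countable J" using J by (auto simp: \<Gamma>_def)
  define q where "q x = (\<lambda>i\<in>J. p i x)" for x
  have "continuous_map X (powertop_real J) q"
    unfolding continuous_map_componentwise X_def
    using JI(1) p_cont by (auto simp: q_def intro: continuous_map_from_subtopology)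
  moreover have "inj_on q (topspace X)"
  proof (rule inj_onI)
    fix x y assume "x \<in> topspace X" "y \<in> topspace X" and eq: "q x = q y"
    then obtain x' y' where x: "x' \<in> topspace K" "x = r J x'" and y: "y' \<in> topspace K" "y = r J y'"
      by (auto simp: X_def)
    show "x = y"
    proof (rule p_sep)
      fix i assume i: "i \<in> I"
      show "p i x = p i y"
      proof (cases "i \<in> J")
        case True
        then show ?thesis using fun_cong[OF eq, of i] by (simp add: q_def)
      next
        case False
        then show ?thesis using i x y p_r[OF J] by simp
      qed
    qed (use x y r_in[OF J] in auto)
  qed
  ultimately have "embedding_map X (powertop_real J) q"
    using cX by (intro continuous_imp_embedding_map) (simp_all add: X_def Hausdorff_space_product_topology)
  then have "X homeomorphic_space subtopology (powertop_real J) (q ` topspace X)"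
    by (rule embedding_map_imp_homeomorphic_space)
  moreover have "metrizable_space (powertop_real J)"
    unfolding metrizable_space_product_topology
    using JI(2) metrizable_space_euclidean by (auto intro: countable_subset[of _ J])
  ultimately show "metrizable_space (subtopology K (r J ` topspace K))"
    unfolding X_def[symmetric] using homeomorphic_metrizable_space metrizable_space_subtopology by blast
qed

lemma retractional_skeleton_restrictions: "retractional_skeleton K \<Gamma> R r"
proof -
  have po: "partial_order_on \<Gamma> R"
    unfolding partial_order_on_def preorder_on_def refl_on_def trans_def antisym_def R_def by auto
  have up: "up_directed \<Gamma> R"
    unfolding up_directed_def
  proof (intro conjI ballI)
    show "\<Gamma> \<noteq> {}" using ex_\<Gamma>_superset[of "{}"] by auto
    fix s t assume st: "s \<in> \<Gamma>" "t \<in> \<Gamma>"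
    then have "countable (s \<union> t)" "s \<union> t \<subseteq> I" by (auto simp: \<Gamma>_def)
    then obtain u where "u \<in> \<Gamma>" "s \<union> t \<subseteq> u" using ex_\<Gamma>_superset by blast
    then show "\<exists>u\<in>\<Gamma>. (s, u) \<in> R \<and> (t, u) \<in> R" using st by (auto simp: R_def)
  qed
  have sc: "sigma_complete \<Gamma> R"
    unfolding sigma_complete_def using is_sup_seq_iff by blast
  have lim: "limitin K (\<lambda>n. r (\<sigma> n) x) (r s x) sequentially"
    if \<sigma>: "increasing_seq \<Gamma> R \<sigma>" "is_sup_seq \<Gamma> R \<sigma> s" and x: "x \<in> topspace K" for \<sigma> s x
  proof -
    note \<sigma>D = increasing_seqD[OF \<sigma>(1)]
    have s: "s = (\<Union>n. \<sigma> n)" "s \<in> \<Gamma>" using is_sup_seq_iff[OF \<sigma>(1)] \<sigma>(2) UN_in_\<Gamma>[OF \<sigma>(1)] by auto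
    show ?thesis
    proof (rule limitin_compact_separated[OF compact r_in[OF s(2) x], of _ _ I p])
      show "\<forall>\<^sub>F n in sequentially. r (\<sigma> n) x \<in> topspace K" using r_in[OF \<sigma>D(1) x] by simp
      fix i assume i: "i \<in> I"
      have "\<forall>\<^sub>F n in sequentially. p i (r (\<sigma> n) x) = p i (r s x)"
      proof (cases "i \<in> s")
        case True
        then obtain N where "i \<in> \<sigma> N" using s by blast
        then have "i \<in> \<sigma> n" if "n \<ge> N" for n using \<sigma>D(2)[OF that] by blast
        then show ?thesis
          using True i by (auto simp: eventually_sequentially p_r[OF \<sigma>D(1) x] p_r[OF s(2) x] intro!: exI[of _ N])
      next
        case False
        moreover from this have "i \<notin> \<sigma> n" for n using s(1) by blast
        ultimately show ?thesis by (simp add: p_r[OF \<sigma>D(1) x i] p_r[OF s(2) x i])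
      qed
      then show "((\<lambda>n. p i (r (\<sigma> n) x)) \<longlongrightarrow> p i (r s x)) sequentially"
        by (rule tendsto_eventually)
    next
      fix w assume "w \<in> topspace K" "w \<noteq> r s x"
      then show "\<exists>i\<in>I. p i w \<noteq> p i (r s x)" using p_sep r_in[OF s(2) x] by blast
    qed (rule p_cont)
  qed
  have net: "limitin K (\<lambda>s. r s x) x (tails \<Gamma> R)" if x: "x \<in> topspace K" for x
  proof (rule limitin_eventually[OF x])
    \<comment> \<open>Supports are countable, so the net is constant once the index contains the
      support of \<open>x\<close>.\<close>
    obtain J where J: "J \<in> \<Gamma>" "{i \<in> I. p i x \<noteq> 0} \<subseteq> J"
      using ex_\<Gamma>_superset[OF countable_support[OF x]] by auto
    have "r t x = x" if "t \<in> \<Gamma>" "(J, t) \<in> R" for t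
      by (rule r_fix[OF that(1) x]) (use J that in \<open>auto simp: R_def\<close>)
    then show "\<forall>\<^sub>F s in tails \<Gamma> R. r s x = x"
      unfolding eventually_tails[OF po up] using J by blast
  qed
  show ?thesis
    unfolding retractional_skeleton_def
  proof (intro conjI ballI allI impI po up sc net)
    fix s assume s: "s \<in> \<Gamma>"
    show "continuous_map K K (r s)" by (rule r_cont[OF s])
    show "r s (r s x) = r s x" if "x \<in> topspace K" for x by (rule r_r[OF s s order_refl that])
    show "compact_space (subtopology K (r s ` topspace K))" "metrizable_space (subtopology K (r s ` topspace K))"
      using r_metrizable[OF s] by blast+
    show "r s x = r t (r s x)" "r s x = r s (r t x)"
      if "t \<in> \<Gamma>" "(s, t) \<in> R" "x \<in> topspace K" for t x
      using r_r[OF s that(1) _ that(3)] that(2) by (simp_all add: R_def)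
  next
    show "limitin K (\<lambda>n. r (\<sigma> n) x) (r s x) sequentially"
      if "increasing_seq \<Gamma> R \<sigma> \<and> is_sup_seq \<Gamma> R \<sigma> s" "x \<in> topspace K" for \<sigma> s x
      using lim that by blast
  qed
qed

text \<open>The coordinates of \<open>r (\<sigma> n) x\<close> and \<open>r s x\<close> differ only
  at \<open>i \<in> s - \<sigma> n\<close>, and there by \<open>p i x\<close>. The finitely many
  \<open>i \<in> s\<close> at which this exceeds \<open>\<epsilon>\<close> in absolute value all lie
  in some \<open>\<sigma> N\<close>.\<close>

lemma has_shrinking_skeleton:
  assumes bd: "\<And>i x. i \<in> I \<Longrightarrow> x \<in> topspace K \<Longrightarrow> \<bar>p i x\<bar> \<le> C" and "0 \<le> C"
  shows "has_shrinking_skeleton TYPE('i set) K"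
proof -
  \<comment> \<open>the zero function makes \<open>A\<close> nonempty when \<open>I\<close> is empty\<close>
  define A where "A = insert (\<lambda>x\<in>topspace K. 0) ((\<lambda>i. restrict (p i) (topspace K)) ` I)"
  have A: "A \<subseteq> mspace (cfun K)"
    unfolding mspace_cfun[OF compact] A_def
    using p_cont by (auto intro: continuous_map_eq[of _ _ "\<lambda>x. 0"] continuous_map_eq)
  have bdA: "\<bar>f x\<bar> \<le> C" if "f \<in> A" "x \<in> topspace K" for f x
    using that bd \<open>0 \<le> C\<close> by (auto simp: A_def)
  have "separates_points K A"
    unfolding separates_points_def
  proof (intro ballI impI)
    fix x y assume xy: "x \<in> topspace K" "y \<in> topspace K" "x \<noteq> y"
    then obtain i where "i \<in> I" "p i x \<noteq> p i y" using p_sep by blast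
    then show "\<exists>f\<in>A. f x \<noteq> f y"
      using xy by (intro bexI[of _ "restrict (p i) (topspace K)"]) (auto simp: A_def)
  qed
  moreover have "shrinking K A \<Gamma> R r"
  proof (rule shrinkingI[where C = C])
    show "A \<noteq> {}" by (simp add: A_def)
    show "\<bar>f x\<bar> \<le> C" if "f \<in> A" "x \<in> topspace K" for f x using bdA[OF that] .
    show "r s x \<in> topspace K" if "s \<in> \<Gamma>" "x \<in> topspace K" for s x using r_in[OF that] .
    fix x \<sigma> s and \<epsilon> :: real
    assume x: "x \<in> topspace K" and \<sigma>: "increasing_seq \<Gamma> R \<sigma>" "is_sup_seq \<Gamma> R \<sigma> s" and "\<epsilon> > 0"
    note \<sigma>D = increasing_seqD[OF \<sigma>(1)]
    have s: "s = (\<Union>n. \<sigma> n)" "s \<in> \<Gamma>" using is_sup_seq_iff[OF \<sigma>(1)] \<sigma>(2) UN_in_\<Gamma>[OF \<sigma>(1)] by auto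
    have "finite ({i \<in> I. \<bar>p i x\<bar> > \<epsilon>} \<inter> s)" using p_fin[OF x \<open>\<epsilon> > 0\<close>] by blast
    then obtain N where N: "{i \<in> I. \<bar>p i x\<bar> > \<epsilon>} \<inter> s \<subseteq> \<sigma> N"
      using finite_subset_incseq_UN[of _ \<sigma>] \<sigma>D(2) unfolding s(1) by blast
    have small: "\<bar>p i (r (\<sigma> n) x) - p i (r s x)\<bar> \<le> \<epsilon>" if n: "n \<ge> N" and i: "i \<in> I" for n i
    proof -
      have "\<sigma> N \<subseteq> \<sigma> n" "\<sigma> n \<subseteq> s" using \<sigma>D(2)[OF n] s(1) by auto
      then show ?thesis
        using N i \<open>\<epsilon> > 0\<close> by (auto simp: p_r[OF \<sigma>D(1) x i] p_r[OF s(2) x i])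
    qed
    show "\<exists>N. \<forall>n\<ge>N. \<forall>f\<in>A. \<bar>f (r (\<sigma> n) x) - f (r s x)\<bar> \<le> \<epsilon>"
      using small \<open>\<epsilon> > 0\<close>
      by (intro exI[of _ N]) (auto simp: A_def r_in[OF \<sigma>D(1) x] r_in[OF s(2) x])
  qed
  moreover have "bounded_cfun K A" by (rule bounded_cfunI[OF compact A, where C = C]) (rule bdA \<open>0 \<le> C\<close>; assumption?)+
  ultimately show ?thesis
    unfolding has_shrinking_skeleton_def
    using A retractional_skeleton_restrictions
    by (intro exI[of _ A] exI[of _ \<Gamma>] exI[of _ R] exI[of _ r]) (auto simp: A_def simp del: mspace_cfunspace)
qed

end

text \<open>Composing the coordinates with \<open>arctan\<close> makes them uniformly bounded. It is
  injective, so separation survives, and it does not increase absolute values, so the finiteness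
  condition survives as well.\<close>

lemma eberlein_imp_shrinking:
  fixes K :: "'a topology"
  assumes K: "compact_space K" "Hausdorff_space K" and "eberlein_compact K"
  shows "has_shrinking_skeleton TYPE(('a \<Rightarrow> real) set) K"
proof -
  obtain I :: "('a \<Rightarrow> real) set" and f where f: "embedding_map K (c0_space I) f"
    using assms(3) by (auto simp: eberlein_compact_def)
  have cf: "continuous_map K (c0_space I) f"
    using f unfolding embedding_map_def
    by (meson continuous_map_in_subtopology homeomorphic_imp_continuous_map)
  have inj: "inj_on f (topspace K)"
    using f by (simp add: embedding_map_def homeomorphic_eq_everything_map)
  have fc0: "f x \<in> topspace (c0_space I)" if "x \<in> topspace K" for x
    using cf that by (auto simp: continuous_map_def)
  interpret c0_family K I "\<lambda>i x. arctan (f x i)"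
  proof
    fix i assume "i \<in> I"
    then have "continuous_map K euclideanreal (\<lambda>x. f x i)"
      using cf unfolding c0_space_def by (simp add: continuous_map_in_subtopology continuous_map_componentwise)
    moreover have "continuous_map euclideanreal euclideanreal arctan"
      by (simp add: continuous_on_arctan)
    ultimately show "continuous_map K euclideanreal (\<lambda>x. arctan (f x i))"
      by (rule continuous_map_compose[unfolded o_def])
  next
    fix x y assume xy: "x \<in> topspace K" "y \<in> topspace K" "\<And>i. i \<in> I \<Longrightarrow> arctan (f x i) = arctan (f y i)"
    have "f x \<in> extensional I" "f y \<in> extensional I"
      using fc0[OF xy(1)] fc0[OF xy(2)] by (auto simp: c0_space_def PiE_def)
    then have "f x = f y"
      using xy(3) by (meson arctan_eq_iff extensionalityI)
    with inj xy show "x = y" by (auto dest: inj_onD)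
  next
    fix x and \<epsilon> :: real assume x: "x \<in> topspace K" "\<epsilon> > 0"
    then have "finite {i \<in> I. \<bar>f x i\<bar> > \<epsilon>}" using fc0[OF x(1)] by (simp add: c0_space_def)
    then show "finite {i \<in> I. \<bar>arctan (f x i)\<bar> > \<epsilon>}"
      by (rule rev_finite_subset) (auto intro: less_le_trans[OF _ abs_arctan_le])
  qed (rule K)+
  show ?thesis
  proof (rule has_shrinking_skeleton)
    show "\<bar>arctan (f x i)\<bar> \<le> 2" for i x
      using arctan_lbound[of "f x i"] arctan_ubound[of "f x i"] pi_half_less_two by linarith
  qed simp
qed

(* The index type of a skeleton cannot be existentially quantified. The first two conjuncts are
   the equivalences at one sufficiently large index type; the last two allow skeletons over an
   arbitrary index type in the hypotheses, so no generality is lost.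
   The space is nonempty: on the empty space B_C(K) is a single point and has only one nonempty
   subset, so the covering condition with eps_A -> 0 fails although the empty space is Eberlein. *)
theorem theorem1:
  fixes K :: "'a topology"
  assumes "compact_space K" and "Hausdorff_space K" and "topspace K \<noteq> {}"
  shows "(eberlein_compact K \<longleftrightarrow> has_shrinking_skeleton TYPE(('a \<Rightarrow> real) set) K) \<and>
         (eberlein_compact K \<longleftrightarrow>
            has_countably_shrinking_full_skeleton TYPE(('a \<Rightarrow> real) set) K) \<and>
         (has_shrinking_skeleton TYPE('i) K \<longrightarrow> eberlein_compact K) \<and>
         (has_countably_shrinking_full_skeleton TYPE('j) K \<longrightarrow> eberlein_compact K)"
  proof (intro conjI iffI impI)
  note K = assms(1,2)
  assume E: "eberlein_compact K"
  show "has_shrinking_skeleton TYPE(('a \<Rightarrow> real) set) K"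
    by (rule eberlein_imp_shrinking[OF K E])
  then show "has_countably_shrinking_full_skeleton TYPE(('a \<Rightarrow> real) set) K"
    by (rule shrinking_imp_countably_shrinking_skeleton[OF assms])
\<comment> \<open>What remains are implications into \<open>eberlein_compact K\<close>; those
  starting from (2) pass through (3).\<close>
qed (rule countably_shrinking_imp_eberlein[OF assms], assumption |
    rule countably_shrinking_imp_eberlein[OF assms],
    rule shrinking_imp_countably_shrinking_skeleton[OF assms], assumption)+

end
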